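(* For all integers $N\ge 2$, the free unitary group $U^+_N$ is topologically generated by its quantum subgroups $U_N$ and $\mathbb{T}^+_N=\widehat{\mathbb{Z}^{*N}}$: $$U^+_N=\langle U_N,\ \mathbb{T}^+_N\rangle.$$
   Context: A CQG algebra is a complex Hopf $*$-algebra $\mathcal{A}$ that is cosemisimple and whose unique unital (left and right) integral $h:\mathcal{A}\to\mathbb{C}$ is positive, i.e. $h(x^*x)\ge 0$ for all $x\in\mathcal{A}$. The category of compact quantum groups is the category dual to that of CQG algebras; $\mathcal{O}(G)$ denotes the CQG algebra attached to a compact quantum group $G$. For an ordinary compact group $G$, $\mathcal{O}(G)$ is the algebra of representative functions. A quantum subgroup $H\le G$ means a quotient Hopf $*$-algebra $\mathcal{O}(G)\to\mathcal{O}(H)$. Topological generation: a family $G_i\le G$, $i\in I$, of quantum subgroups topologically generates $G$, written $G=\langle G_i,\ i\in I\rangle$, if the quotient maps $\mathcal{O}(G)\to\mathcal{O}(G_i)$, $i\in I$, do not all factor through one and the same proper quotient Hopf $*$-algebra of $\mathcal{O}(G)$. For a discrete group $\Gamma$, $\widehat{\Gamma}$ denotes the compact quantum group with $\mathcal{O}(\widehat{\Gamma})=\mathbb{C}\Gamma$, the group algebra with every $\gamma\in\Gamma$ unitary, $\Delta(\gamma)=\gamma\otimes\gamma$ and $\varepsilon(\gamma)=1$. Free unitary group: for $N\ge 2$, $U^+_N$ is the compact quantum group whose CQG algebra $\mathcal{O}(U^+_N)$ is generated as a $*$-algebra by $u_{ij}$, $1\le i,j\le N$, subject to the relations that both matrices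 $u=(u_{ij})_{i,j}$ and $\overline{u}=(u_{ij}^* )_{i,j}$ in $M_N(\mathcal{O}(U^+_N))$ are unitary, with $\Delta(u_{ij})=\sum_k u_{ik}\otimes u_{kj}$ and $\varepsilon(u_{ij})=\delta_{ij}$. The classical unitary group $U_N$ is a quantum subgroup of $U^+_N$ by sending $u_{ij}$ to the $(i,j)$ coordinate function on $U_N$. The quantum group $\mathbb{T}^+_N:=\widehat{\mathbb{Z}^{*N}}$, the dual of the free group on $N$ generators $g_1,\dots,g_N$, is a quantum subgroup of $U^+_N$ via $u_{ij}\mapsto\delta_{ij}g_i$ (annihilating the off-diagonal generators). *)

theory Defs
  imports
    "HOL-Analysis.Analysis"
    "HOL-Library.Poly_Mapping"
    "HOL-Algebra.Module"
    "HOL-Algebra.QuotRing"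
begin

section \<open>Complex *-algebras\<close>

record 'a star_alg = "(complex, 'a) module" +
  star :: "'a \<Rightarrow> 'a"

definition complex_alg :: "complex star_alg" where
  "complex_alg =
    \<lparr>carrier = UNIV, mult = (*), one = 1, zero = 0, add = (+), smult = (*), star = cnj\<rparr>"

definition star_algebra :: "('a, 'm) star_alg_scheme \<Rightarrow> bool" where
  "star_algebra A \<longleftrightarrow>
     ring A \<and> Module.module complex_alg A \<and>
     (\<forall>c. \<forall>x\<in>carrier A. \<forall>y\<in>carrier A.
        (c \<odot>\<^bsub>A\<^esub> x) \<otimes>\<^bsub>A\<^esub> y = c \<odot>\<^bsub>A\<^esub> (x \<otimes>\<^bsub>A\<^esub> y) \<and>
        x \<otimes>\<^bsub>A\<^esub> (c \<odot>\<^bsub>A\<^esub> y) = c \<odot>\<^bsub>A\<^esub> (x \<otimes>\<^bsub>A\<^esub> y)) \<and>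
     (\<forall>x\<in>carrier A. star A x \<in> carrier A \<and> star A (star A x) = x) \<and>
     (\<forall>c. \<forall>x\<in>carrier A. star A (c \<odot>\<^bsub>A\<^esub> x) = cnj c \<odot>\<^bsub>A\<^esub> star A x) \<and>
     (\<forall>x\<in>carrier A. \<forall>y\<in>carrier A.
        star A (x \<oplus>\<^bsub>A\<^esub> y) = star A x \<oplus>\<^bsub>A\<^esub> star A y \<and>
        star A (x \<otimes>\<^bsub>A\<^esub> y) = star A y \<otimes>\<^bsub>A\<^esub> star A x)"

definition linear_map ::
  "('a, 'm) star_alg_scheme \<Rightarrow> ('b, 'k) star_alg_scheme \<Rightarrow> ('a \<Rightarrow> 'b) \<Rightarrow> bool" where
  "linear_map A B f \<longleftrightarrow>
     f \<in> carrier A \<rightarrow> carrier B \<and>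
     (\<forall>x\<in>carrier A. \<forall>y\<in>carrier A. f (x \<oplus>\<^bsub>A\<^esub> y) = f x \<oplus>\<^bsub>B\<^esub> f y) \<and>
     (\<forall>c. \<forall>x\<in>carrier A. f (c \<odot>\<^bsub>A\<^esub> x) = c \<odot>\<^bsub>B\<^esub> f x)"

definition star_alg_hom ::
  "('a, 'm) star_alg_scheme \<Rightarrow> ('b, 'k) star_alg_scheme \<Rightarrow> ('a \<Rightarrow> 'b) \<Rightarrow> bool" where
  "star_alg_hom A B f \<longleftrightarrow>
     f \<in> ring_hom A B \<and> linear_map A B f \<and> (\<forall>x\<in>carrier A. f (star A x) = star B (f x))"

text \<open>The *-algebra with basis a monoid \<open>M\<close>, the involution being the conjugate-linear
  extension of an involutive antiautomorphism \<open>\<iota>\<close> of \<open>M\<close>.\<close>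

definition star_monoid_alg :: "('m, 'k) monoid_scheme \<Rightarrow> ('m \<Rightarrow> 'm) \<Rightarrow> ('m \<Rightarrow>\<^sub>0 complex) star_alg"
  where
  "star_monoid_alg M \<iota> =
    \<lparr>carrier = {f. Poly_Mapping.keys f \<subseteq> carrier M},
     mult = (\<lambda>f g. \<Sum>a\<in>Poly_Mapping.keys f. \<Sum>b\<in>Poly_Mapping.keys g.
        Poly_Mapping.single (a \<otimes>\<^bsub>M\<^esub> b) (Poly_Mapping.lookup f a * Poly_Mapping.lookup g b)),
     one = Poly_Mapping.single \<one>\<^bsub>M\<^esub> 1,
     zero = 0,
     add = (+),
     smult = (\<lambda>c. Poly_Mapping.map ((*) c)),
     star = (\<lambda>f. \<Sum>a\<in>Poly_Mapping.keys f.
        Poly_Mapping.single (\<iota> a) (cnj (Poly_Mapping.lookup f a)))\<rparr>"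

text \<open>The ring part is \<open>F Quot I\<close> (so elements are cosets of \<open>I\<close>), with the induced
  scalar multiplication and involution.\<close>

definition quot_star_alg :: "('a, 'm) star_alg_scheme \<Rightarrow> 'a set \<Rightarrow> 'a set star_alg" where
  "quot_star_alg F I =
    \<lparr>carrier = carrier (F Quot I), mult = mult (F Quot I), one = one (F Quot I),
     zero = zero (F Quot I), add = add (F Quot I),
     smult = (\<lambda>c X. \<Union>x\<in>X. I +>\<^bsub>F\<^esub> (c \<odot>\<^bsub>F\<^esub> x)),
     star = (\<lambda>X. \<Union>x\<in>X. I +>\<^bsub>F\<^esub> star F x)\<rparr>"

definition star_ideal_generated :: "('a, 'm) star_alg_scheme \<Rightarrow> 'a set \<Rightarrow> 'a set" where
  "star_ideal_generated F S = \<Inter>{I. ideal I F \<and> (\<forall>x\<in>I. star F x \<in> I) \<and> S \<subseteq> I}"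


section \<open>Algebraic tensor products\<close>

text \<open>\<open>A \<otimes> B\<close> is the space of formal sums of pairs \<open>(a, b)\<close> modulo the bilinearity relations.
  The space of formal sums is the monoid algebra of the multiplicative monoid of \<open>A \<times> B\<close>, and
  its product and involution descend to \<open>(a \<otimes> b)(a' \<otimes> b') = aa' \<otimes> bb'\<close> and
  \<open>(a \<otimes> b)* = a* \<otimes> b*\<close>.\<close>

type_synonym ('a, 'b) tensor = "('a \<times> 'b \<Rightarrow>\<^sub>0 complex) set"

definition formal_sums ::
  "('a, 'm) star_alg_scheme \<Rightarrow> ('b, 'k) star_alg_scheme \<Rightarrow> ('a \<times> 'b \<Rightarrow>\<^sub>0 complex) star_alg" where
  "formal_sums A B = star_monoid_alg (A \<times>\<times> B) (map_prod (star A) (star B))"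

inductive_set tensor_null ::
  "('a, 'm) star_alg_scheme \<Rightarrow> ('b, 'k) star_alg_scheme \<Rightarrow> ('a \<times> 'b \<Rightarrow>\<^sub>0 complex) set"
  for A B where
  zero: "0 \<in> tensor_null A B"
| add: "x \<in> tensor_null A B \<Longrightarrow> y \<in> tensor_null A B \<Longrightarrow> x + y \<in> tensor_null A B"
| smult: "x \<in> tensor_null A B \<Longrightarrow> Poly_Mapping.map ((*) c) x \<in> tensor_null A B"
| add_left: "a \<in> carrier A \<Longrightarrow> a' \<in> carrier A \<Longrightarrow> b \<in> carrier B \<Longrightarrow>
    Poly_Mapping.single (a \<oplus>\<^bsub>A\<^esub> a', b) 1 - Poly_Mapping.single (a, b) 1
      - Poly_Mapping.single (a', b) 1 \<in> tensor_null A B"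
| add_right: "a \<in> carrier A \<Longrightarrow> b \<in> carrier B \<Longrightarrow> b' \<in> carrier B \<Longrightarrow>
    Poly_Mapping.single (a, b \<oplus>\<^bsub>B\<^esub> b') 1 - Poly_Mapping.single (a, b) 1
      - Poly_Mapping.single (a, b') 1 \<in> tensor_null A B"
| smult_left: "a \<in> carrier A \<Longrightarrow> b \<in> carrier B \<Longrightarrow>
    Poly_Mapping.single (c \<odot>\<^bsub>A\<^esub> a, b) 1 - Poly_Mapping.single (a, b) c \<in> tensor_null A B"
| smult_right: "a \<in> carrier A \<Longrightarrow> b \<in> carrier B \<Longrightarrow>
    Poly_Mapping.single (a, c \<odot>\<^bsub>B\<^esub> b) 1 - Poly_Mapping.single (a, b) c \<in> tensor_null A B"

definition tensor_alg ::
  "('a, 'm) star_alg_scheme \<Rightarrow> ('b, 'k) star_alg_scheme \<Rightarrow> ('a, 'b) tensor star_alg" where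
  "tensor_alg A B = quot_star_alg (formal_sums A B) (tensor_null A B)"

definition tensor_class ::
  "('a, 'm) star_alg_scheme \<Rightarrow> ('b, 'k) star_alg_scheme \<Rightarrow> ('a \<times> 'b \<Rightarrow>\<^sub>0 complex) \<Rightarrow> ('a, 'b) tensor"
  where
  "tensor_class A B r = tensor_null A B +>\<^bsub>formal_sums A B\<^esub> r"

definition simple_tensor ::
  "('a, 'm) star_alg_scheme \<Rightarrow> ('b, 'k) star_alg_scheme \<Rightarrow> 'a \<Rightarrow> 'b \<Rightarrow> ('a, 'b) tensor" where
  "simple_tensor A B a b = tensor_class A B (Poly_Mapping.single (a, b) 1)"

text \<open>The linear map \<open>A \<otimes> B \<rightarrow> V\<close> induced by a bilinear map \<open>\<phi>\<close>; for bilinear \<open>\<phi>\<close> the value does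
  not depend on the chosen representative.\<close>

definition tensor_lift ::
  "('v, 'm) star_alg_scheme \<Rightarrow> ('a \<Rightarrow> 'b \<Rightarrow> 'v) \<Rightarrow> ('a, 'b) tensor \<Rightarrow> 'v" where
  "tensor_lift V \<phi> t =
     (let r = (SOME r. r \<in> t) in
      finsum V (\<lambda>(a, b). Poly_Mapping.lookup r (a, b) \<odot>\<^bsub>V\<^esub> \<phi> a b) (Poly_Mapping.keys r))"

definition tensor_map ::
  "('c, 'm) star_alg_scheme \<Rightarrow> ('d, 'k) star_alg_scheme \<Rightarrow> ('a \<Rightarrow> 'c) \<Rightarrow> ('b \<Rightarrow> 'd) \<Rightarrow>
    ('a, 'b) tensor \<Rightarrow> ('c, 'd) tensor" where
  "tensor_map C D f g = tensor_lift (tensor_alg C D) (\<lambda>a b. simple_tensor C D (f a) (g b))"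

definition tensor_assoc ::
  "('a, 'm) star_alg_scheme \<Rightarrow> ('b, 'k) star_alg_scheme \<Rightarrow> ('c, 'l) star_alg_scheme \<Rightarrow>
    (('a, 'b) tensor, 'c) tensor \<Rightarrow> ('a, ('b, 'c) tensor) tensor" where
  "tensor_assoc A B C =
     (let BC = tensor_alg B C; T = tensor_alg A BC in
      tensor_lift T (\<lambda>t c. tensor_lift T (\<lambda>a b. simple_tensor A BC a (simple_tensor B C b c)) t))"


section \<open>Hopf *-algebras and topological generation\<close>

record 'a hopf_star_alg = "'a star_alg" +
  comult :: "'a \<Rightarrow> ('a \<times> 'a \<Rightarrow>\<^sub>0 complex) set"
  counit :: "'a \<Rightarrow> complex"

definition with_coalgebra ::
  "'a star_alg \<Rightarrow> ('a \<Rightarrow> ('a, 'a) tensor) \<Rightarrow> ('a \<Rightarrow> complex) \<Rightarrow> 'a hopf_star_alg" where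
  "with_coalgebra A \<Delta> \<epsilon> = star_alg.extend A (hopf_star_alg.fields \<Delta> \<epsilon>)"

text \<open>The antipode is uniquely determined and automatically preserved by bialgebra
  homomorphisms, so its existence is a property and not part of the data.\<close>

definition hopf_star_algebra :: "'a hopf_star_alg \<Rightarrow> bool" where
  "hopf_star_algebra H \<longleftrightarrow>
     star_algebra H \<and>
     star_alg_hom H (tensor_alg H H) (comult H) \<and>
     star_alg_hom H complex_alg (counit H) \<and>
     (\<forall>x\<in>carrier H.
        tensor_assoc H H H (tensor_map (tensor_alg H H) H (comult H) (\<lambda>x. x) (comult H x)) =
        tensor_map H (tensor_alg H H) (\<lambda>x. x) (comult H) (comult H x)) \<and>
     (\<forall>x\<in>carrier H.
        tensor_lift H (\<lambda>a b. counit H a \<odot>\<^bsub>H\<^esub> b) (comult H x) = x \<and>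
        tensor_lift H (\<lambda>a b. counit H b \<odot>\<^bsub>H\<^esub> a) (comult H x) = x) \<and>
     (\<exists>S. linear_map H H S \<and>
        (\<forall>x\<in>carrier H.
           tensor_lift H (\<lambda>a b. S a \<otimes>\<^bsub>H\<^esub> b) (comult H x) = counit H x \<odot>\<^bsub>H\<^esub> \<one>\<^bsub>H\<^esub> \<and>
           tensor_lift H (\<lambda>a b. a \<otimes>\<^bsub>H\<^esub> S b) (comult H x) = counit H x \<odot>\<^bsub>H\<^esub> \<one>\<^bsub>H\<^esub>))"

definition hopf_star_hom :: "'a hopf_star_alg \<Rightarrow> 'b hopf_star_alg \<Rightarrow> ('a \<Rightarrow> 'b) \<Rightarrow> bool" where
  "hopf_star_hom H K f \<longleftrightarrow>
     star_alg_hom H K f \<and>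
     (\<forall>x\<in>carrier H. comult K (f x) = tensor_map K K f f (comult H x)) \<and>
     (\<forall>x\<in>carrier H. counit K (f x) = counit H x)"

text \<open>A quotient Hopf *-algebra of a CQG algebra is again spanned by the coefficients of
  finite-dimensional unitary corepresentations and hence is a CQG algebra, so no separate
  condition on the Haar integral of \<open>K\<close> is needed.\<close>

definition hopf_star_quotient :: "'a hopf_star_alg \<Rightarrow> 'b hopf_star_alg \<Rightarrow> ('a \<Rightarrow> 'b) \<Rightarrow> bool" where
  "hopf_star_quotient H K p \<longleftrightarrow>
     hopf_star_algebra K \<and> hopf_star_hom H K p \<and> p ` carrier H = carrier K"

definition factors_through ::
  "'a hopf_star_alg \<Rightarrow> 'q hopf_star_alg \<Rightarrow> ('a \<Rightarrow> 'q) \<Rightarrow> 'b hopf_star_alg \<Rightarrow> ('a \<Rightarrow> 'b) \<Rightarrow> bool" where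
  "factors_through H Q p K f \<longleftrightarrow>
     (\<exists>\<rho>. hopf_star_hom Q K \<rho> \<and> (\<forall>x\<in>carrier H. f x = \<rho> (p x)))"

text \<open>Here \<open>H = O(G)\<close> and \<open>\<pi>\<^sub>i : H \<rightarrow> K\<^sub>i = O(G\<^sub>i)\<close> are the quotient maps of the two
  quantum subgroups.  A quotient is proper iff its quotient map \<open>p\<close> is not injective.  The type argument is the type that carries the quotients of \<open>H\<close>; it is
  meant to be instantiated by a free type variable, so that quotients of every type are covered.\<close>

definition topologically_generated_by ::
  "'q itself \<Rightarrow> 'a hopf_star_alg \<Rightarrow> 'b hopf_star_alg \<Rightarrow> ('a \<Rightarrow> 'b) \<Rightarrow>
    'c hopf_star_alg \<Rightarrow> ('a \<Rightarrow> 'c) \<Rightarrow> bool" where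
  "topologically_generated_by TYPE('q) H K\<^sub>1 \<pi>\<^sub>1 K\<^sub>2 \<pi>\<^sub>2 \<longleftrightarrow>
     \<not> (\<exists>(Q :: 'q hopf_star_alg) p.
          hopf_star_quotient H Q p \<and> \<not> inj_on p (carrier H) \<and>
          factors_through H Q p K\<^sub>1 \<pi>\<^sub>1 \<and> factors_through H Q p K\<^sub>2 \<pi>\<^sub>2)"


section \<open>The free unitary group\<close>

text \<open>\<open>((i, j), False)\<close> stands for \<open>u\<^sub>i\<^sub>j\<close> and \<open>((i, j), True)\<close> for its adjoint.\<close>

type_synonym 'n letter = "('n \<times> 'n) \<times> bool"
type_synonym 'n star_poly = "'n letter list \<Rightarrow>\<^sub>0 complex"

definition free_star_alg :: "'n star_poly star_alg" where
  "free_star_alg =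
     star_monoid_alg \<lparr>carrier = UNIV, mult = (@), one = []\<rparr>
       (\<lambda>w. rev (map (\<lambda>(ij, s). (ij, \<not> s)) w))"

definition free_gen :: "'n \<Rightarrow> 'n \<Rightarrow> 'n star_poly" where
  "free_gen i j = Poly_Mapping.single [((i, j), False)] 1"

text \<open>The entries of \<open>v v* - 1\<close> and \<open>v* v - 1\<close>.\<close>

definition unitarity_relations ::
  "('a, 'm) star_alg_scheme \<Rightarrow> ('n::finite \<Rightarrow> 'n \<Rightarrow> 'a) \<Rightarrow> 'a set" where
  "unitarity_relations A v =
     {(\<Oplus>\<^bsub>A\<^esub>k\<in>UNIV. v i k \<otimes>\<^bsub>A\<^esub> star A (v j k)) \<ominus>\<^bsub>A\<^esub> (if i = j then \<one>\<^bsub>A\<^esub> else \<zero>\<^bsub>A\<^esub>) | i j. True} \<union>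
     {(\<Oplus>\<^bsub>A\<^esub>k\<in>UNIV. star A (v k i) \<otimes>\<^bsub>A\<^esub> v k j) \<ominus>\<^bsub>A\<^esub> (if i = j then \<one>\<^bsub>A\<^esub> else \<zero>\<^bsub>A\<^esub>) | i j. True}"

definition free_unitary_ideal :: "'n::finite star_poly set" where
  "free_unitary_ideal =
     star_ideal_generated free_star_alg
       (unitarity_relations free_star_alg free_gen \<union>
        unitarity_relations free_star_alg (\<lambda>i j. star free_star_alg (free_gen i j)))"

definition free_unitary_alg :: "'n::finite star_poly set star_alg" where
  "free_unitary_alg = quot_star_alg free_star_alg free_unitary_ideal"

definition free_unitary_gen :: "'n::finite \<Rightarrow> 'n \<Rightarrow> 'n star_poly set" where
  "free_unitary_gen i j = free_unitary_ideal +>\<^bsub>free_star_alg\<^esub> free_gen i j"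

definition star_poly_eval ::
  "('c, 'm) star_alg_scheme \<Rightarrow> ('n \<Rightarrow> 'n \<Rightarrow> 'c) \<Rightarrow> 'n star_poly \<Rightarrow> 'c" where
  "star_poly_eval C v f =
     (\<Oplus>\<^bsub>C\<^esub>w\<in>Poly_Mapping.keys f. Poly_Mapping.lookup f w \<odot>\<^bsub>C\<^esub>
        foldr (\<lambda>((i, j), s) y. (if s then star C (v i j) else v i j) \<otimes>\<^bsub>C\<^esub> y) w \<one>\<^bsub>C\<^esub>)"

text \<open>The unital *-homomorphism out of the algebra of the free unitary group that sends the
  generator \<open>u\<^sub>i\<^sub>j\<close> to \<open>v i j\<close>, where \<open>v\<close> is a matrix over \<open>C\<close> such that both \<open>v\<close> and its entrywise
  adjoint are unitary (then the value does not depend on the chosen representative).\<close>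

definition induced_hom ::
  "('c, 'm) star_alg_scheme \<Rightarrow> ('n::finite \<Rightarrow> 'n \<Rightarrow> 'c) \<Rightarrow> 'n star_poly set \<Rightarrow> 'c" where
  "induced_hom C v X = star_poly_eval C v (SOME f. f \<in> X)"

definition O_free_unitary :: "'n::finite star_poly set hopf_star_alg" where
  "O_free_unitary =
     (let A = free_unitary_alg; T = tensor_alg A A in
      with_coalgebra A
        (induced_hom T (\<lambda>i j. \<Oplus>\<^bsub>T\<^esub>k\<in>UNIV. simple_tensor A A (free_unitary_gen i k) (free_unitary_gen k j)))
        (induced_hom complex_alg (\<lambda>i j. if i = j then 1 else 0)))"


section \<open>Compact groups\<close>

text \<open>Functions on the group are represented extensionally.  A continuous function is
  representative iff its translates lie in a finite-dimensional space of functions.\<close>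

definition representative_functions ::
  "('g::topological_space, 'm) monoid_scheme \<Rightarrow> ('g \<Rightarrow> complex) set" where
  "representative_functions G =
     {f \<in> extensional (carrier G). continuous_on (carrier G) f \<and>
        (\<exists>F :: ('g \<Rightarrow> complex) set. finite F \<and>
           (\<forall>y\<in>carrier G. \<exists>c. \<forall>x\<in>carrier G. f (x \<otimes>\<^bsub>G\<^esub> y) = (\<Sum>h\<in>F. c h * h x)))}"

definition representative_alg ::
  "('g::topological_space, 'm) monoid_scheme \<Rightarrow> ('g \<Rightarrow> complex) star_alg" where
  "representative_alg G =
    \<lparr>carrier = representative_functions G,
     mult = (\<lambda>f g. \<lambda>x\<in>carrier G. f x * g x), one = (\<lambda>x\<in>carrier G. 1),
     zero = (\<lambda>x\<in>carrier G. 0), add = (\<lambda>f g. \<lambda>x\<in>carrier G. f x + g x),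
     smult = (\<lambda>c f. \<lambda>x\<in>carrier G. c * f x),
     star = (\<lambda>f. \<lambda>x\<in>carrier G. cnj (f x))\<rparr>"

text \<open>The comultiplication of \<open>f\<close> is the tensor that corresponds to the function
  \<open>(x, y) \<mapsto> f (x y)\<close> on \<open>G \<times> G\<close>.\<close>

definition O_compact_group ::
  "('g::topological_space, 'm) monoid_scheme \<Rightarrow> ('g \<Rightarrow> complex) hopf_star_alg" where
  "O_compact_group G =
     (let A = representative_alg G in
      with_coalgebra A
        (\<lambda>f. tensor_class A A
           (SOME r. r \<in> carrier (formal_sums A A) \<and>
              (\<forall>x\<in>carrier G. \<forall>y\<in>carrier G.
                 f (x \<otimes>\<^bsub>G\<^esub> y) =
                 (\<Sum>(a, b)\<in>Poly_Mapping.keys r. Poly_Mapping.lookup r (a, b) * (a x * b y)))))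
        (\<lambda>f. f \<one>\<^bsub>G\<^esub>))"

definition unitary_group :: "(complex^'n^'n) monoid" where
  "unitary_group =
    \<lparr>carrier = {U. let U' = (\<chi> i j. cnj (U $ j $ i)) in U ** U' = mat 1 \<and> U' ** U = mat 1},
     mult = (**), one = mat 1\<rparr>"

definition to_unitary_group ::
  "'n::finite star_poly set \<Rightarrow> complex^'n^'n \<Rightarrow> complex" where
  "to_unitary_group =
     induced_hom (O_compact_group unitary_group) (\<lambda>i j. \<lambda>U\<in>carrier unitary_group. U $ i $ j)"


section \<open>Duals of discrete groups\<close>

definition O_dual :: "('g, 'm) monoid_scheme \<Rightarrow> ('g \<Rightarrow>\<^sub>0 complex) hopf_star_alg" where
  "O_dual \<Gamma> =
     (let A = star_monoid_alg \<Gamma> (m_inv \<Gamma>); T = tensor_alg A A in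
      with_coalgebra A
        (\<lambda>f. \<Oplus>\<^bsub>T\<^esub>\<gamma>\<in>Poly_Mapping.keys f. Poly_Mapping.lookup f \<gamma> \<odot>\<^bsub>T\<^esub>
           simple_tensor A A (Poly_Mapping.single \<gamma> 1) (Poly_Mapping.single \<gamma> 1))
        (\<lambda>f. \<Sum>\<gamma>\<in>Poly_Mapping.keys f. Poly_Mapping.lookup f \<gamma>))"

text \<open>Reduced words; \<open>(i, False)\<close> stands for the generator \<open>g\<^sub>i\<close> and \<open>(i, True)\<close> for its inverse.\<close>

definition reduced_words :: "('n \<times> bool) list set" where
  "reduced_words = {w. \<forall>k. Suc k < length w \<longrightarrow> w ! Suc k \<noteq> map_prod id Not (w ! k)}"

definition cons_reduced :: "'n \<times> bool \<Rightarrow> ('n \<times> bool) list \<Rightarrow> ('n \<times> bool) list" where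
  "cons_reduced a w = (if w \<noteq> [] \<and> hd w = map_prod id Not a then tl w else a # w)"

definition free_group :: "('n \<times> bool) list monoid" where
  "free_group = \<lparr>carrier = reduced_words, mult = foldr cons_reduced, one = []\<rparr>"

definition to_free_torus :: "'n::finite star_poly set \<Rightarrow> ('n \<times> bool) list \<Rightarrow>\<^sub>0 complex" where
  "to_free_torus =
     induced_hom (O_dual free_group) (\<lambda>i j. if i = j then Poly_Mapping.single [(i, False)] 1 else 0)"

end

theory Submission
  imports Defs
begin

text \<open>
  Let \<open>p\<close> be a quotient map of the free unitary algebra through which both subgroup maps factor.
  The linear functionals vanishing on its kernel are closed under convolution and contain the
  evaluations at unitary matrices and the coefficient functionals of the free group.  On the tensor
  representation \<open>V\<^sup>w\<close> of a word \<open>w\<close> in \<open>u\<close> and its conjugate they act by the unitary group and by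
  the projections onto the weight spaces of the free torus.

  The key point is that the space of \<^emph>\<open>harmonic\<close> tensors in \<open>V\<^sup>w\<close>, those killed by all contractions
  of adjacent opposite letters, is irreducible under these operators.  Each reduced index word spans
  a weight space of maximal length, and unitary matrices without zero entries connect all of these
  lines, so an invariant subspace that misses one of them misses all.  Relations coming from root
  vectors and contractions along the first alternating run of \<open>w\<close> then force the first slices
  of such a subspace to miss a reduced index word of the shorter word, and induction applies.

  Modulo the defining relations every element of degree \<open>n\<close> has harmonic coefficients in degree \<open>n\<close>.
  A weight projection of length \<open>n\<close> placed between two functionals isolates the coefficients of
  one signature, and irreducibility shows that they vanish if the element is in the kernel of \<open>p\<close>.
\<close>

section \<open>Tensor representations of the unitary group and of the free torus\<close>

text \<open>The obstacle lies in the slicing step. It needs a reduced index word \<open>L'\<close>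
  of the shorter word such that the invariant subspace misses \<open>y # L'\<close> for every letter
  y. All but at most one of these words are reduced and hence missed already; the exceptional y
  repeats the first letter of \<open>L'\<close> across a pair of opposite signs. Its coordinate is
  the first unknown of a linear system along the alternating run, with one equation for each
  contraction. Once the root relations have expressed all coordinates through alternating sums, the
  system is tridiagonal with N = \<open>CARD('n)\<close> on the diagonal and 1 beside it, and the
  root vector between the two letters in use makes the last unknown 0. Since N is at least 2, the
  first unknown is then 0 as well. Harmonic tensors enter because a contraction is the adjoint of
  inserting the invariant vector of two opposite legs. A coefficient with such an insertion loses
  two letters by unitarity, so only the orthogonal complement of the insertions matters in top
  degree.\<close>

definition signed_entry :: "complex^'n^'n \<Rightarrow> bool \<Rightarrow> 'n \<Rightarrow> 'n \<Rightarrow> complex" where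
  "signed_entry U s i j = (if s then cnj (U $ i $ j) else U $ i $ j)"

text \<open>This is the tensor product action of U, with the conjugate of U in the legs whose sign
  is True. Recursion on the first leg suits both the contraction argument and the later slicing.
  Index lists of the wrong length are sent to 0, so the result is again a tensor on the legs of
  w.\<close>

fun tensor_act ::
  "complex^'n^'n \<Rightarrow> bool list \<Rightarrow> ('n::finite list \<Rightarrow> complex) \<Rightarrow> 'n list \<Rightarrow> complex" where
  "tensor_act U [] v [] = v []"
| "tensor_act U (s # w) v (i # I) =
     (\<Sum>j\<in>UNIV. signed_entry U s i j * tensor_act U w (\<lambda>J. v (j # J)) I)"
| "tensor_act U _ v _ = 0"

definition weight :: "bool list \<Rightarrow> 'n list \<Rightarrow> ('n \<times> bool) list" where
  "weight w I = foldr cons_reduced (zip I w) []"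

definition weight_proj ::
  "('n \<times> bool) list \<Rightarrow> bool list \<Rightarrow> ('n list \<Rightarrow> complex) \<Rightarrow> 'n list \<Rightarrow> complex" where
  "weight_proj h w v = (\<lambda>I. if weight w I = h then v I else 0)"

text \<open>A contraction is the pairing with the tensor that inserts sum_c e_c \<otimes> e_c at the
  same place, so these tensors form the orthogonal complement of all such insertions (see
  \<open>cups\<close>). The length condition makes a function on all lists stand for one
  tensor.\<close>

definition harmonic :: "bool list \<Rightarrow> ('n::finite list \<Rightarrow> complex) set" where
  "harmonic w =
     {v. (\<forall>I. length I \<noteq> length w \<longrightarrow> v I = 0) \<and>
         (\<forall>w1 s w2 I1 I2. w = w1 @ s # (\<not> s) # w2 \<longrightarrow> length I1 = length w1 \<longrightarrow>
            length I2 = length w2 \<longrightarrow> (\<Sum>c\<in>UNIV. v (I1 @ c # c # I2)) = 0)}"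

text \<open>Root vectors are not part of the definition; they are recovered from the group by
  differentiating single coordinates.\<close>

definition stable :: "bool list \<Rightarrow> ('n::finite list \<Rightarrow> complex) set \<Rightarrow> bool" where
  "stable w Z \<longleftrightarrow>
     (\<lambda>_. 0) \<in> Z \<and> (\<forall>u\<in>Z. \<forall>v\<in>Z. (\<lambda>I. u I + v I) \<in> Z) \<and> (\<forall>c. \<forall>v\<in>Z. (\<lambda>I. c * v I) \<in> Z) \<and>
     (\<forall>U\<in>carrier unitary_group. \<forall>v\<in>Z. tensor_act U w v \<in> Z) \<and>
     (\<forall>h. \<forall>v\<in>Z. weight_proj h w v \<in> Z)"

text \<open>Only neighbours of opposite sign are constrained, because a generator of the free group
  does not cancel against itself.\<close>

definition reduced_index :: "bool list \<Rightarrow> 'n list \<Rightarrow> bool" where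
  "reduced_index w K \<longleftrightarrow> length K = length w \<and>
     (\<forall>q. Suc q < length w \<longrightarrow> w ! Suc q \<noteq> w ! q \<longrightarrow> K ! Suc q \<noteq> K ! q)"

section \<open>Invariance of harmonic tensors under the unitary group\<close>

lemma unitary_group_iff:
  "U \<in> carrier unitary_group \<longleftrightarrow>
     (\<forall>i j. (\<Sum>k\<in>UNIV. U $ i $ k * cnj (U $ j $ k)) = (if i = j then 1 else 0)) \<and>
     (\<forall>i j. (\<Sum>k\<in>UNIV. cnj (U $ k $ i) * U $ k $ j) = (if i = j then 1 else 0))"
  by (auto simp: unitary_group_def Let_def vec_eq_iff matrix_matrix_mult_def mat_def)

lemma signed_entry_rows:
  assumes "U \<in> carrier unitary_group"
  shows "(\<Sum>k\<in>UNIV. signed_entry U s i k * signed_entry U (\<not> s) j k) = (if i = j then 1 else 0)"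
proof -
  have "(\<Sum>k\<in>UNIV. U $ i $ k * cnj (U $ j $ k)) = (if i = j then 1 else 0)" for i j
    using assms unfolding unitary_group_iff by blast
  from this[of i j] this[of j i] show ?thesis
    by (cases s) (auto simp: signed_entry_def mult.commute)
qed

lemma signed_entry_cols:
  assumes "U \<in> carrier unitary_group"
  shows "(\<Sum>k\<in>UNIV. signed_entry U s k i * signed_entry U (\<not> s) k j) = (if i = j then 1 else 0)"
proof -
  have "(\<Sum>k\<in>UNIV. cnj (U $ k $ i) * U $ k $ j) = (if i = j then 1 else 0)" for i j
    using assms unfolding unitary_group_iff by blast
  from this[of i j] this[of j i] show ?thesis
    by (cases s) (auto simp: signed_entry_def mult.commute)
qed

lemma tensor_act_length: "length I \<noteq> length w \<Longrightarrow> tensor_act U w v I = 0"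
  by (induction U w v I rule: tensor_act.induct) auto

lemma tensor_act_zero: "(\<And>J. length J = length w \<Longrightarrow> v J = 0) \<Longrightarrow> tensor_act U w v I = 0"
  by (induction U w v I rule: tensor_act.induct) auto

lemma tensor_act_add:
  "tensor_act U w (\<lambda>J. u J + v J) I = tensor_act U w u I + tensor_act U w v I"
  by (induction U w u I arbitrary: v rule: tensor_act.induct)
     (auto simp: sum.distrib distrib_left)

lemma tensor_act_scale: "tensor_act U w (\<lambda>J. c * v J) I = c * tensor_act U w v I"
  by (induction U w v I rule: tensor_act.induct) (auto simp: sum_distrib_left mult_ac)

lemma tensor_act_sum:
  "finite S \<Longrightarrow> tensor_act U w (\<lambda>J. \<Sum>x\<in>S. f x J) I = (\<Sum>x\<in>S. tensor_act U w (f x) I)"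
  by (induction S rule: finite_induct) (auto simp: tensor_act_add tensor_act_zero)

text \<open>The two contracted legs carry U and its conjugate, so summing over c turns the product
  of their entries into a Kronecker delta by orthogonality of columns. Hence contraction commutes
  with the action.\<close>

lemma tensor_act_contraction:
  assumes "U \<in> carrier unitary_group"
  shows "(\<And>I1 I2. length I1 = length w1 \<Longrightarrow> length I2 = length w2 \<Longrightarrow>
            (\<Sum>c\<in>UNIV. v (I1 @ c # c # I2)) = 0) \<Longrightarrow>
         length I1 = length w1 \<Longrightarrow> length I2 = length w2 \<Longrightarrow>
         (\<Sum>c\<in>UNIV. tensor_act U (w1 @ s # (\<not> s) # w2) v (I1 @ c # c # I2)) = 0"
proof (induction w1 arbitrary: I1 v)
  case Nil
  let ?t = "\<lambda>j k. tensor_act U w2 (\<lambda>J. v (j # k # J)) I2"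
  have "(\<Sum>c\<in>UNIV. tensor_act U ([] @ s # (\<not> s) # w2) v (I1 @ c # c # I2)) =
    (\<Sum>c\<in>UNIV. \<Sum>j\<in>UNIV. \<Sum>k\<in>UNIV. signed_entry U s c j * signed_entry U (\<not> s) c k * ?t j k)"
    using Nil by (simp add: sum_distrib_left mult.assoc)
  also have "\<dots> = (\<Sum>j\<in>UNIV. \<Sum>k\<in>UNIV. \<Sum>c\<in>UNIV.
      signed_entry U s c j * signed_entry U (\<not> s) c k * ?t j k)"
    by (subst sum.swap, rule sum.cong[OF refl], subst sum.swap, rule refl)
  also have "\<dots> = (\<Sum>j\<in>UNIV. \<Sum>k\<in>UNIV. (if j = k then 1 else 0) * ?t j k)"
    by (simp add: sum_distrib_right[symmetric] signed_entry_cols[OF assms])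
  also have "\<dots> = (\<Sum>j\<in>UNIV. ?t j j)"
    by (simp add: if_distrib[where f="\<lambda>x. x * _"] cong: if_cong)
  also have "\<dots> = tensor_act U w2 (\<lambda>J. \<Sum>j\<in>UNIV. v (j # j # J)) I2"
    by (simp add: tensor_act_sum)
  also have "\<dots> = 0"
    by (rule tensor_act_zero) (use Nil(1)[of "[]"] in auto)
  finally show ?case .
next
  case (Cons s0 w1)
  then obtain i I1' where I1: "I1 = i # I1'" "length I1' = length w1"
    by (cases I1) auto
  have "(\<Sum>c\<in>UNIV. tensor_act U (w1 @ s # (\<not> s) # w2) (\<lambda>J. v (j # J)) (I1' @ c # c # I2)) = 0" for j
    by (rule Cons.IH) (use Cons.prems(1)[of "j # _"] I1 Cons.prems in auto)
  then show ?case
    unfolding I1 append_Cons tensor_act.simps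
    by (subst sum.swap) (simp add: sum_distrib_left[symmetric])
qed

lemma tensor_act_harmonic:
  assumes "U \<in> carrier unitary_group" "v \<in> harmonic w"
  shows "tensor_act U w v \<in> harmonic w"
  unfolding harmonic_def
proof safe
  fix w1 s w2 and I1 I2 :: "'a list"
  assume "w = w1 @ s # (\<not> s) # w2" "length I1 = length w1" "length I2 = length w2"
  then show "(\<Sum>c\<in>UNIV. tensor_act U (w1 @ s # (\<not> s) # w2) v (I1 @ c # c # I2)) = 0"
    using assms(2) by (intro tensor_act_contraction[OF assms(1)]) (auto simp: harmonic_def)
qed (simp add: tensor_act_length)

section \<open>Reduced words of the free group and weight spaces\<close>

lemma reduced_words_Cons:
  "a # w \<in> reduced_words \<longleftrightarrow> w \<in> reduced_words \<and> (w \<noteq> [] \<longrightarrow> hd w \<noteq> map_prod id Not a)"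
  (is "?l \<longleftrightarrow> ?r")
proof
  assume l: ?l
  have "w \<in> reduced_words"
    unfolding reduced_words_def
  proof (clarify)
    fix k assume "Suc k < length w" "w ! Suc k = map_prod id Not (w ! k)"
    then show False using l unfolding reduced_words_def by (auto dest!: spec[of _ "Suc k"])
  qed
  moreover have "w \<noteq> [] \<longrightarrow> hd w \<noteq> map_prod id Not a"
    using l unfolding reduced_words_def by (auto dest!: spec[of _ 0] simp: hd_conv_nth)
  ultimately show ?r by simp
next
  assume r: ?r
  then show ?l
    unfolding reduced_words_def by (auto simp: nth_Cons hd_conv_nth split: nat.splits)
qed

lemma Nil_reduced: "[] \<in> reduced_words"
  by (simp add: reduced_words_def)

lemma map_prod_Not_Not [simp]: "map_prod id Not (map_prod id Not a) = a"
  by (cases a) auto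

lemma cons_reduced_in_reduced: "x \<in> reduced_words \<Longrightarrow> cons_reduced a x \<in> reduced_words"
  by (cases x) (auto simp: cons_reduced_def reduced_words_Cons)

lemma foldr_cons_reduced: "y \<in> reduced_words \<Longrightarrow> foldr cons_reduced x y \<in> reduced_words"
  by (induction x) (auto simp: cons_reduced_in_reduced)

lemma weight_reduced: "weight w I \<in> reduced_words"
  by (simp add: weight_def foldr_cons_reduced Nil_reduced)

lemma cons_reduced_cancel:
  assumes "x \<in> reduced_words"
  shows "cons_reduced a (cons_reduced (map_prod id Not a) x) = x"
  using assms by (cases x) (auto simp: cons_reduced_def reduced_words_Cons hd_conv_nth)

lemma cons_reduced_cancel':
  assumes "x \<in> reduced_words"
  shows "cons_reduced (map_prod id Not a) (cons_reduced a x) = x"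
  using cons_reduced_cancel[OF assms, of "map_prod id Not a"] by simp

lemma foldr_reduced_id: "x \<in> reduced_words \<Longrightarrow> foldr cons_reduced x [] = x"
  by (induction x) (auto simp: reduced_words_Cons cons_reduced_def)

lemma length_foldr_cons_reduced: "length (foldr cons_reduced x []) \<le> length x"
  by (induction x) (auto simp: cons_reduced_def split: if_splits)

text \<open>Every cancellation shortens the word, so full length means that none took place.\<close>

lemma foldr_cons_reduced_eq:
  "length (foldr cons_reduced x []) = length x \<Longrightarrow> foldr cons_reduced x [] = x"
proof (induction x)
  case (Cons a x)
  let ?y = "foldr cons_reduced x []"
  have "length ?y \<le> length x" by (rule length_foldr_cons_reduced)
  moreover have "length (cons_reduced a ?y) = Suc (length x)" using Cons.prems by simp
  ultimately have "cons_reduced a ?y = a # ?y" "length ?y = length x"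
    by (auto simp: cons_reduced_def[of a ?y] split: if_splits)
  then show ?case using Cons.IH by simp
qed simp

lemma reduced_index_zip:
  assumes "length K = length w"
  shows "zip K w \<in> reduced_words \<longleftrightarrow> reduced_index w K"
  using assms by (auto simp: reduced_words_def reduced_index_def)

lemma weight_reduced_index: "reduced_index w K \<Longrightarrow> weight w K = zip K w"
  using reduced_index_zip[of K w] foldr_reduced_id
  by (auto simp: weight_def reduced_index_def)

text \<open>A weight at least as long as the index word arises only without cancellation and then
  records both letters and signs. So a reduced index word spans its whole weight space, even when
  all words w of at most its length are considered together.\<close>

lemma weight_eq_long:
  assumes "weight w I = zip K w'" "length K = length w'" "length I = length w" "length w \<le> length w'"
  shows "I = K \<and> w = w'"
proof -
  have "length w = length w'"
    using assms length_foldr_cons_reduced[of "zip I w"] by (simp add: weight_def)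
  then have "zip I w = zip K w'"
    using assms foldr_cons_reduced_eq[of "zip I w"] by (auto simp: weight_def)
  then show ?thesis using assms
    by (metis map_fst_zip map_snd_zip)
qed

lemma weight_proj_reduced:
  assumes "v \<in> harmonic w" "reduced_index w L"
  shows "weight_proj (zip L w) w v = (\<lambda>J. v L * (if J = L then 1 else 0))"
proof
  fix J
  show "weight_proj (zip L w) w v J = v L * (if J = L then 1 else 0)"
    using assms weight_eq_long[of w J L w] weight_reduced_index[OF assms(2)]
    by (cases "length J = length w") (auto simp: weight_proj_def harmonic_def reduced_index_def)
qed

lemma weight_cancel:
  assumes "length I1 = length w1"
  shows "weight (w1 @ s # (\<not> s) # w2) (I1 @ c # c # I2) = weight (w1 @ w2) (I1 @ I2)"
  using assms cons_reduced_cancel[OF weight_reduced, of "(c, s)" w2 I2]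
  by (simp add: weight_def)

text \<open>All terms of one contraction sum have the same weight by \<open>weight_cancel\<close>,
  so the projection keeps the sum as a whole or drops it.\<close>

lemma weight_proj_harmonic:
  assumes "v \<in> harmonic w"
  shows "weight_proj h w v \<in> harmonic w"
  using assms unfolding harmonic_def
proof (clarsimp simp: weight_proj_def weight_cancel, safe)
  fix w1 s w2 and I1 I2 :: "'a list"
  assume "\<forall>w1a sa w2a. w1 @ s # (\<not> s) # w2 = w1a @ sa # (\<not> sa) # w2a \<longrightarrow>
    (\<forall>I1. length I1 = length w1a \<longrightarrow> (\<forall>I2. length I2 = length w2a \<longrightarrow> (\<Sum>c\<in>UNIV. v (I1 @ c # c # I2)) = 0))"
    and "length I1 = length w1" "length I2 = length w2"
  then have "(\<Sum>c\<in>UNIV. v (I1 @ c # c # I2)) = 0" by blast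
  then show "(\<Sum>c\<in>UNIV. if weight (w1 @ w2) (I1 @ I2) = h then v (I1 @ c # c # I2) else 0) = 0"
    by (cases "weight (w1 @ w2) (I1 @ I2) = h") simp_all
qed

section \<open>Moving between the lines of reduced index words\<close>

lemma exists_unitary_nonzero_entries:
  assumes "CARD('n::finite) \<ge> 2"
  shows "\<exists>U::complex^'n^'n. U \<in> carrier unitary_group \<and> (\<forall>i j. U $ i $ j \<noteq> 0)"
proof -
  let ?n = "of_nat (CARD('n)) :: complex"
  \<comment> \<open>With J the all-ones matrix, I + \<beta> J is the identity on vectors of sum 0
    and multiplies constant vectors by 1 + n \<beta>, so unitarity asks for modulus 1. The value i
    is chosen here; the reflection with value -1 would have zero diagonal for n = 2.\<close>
  define \<beta> where "\<beta> = (\<i> - 1) / ?n"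
  define U :: "complex^'n^'n" where "U = (\<chi> i j. (if i = j then 1 else 0) + \<beta>)"
  have n0: "?n \<noteq> 0" by simp
  have b: "\<beta> + cnj \<beta> + ?n * (\<beta> * cnj \<beta>) = 0"
    unfolding \<beta>_def by (simp add: field_simps power2_eq_square n0)
  have s: "(\<Sum>k\<in>UNIV. ((if i = k then 1 else 0) + x) * ((if j = k then 1 else 0) + y)) =
     (if i = j then 1 else 0) + (x + y + ?n * (x * y))" for i j :: 'n and x y :: complex
  proof -
    have "(\<Sum>k\<in>UNIV. ((if i = k then 1 else 0) + x) * ((if j = k then 1 else 0) + y)) =
      (\<Sum>k\<in>UNIV. (if i = k then (if j = k then 1 else 0) else 0) + (if i = k then y else 0)
         + (if j = k then x else 0) + x * y)"
      by (rule sum.cong) (auto simp: algebra_simps)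
    also have "\<dots> = (if j = i then 1 else 0) + y + x + ?n * (x * y)"
      by (simp add: sum.distrib)
    finally show ?thesis by (auto simp: algebra_simps)
  qed
  have "U \<in> carrier unitary_group"
    unfolding unitary_group_iff
  proof safe
    fix i j :: 'n
    have "(\<Sum>k\<in>UNIV. U $ i $ k * cnj (U $ j $ k)) =
      (\<Sum>k\<in>UNIV. ((if i = k then 1 else 0) + \<beta>) * ((if j = k then 1 else 0) + cnj \<beta>))"
      by (rule sum.cong) (auto simp: U_def)
    then show "(\<Sum>k\<in>UNIV. U $ i $ k * cnj (U $ j $ k)) = (if i = j then 1 else 0)"
      unfolding s using b by simp
    have "(\<Sum>k\<in>UNIV. cnj (U $ k $ i) * U $ k $ j) =
      (\<Sum>k\<in>UNIV. ((if i = k then 1 else 0) + cnj \<beta>) * ((if j = k then 1 else 0) + \<beta>))"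
      by (rule sum.cong) (auto simp: U_def)
    then show "(\<Sum>k\<in>UNIV. cnj (U $ k $ i) * U $ k $ j) = (if i = j then 1 else 0)"
      unfolding s using b by (simp add: algebra_simps)
  qed
  moreover have "\<beta> \<noteq> 0" "1 + \<beta> \<noteq> 0"
  proof -
    show "\<beta> \<noteq> 0" unfolding \<beta>_def by (auto simp: complex_eq_iff)
    have "Im (1 + \<beta>) \<noteq> 0" unfolding \<beta>_def by (simp add: Im_divide)
    then show "1 + \<beta> \<noteq> 0" by (metis zero_complex.sel(2))
  qed
  ultimately show ?thesis unfolding U_def by (intro exI[of _ U]) (auto simp: U_def)
qed

text \<open>Each coordinate of the image of a basis tensor is a product of signed entries, one for
  each leg.\<close>

lemma tensor_act_basis_nonzero:
  fixes U :: "complex^'n^'n::finite"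
  assumes "\<forall>i j. U $ i $ j \<noteq> 0"
  shows "length K = length w \<Longrightarrow> length L = length w \<Longrightarrow>
    tensor_act U w (\<lambda>J. if J = L then 1 else 0) K \<noteq> 0"
proof (induction w arbitrary: K L)
  case (Cons s w)
  then obtain k K' l L' where KL: "K = k # K'" "L = l # L'" "length K' = length w" "length L' = length w"
    by (metis length_Suc_conv length_Cons)
  have "tensor_act U (s # w) (\<lambda>J. if J = L then 1 else 0) K =
    (\<Sum>j\<in>UNIV. signed_entry U s k j * tensor_act U w (\<lambda>J. if j # J = L then 1 else 0) K')"
    by (simp add: KL)
  also have "\<dots> = (\<Sum>j\<in>UNIV. if j = l then signed_entry U s k l * tensor_act U w (\<lambda>J. if J = L' then 1 else 0) K' else 0)"
    by (rule sum.cong) (auto simp: KL tensor_act_zero)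
  also have "\<dots> = signed_entry U s k l * tensor_act U w (\<lambda>J. if J = L' then 1 else 0) K'"
    by simp
  also have "\<dots> \<noteq> 0"
    using Cons.IH[of K' L'] KL assms by (auto simp: signed_entry_def)
  finally show ?case .
qed auto

lemma stable_reduced_vanish:
  fixes Z :: "('n::finite list \<Rightarrow> complex) set"
  assumes N: "CARD('n) \<ge> 2"
    and Z: "stable w Z" "Z \<subseteq> harmonic w"
    and K: "reduced_index w K" "\<And>v. v \<in> Z \<Longrightarrow> v K = 0"
    and L: "reduced_index w L" and v: "v \<in> Z"
  shows "v L = 0"
proof (rule ccontr)
  assume nz: "v L \<noteq> 0"
  obtain U :: "complex^'n^'n" where U: "U \<in> carrier unitary_group" "\<forall>i j. U $ i $ j \<noteq> 0"
    using exists_unitary_nonzero_entries[OF N] by blast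
  have "weight_proj (zip L w) w v \<in> Z"
    using Z(1) v by (auto simp: stable_def)
  then have "tensor_act U w (\<lambda>J. v L * (if J = L then 1 else 0)) \<in> Z"
    using Z weight_proj_reduced[of v w L] L v U(1) by (auto simp: stable_def subset_iff)
  then have "tensor_act U w (\<lambda>J. v L * (if J = L then 1 else 0)) K = 0"
    by (rule K(2))
  then show False
    unfolding tensor_act_scale
    using nz tensor_act_basis_nonzero[OF U(2), of K w L] K(1) L
    by (auto simp: reduced_index_def)
qed

section \<open>Irreducibility of the harmonic spaces\<close>

definition plane_rotation :: "'n \<Rightarrow> 'n \<Rightarrow> complex \<Rightarrow> real \<Rightarrow> complex^'n^'n" where
  "plane_rotation a b z t = (\<chi> i j.
     if i = j then if i = a \<or> i = b then of_real (cos t) else 1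
     else if i = a \<and> j = b then z * of_real (sin t)
     else if i = b \<and> j = a then - (cnj z * of_real (sin t)) else 0)"

text \<open>The matrix unit E_ab acting by the Leibniz rule: as E_ab on legs of sign False and,
  dually, as -E_ba on legs of sign True.\<close>

fun root_act ::
  "'n \<Rightarrow> 'n \<Rightarrow> bool list \<Rightarrow> ('n list \<Rightarrow> complex) \<Rightarrow> 'n list \<Rightarrow> complex" where
  "root_act a b (s # w) v (k # K) =
     (if \<not> s \<and> k = a then v (b # K) else if s \<and> k = b then - v (a # K) else 0) +
     root_act a b w (\<lambda>J. v (k # J)) K"
| "root_act a b _ v _ = 0"

lemma sum_two_points:
  fixes f :: "'n::finite \<Rightarrow> 'c::comm_monoid_add"
  assumes "a \<noteq> b"
  shows "sum f UNIV = f a + (f b + sum f (UNIV - {a, b}))"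
proof -
  have "sum f UNIV = sum f (insert a (insert b (UNIV - {a, b})))"
    by (rule sum.cong) auto
  also have "\<dots> = f a + (f b + sum f (UNIV - {a, b}))"
    using assms by (subst sum.insert; simp)+
  finally show ?thesis .
qed

lemma plane_rotation_unitary:
  fixes a b :: "'n::finite"
  assumes "a \<noteq> b" "z * cnj z = 1"
  shows "plane_rotation a b z t \<in> carrier unitary_group"
proof -
  let ?R = "plane_rotation a b z t"
  have cs: "of_real (cos t) * of_real (cos t) + of_real (sin t) * of_real (sin t) = (1::complex)"
    by (metis of_real_1 of_real_add of_real_mult power2_eq_square sin_cos_squared_add2)
  have zs: "z * x * (cnj z * y) = x * y" for x y
    using assms(2) by (metis mult.assoc mult.left_commute mult_1)
  have rest1: "(\<Sum>k\<in>UNIV - {a, b}. ?R $ i $ k * cnj (?R $ j $ k)) =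
      (if i = j \<and> i \<noteq> a \<and> i \<noteq> b then 1 else 0)" for i j
  proof -
    have "(\<Sum>k\<in>UNIV - {a, b}. ?R $ i $ k * cnj (?R $ j $ k)) =
      (\<Sum>k\<in>UNIV - {a, b}. if k = i then (if i = j then 1 else 0) else 0)"
      by (rule sum.cong) (auto simp: plane_rotation_def)
    then show ?thesis by (simp add: sum.delta)
  qed
  have rest2: "(\<Sum>k\<in>UNIV - {a, b}. cnj (?R $ k $ i) * ?R $ k $ j) =
      (if i = j \<and> i \<noteq> a \<and> i \<noteq> b then 1 else 0)" for i j
  proof -
    have "(\<Sum>k\<in>UNIV - {a, b}. cnj (?R $ k $ i) * ?R $ k $ j) =
      (\<Sum>k\<in>UNIV - {a, b}. if k = i then (if i = j then 1 else 0) else 0)"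
      by (rule sum.cong) (auto simp: plane_rotation_def)
    then show ?thesis by (simp add: sum.delta)
  qed
  have ab [simp]: "?R $ a $ a = of_real (cos t)" "?R $ b $ b = of_real (cos t)"
    "?R $ a $ b = z * of_real (sin t)" "?R $ b $ a = - (cnj z * of_real (sin t))"
    using assms(1) by (simp_all add: plane_rotation_def)
  have off [simp]: "?R $ i $ a = 0" "?R $ i $ b = 0" "?R $ a $ i = 0" "?R $ b $ i = 0"
    if "i \<noteq> a" "i \<noteq> b" for i
    using that by (simp_all add: plane_rotation_def)
  have zs': "z * x * (cnj z * y) = x * y" "cnj z * x * (z * y) = x * y" for x y
    using zs[of x y] by (simp_all add: mult_ac)
  show ?thesis
    unfolding unitary_group_iff
  proof (intro conjI allI)
    fix i j
    show "(\<Sum>k\<in>UNIV. ?R $ i $ k * cnj (?R $ j $ k)) = (if i = j then 1 else 0)"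
      unfolding sum_two_points[OF assms(1)] rest1
      using assms(1) cs
      by (cases "i = a"; cases "i = b"; cases "j = a"; cases "j = b") (simp_all add: zs' add.commute)
    show "(\<Sum>k\<in>UNIV. cnj (?R $ k $ i) * ?R $ k $ j) = (if i = j then 1 else 0)"
      unfolding sum_two_points[OF assms(1)] rest2
      using assms(1) cs
      by (cases "i = a"; cases "i = b"; cases "j = a"; cases "j = b") (simp_all add: zs' add.commute)
  qed
qed

lemma signed_entry_rotation_0:
  "signed_entry (plane_rotation a b z 0) s i j = (if j = i then 1 else 0)"
proof -
  have "plane_rotation a b z 0 $ i $ j = (if j = i then 1 else 0)"
    by (cases "i = j") (simp_all add: plane_rotation_def)
  then show ?thesis by (cases "j = i") (simp_all add: signed_entry_def)
qed

lemma tensor_act_plane_rotation_0: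
  "length K = length w \<Longrightarrow> tensor_act (plane_rotation a b z 0) w v K = v K"
proof (induction w arbitrary: v K)
  case (Cons s w)
  then obtain k K' where K: "K = k # K'" "length K' = length w" by (cases K) auto
  have "tensor_act (plane_rotation a b z 0) (s # w) v K =
      (\<Sum>j\<in>UNIV. if j = k then v (j # K') else 0)"
    unfolding K(1) tensor_act.simps Cons.IH[OF K(2)] signed_entry_rotation_0
    by (intro sum.cong) auto
  then show ?case by (simp add: K(1))
qed simp

lemma signed_entry_rotation_deriv:
  assumes "a \<noteq> b"
  shows "((\<lambda>t. signed_entry (plane_rotation a b z t) s i j) has_vector_derivative
     (if i = a \<and> j = b then (if s then cnj z else z)
      else if i = b \<and> j = a then - (if s then z else cnj z) else 0)) (at 0)"
proof -
  have c: "((\<lambda>t. complex_of_real (cos t)) has_vector_derivative 0) (at 0)"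
    using has_vector_derivative_of_real[of cos "- sin 0" "at 0"]
    by (auto intro!: derivative_eq_intros)
  have s: "((\<lambda>t. y * complex_of_real (sin t)) has_vector_derivative y) (at 0)" for y
    using has_vector_derivative_mult_right[OF has_vector_derivative_of_real[of sin "cos 0" "at 0"], of y]
    by (auto intro!: derivative_eq_intros)
  note facts = c s[of z] s[of "cnj z"] s[of "- z", simplified] s[of "- cnj z", simplified]
  show ?thesis
    using assms
    by (cases "i = j"; cases "i = a"; cases "i = b"; cases "j = a"; cases "j = b"; cases s)
       (simp_all add: signed_entry_def plane_rotation_def facts)
qed

text \<open>At t = 0 the rotation is the identity, so the product rule differentiates one leg at a
  time and leaves the others alone. The phase z separates the two root vectors into a linear and a
  conjugate-linear term.\<close>

lemma tensor_act_rotation_deriv: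
  fixes a b :: "'n::finite"
  assumes "a \<noteq> b"
  shows "length K = length w \<Longrightarrow>
    ((\<lambda>t. tensor_act (plane_rotation a b z t) w v K) has_vector_derivative
       (z * root_act a b w v K - cnj z * root_act b a w v K)) (at 0)"
proof (induction w arbitrary: v K)
  case (Cons s w)
  then obtain k K' where K: "K = k # K'" "length K' = length w" by (cases K) auto
  let ?R = "plane_rotation a b z"
  let ?e = "\<lambda>j. if k = a \<and> j = b then (if s then cnj z else z)
      else if k = b \<and> j = a then - (if s then z else cnj z) else 0"
  let ?D = "\<lambda>j. z * root_act a b w (\<lambda>J. v (j # J)) K' - cnj z * root_act b a w (\<lambda>J. v (j # J)) K'"
  have "((\<lambda>t. \<Sum>j\<in>UNIV. signed_entry (?R t) s k j * tensor_act (?R t) w (\<lambda>J. v (j # J)) K')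
     has_vector_derivative
     (\<Sum>j\<in>UNIV. signed_entry (?R 0) s k j * ?D j +
        ?e j * tensor_act (?R 0) w (\<lambda>J. v (j # J)) K')) (at 0)"
    by (intro has_vector_derivative_sum has_vector_derivative_mult
          signed_entry_rotation_deriv assms Cons.IH K)
  moreover have "(\<Sum>j\<in>UNIV. signed_entry (?R 0) s k j * ?D j + ?e j * tensor_act (?R 0) w (\<lambda>J. v (j # J)) K')
     = z * root_act a b (s # w) v K - cnj z * root_act b a (s # w) v K"
  proof -
    note 1 = signed_entry_rotation_0
    have 2: "(\<Sum>j\<in>UNIV. ?e j * v (j # K')) =
       z * (if \<not> s \<and> k = a then v (b # K') else if s \<and> k = b then - v (a # K') else 0)
       - cnj z * (if \<not> s \<and> k = b then v (a # K') else if s \<and> k = a then - v (b # K') else 0)"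
      using assms by (simp add: sum_two_points[OF assms])
    have 3: "(\<Sum>j\<in>UNIV. (if j = k then 1 else 0) * ?D j) = ?D k"
    proof -
      have "(\<Sum>j\<in>UNIV. (if j = k then 1 else 0) * ?D j) = (\<Sum>j\<in>UNIV. if j = k then ?D j else 0)"
        by (intro sum.cong) auto
      then show ?thesis by simp
    qed
    show ?thesis
      unfolding sum.distrib 1 tensor_act_plane_rotation_0[OF K(2)] 2 3
      unfolding K(1) root_act.simps by (simp only: algebra_simps)
  qed
  ultimately show ?case by (simp add: K(1))
qed simp

text \<open>The coordinate at K is 0 along the whole curve of rotated tensors, hence so is its
  derivative at 0. The phases 1 and i give the difference and the sum of the two root
  actions.\<close>

lemma root_act_vanish:
  fixes Z :: "('n::finite list \<Rightarrow> complex) set"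
  assumes Z: "stable w Z" and v: "v \<in> Z" and K: "length K = length w"
    and vanish: "\<And>u. u \<in> Z \<Longrightarrow> u K = 0" and ab: "a \<noteq> b"
  shows "root_act a b w v K = 0"
proof -
  have *: "z * root_act a b w v K - cnj z * root_act b a w v K = 0" if z: "z * cnj z = 1" for z
  proof -
    have "tensor_act (plane_rotation a b z t) w v K = 0" for t
      using Z v plane_rotation_unitary[OF ab z] by (intro vanish) (auto simp: stable_def)
    then have "((\<lambda>t. 0) has_vector_derivative
       (z * root_act a b w v K - cnj z * root_act b a w v K)) (at (0::real))"
      using tensor_act_rotation_deriv[OF ab K, of z v] by simp
    then show ?thesis
      using has_vector_derivative_const vector_derivative_unique_at by blast
  qed
  have "root_act a b w v K = root_act b a w v K" using *[of 1] by simp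
  moreover have "root_act a b w v K = - root_act b a w v K"
  proof -
    have "\<i> * (root_act a b w v K + root_act b a w v K) = 0"
      using *[of \<i>] by (simp add: algebra_simps)
    then show ?thesis using add_eq_0_iff2 by fastforce
  qed
  ultimately have "root_act a b w v K = - root_act a b w v K" by simp
  then show ?thesis by simp
qed

lemma root_act_sum:
  "length K = length w \<Longrightarrow> root_act a b w v K =
     (\<Sum>q<length w. if \<not> w ! q \<and> K ! q = a then v (K[q := b])
        else if w ! q \<and> K ! q = b then - v (K[q := a]) else 0)"
proof (induction w arbitrary: v K)
  case (Cons s w)
  then obtain k K' where K: "K = k # K'" "length K' = length w" by (cases K) auto
  show ?case
    unfolding K(1) length_Cons sum.lessThan_Suc_shift
    by (simp add: Cons.IH[OF K(2)] cong: if_cong)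
qed simp

text \<open>Keeping s as a parameter allows it to be the sign of a chosen position later on. For s
  False this is the root vector E_xy, for s True it is the negative of E_yx.\<close>

lemma root_relation:
  fixes Z :: "('n::finite list \<Rightarrow> complex) set"
  assumes Z: "stable w Z" and v: "v \<in> Z" and K: "length K = length w"
    and vanish: "\<And>u. u \<in> Z \<Longrightarrow> u K = 0" and xy: "x \<noteq> y"
  shows "(\<Sum>q<length w. if w ! q = s \<and> K ! q = x then v (K[q := y])
        else if w ! q \<noteq> s \<and> K ! q = y then - v (K[q := x]) else 0) = 0"
proof (cases s)
  case False
  have "(\<Sum>q<length w. if w ! q = s \<and> K ! q = x then v (K[q := y])
        else if w ! q \<noteq> s \<and> K ! q = y then - v (K[q := x]) else 0) =
        (\<Sum>q<length w. if \<not> w ! q \<and> K ! q = x then v (K[q := y])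
        else if w ! q \<and> K ! q = y then - v (K[q := x]) else 0)"
    using False by (intro sum.cong refl) auto
  then show ?thesis
    using root_act_vanish[OF Z v K _ xy] vanish root_act_sum[OF K, of x y v] by simp
next
  case True
  have "(\<Sum>q<length w. if w ! q = s \<and> K ! q = x then v (K[q := y])
        else if w ! q \<noteq> s \<and> K ! q = y then - v (K[q := x]) else 0) =
        - (\<Sum>q<length w. if \<not> w ! q \<and> K ! q = y then v (K[q := x])
        else if w ! q \<and> K ! q = x then - v (K[q := y]) else 0)"
    unfolding sum_negf[symmetric] eqTrueI[OF True]
    by (intro sum.cong refl) (simp split: if_split)
  then show ?thesis
    using root_act_vanish[OF Z v K _ xy[symmetric]] vanish root_act_sum[OF K, of y x v] by simp
qed

section \<open>Contractions and root relations along the initial alternating run\<close>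

lemma harmonic_contraction:
  assumes v: "v \<in> harmonic w" and p: "Suc p < length w" "w ! Suc p = (\<not> w ! p)"
    and K: "length K = length w"
  shows "(\<Sum>c\<in>UNIV. v (K[p := c, Suc p := c])) = 0"
proof -
  have w: "w = take p w @ w ! p # (\<not> w ! p) # drop (Suc (Suc p)) w"
    using id_take_nth_drop[of p w] Cons_nth_drop_Suc[of "Suc p" w] p by simp
  have "K = take p K @ K ! p # K ! Suc p # drop (Suc (Suc p)) K"
    using id_take_nth_drop[of p K] Cons_nth_drop_Suc[of "Suc p" K] p K by simp
  then have "K[p := c, Suc p := c] =
      (take p K @ K ! p # K ! Suc p # drop (Suc (Suc p)) K)[p := c, Suc p := c]" for c
    by simp
  then have "K[p := c, Suc p := c] = take p K @ c # c # drop (Suc (Suc p)) K" for c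
    using p K by (simp add: list_update_append)
  moreover have "(\<Sum>c\<in>UNIV. v (take p K @ c # c # drop (Suc (Suc p)) K)) = 0"
  proof -
    have "\<forall>I1 I2. length I1 = length (take p w) \<longrightarrow> length I2 = length (drop (Suc (Suc p)) w) \<longrightarrow>
        (\<Sum>c\<in>UNIV. v (I1 @ c # c # I2)) = 0"
      using v w unfolding harmonic_def by blast
    then show ?thesis using p K by simp
  qed
  ultimately show ?thesis by simp
qed

lemma initial_alternating_run:
  "w \<noteq> [] \<Longrightarrow> \<exists>s\<ge>1. s \<le> length w \<and> (\<forall>q. Suc q < s \<longrightarrow> w ! Suc q = (\<not> w ! q)) \<and>
     (s < length w \<longrightarrow> w ! s = w ! (s - 1))"
proof (induction w)
  case (Cons x w)
  show ?case
  proof (cases "w = [] \<or> hd w = x")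
    case True
    then show ?thesis by (intro exI[of _ 1]) (auto simp: hd_conv_nth)
  next
    case False
    then obtain s where s: "s \<ge> 1" "s \<le> length w" "\<forall>q. Suc q < s \<longrightarrow> w ! Suc q = (\<not> w ! q)"
        "s < length w \<longrightarrow> w ! s = w ! (s - 1)"
      using Cons.IH by blast
    show ?thesis
    proof (intro exI[of _ "Suc s"] conjI allI impI)
      fix q assume "Suc q < Suc s"
      then show "(x # w) ! Suc q = (\<not> (x # w) ! q)"
        using s(3) False by (cases q) (auto simp: hd_conv_nth)
    qed (use s in \<open>auto simp: nth_Cons split: nat.splits\<close>)
  qed
qed simp

lemma nth_update_if: "i < length xs \<Longrightarrow> xs[p := c] ! i = (if p = i then c else xs ! i)"
  by (cases "p = i") auto

text \<open>Inside the run and after it the letter is a one-to-one function of the sign, so opposite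
  neighbours differ. The rule changes only between positions s - 1 and s, where the signs agree and
  nothing is required.\<close>

lemma run_word_reduced:
  fixes al :: "bool \<Rightarrow> 'n"
  assumes run: "s < length w \<Longrightarrow> w ! s = w ! (s - 1)"
    and al: "al True \<noteq> al False"
    and K: "length K = length w" "\<And>q. q < s \<Longrightarrow> K ! q = al (w ! q)"
      "\<And>q. s \<le> q \<Longrightarrow> q < length w \<Longrightarrow> K ! q = al (\<not> w ! q)"
  shows "reduced_index w K"
proof -
  have al': "al x = al y \<longleftrightarrow> x = y" for x y
    using al by (cases x; cases y) auto
  have "K ! Suc q \<noteq> K ! q" if "Suc q < length w" "w ! Suc q \<noteq> w ! q" for q
  proof (cases "Suc q = s")
    case True
    then show ?thesis using run that by auto
  next
    case False
    then show ?thesis using that K(2,3)[of q] K(2,3)[of "Suc q"]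
      by (cases "Suc q < s") (auto simp: al')
  qed
  then show ?thesis using K(1) by (simp add: reduced_index_def)
qed

text \<open>Extremal words: along the initial alternating run the letters are chosen so that
  the root vectors between the two letters a, b and between them and a third letter act on
  the run only.\<close>

lemma run_flip_vanish:
  fixes Z :: "('n::finite list \<Rightarrow> complex) set" and al :: "bool \<Rightarrow> 'n"
  assumes N: "CARD('n) \<ge> 2"
    and Z: "stable w Z" "Z \<subseteq> harmonic w"
    and van: "\<And>u K. u \<in> Z \<Longrightarrow> reduced_index w K \<Longrightarrow> u K = 0"
    and v: "v \<in> Z"
    and run: "s \<ge> 1" "s \<le> length w" "\<And>q. Suc q < s \<Longrightarrow> w ! Suc q = (\<not> w ! q)"
      "s < length w \<Longrightarrow> w ! s = w ! (s - 1)"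
    and al: "al True \<noteq> al False"
    and K: "length K = length w" "\<And>q. q < s \<Longrightarrow> K ! q = al (w ! q)"
      "\<And>q. s \<le> q \<Longrightarrow> q < length w \<Longrightarrow> K ! q = al (\<not> w ! q)"
  shows "v (K[0 := al (\<not> w ! 0)]) = 0"
proof -
  \<comment> \<open>In a run of at least two letters, flipping a position gives it the letter of its
    neighbours in the run. So z q is a coordinate at a word that is not reduced, where nothing is
    known yet.\<close>
  define z where "z q = v (K[q := al (\<not> w ! q)])" for q
  \<comment> \<open>Alternating partial sums, so that z (Suc p) = \<kappa> p + \<kappa> (Suc p). The
    recursion, in place of the coordinates that \<open>third\<close> identifies with \<kappa>, also
    makes sense for an alphabet of two letters.\<close>
  define \<kappa> where "\<kappa> = rec_nat (z 0) (\<lambda>p k. z (Suc p) - k)"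
  have \<kappa>0: "\<kappa> 0 = z 0" and \<kappa>S: "\<kappa> (Suc p) = z (Suc p) - \<kappa> p" for p
    by (simp_all add: \<kappa>_def)
  have al': "al x = al y \<longleftrightarrow> x = y" for x y
    using al by (cases x; cases y) auto
  have Kal: "K ! q \<in> range al" if "q < length w" for q
    using K(2,3)[of q] that by (cases "q < s") auto
  have redK: "reduced_index w K"
    using run(4) al K by (rule run_word_reduced)
  have adj: "K ! Suc q \<noteq> K ! q" if "Suc q < length w" "w ! Suc q \<noteq> w ! q" for q
    using redK that by (simp add: reduced_index_def)
  have redKc: "reduced_index w (K[p := c])" if "c \<notin> range al" for p c
    unfolding reduced_index_def
  proof (intro conjI allI impI)
    fix q assume q: "Suc q < length w" "w ! Suc q \<noteq> w ! q"
    show "K[p := c] ! Suc q \<noteq> K[p := c] ! q"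
      using adj[OF q] Kal[of q] Kal[of "Suc q"] q K(1) that
      by (auto simp: nth_update_if)
  qed (use K(1) in auto)
  have redKcc: "reduced_index w (K[p := c, q := c])"
    if "c \<notin> range al" "p \<noteq> Suc q" "q \<noteq> Suc p" for p q c
    unfolding reduced_index_def
  proof (intro conjI allI impI)
    fix r assume r: "Suc r < length w" "w ! Suc r \<noteq> w ! r"
    show "K[p := c, q := c] ! Suc r \<noteq> K[p := c, q := c] ! r"
      using adj[OF r] Kal[of r] Kal[of "Suc r"] r K(1) that
      by (auto simp: nth_update_if)
  qed (use K(1) in auto)
  \<comment> \<open>The relation at K between the two letters flips each position of the run once,
    with a sign given by w. These signs alternate, so the relation says that \<kappa> (s - 1) is 0
    up to sign.\<close>
  have last0: "\<kappa> (s - 1) = 0"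
  proof -
    have "(\<Sum>q<length w. if w ! q = True \<and> K ! q = al True then v (K[q := al False])
        else if w ! q \<noteq> True \<and> K ! q = al False then - v (K[q := al True]) else 0) = 0"
      by (rule root_relation[OF Z(1) v K(1) _ al]) (rule van[OF _ redK])
    also have "(\<Sum>q<length w. if w ! q = True \<and> K ! q = al True then v (K[q := al False])
        else if w ! q \<noteq> True \<and> K ! q = al False then - v (K[q := al True]) else 0) =
        (\<Sum>q<length w. if q < s then (if w ! q then z q else - z q) else 0)"
      by (rule sum.cong[OF refl], rename_tac q, case_tac "q < s"; case_tac "w ! q")
         (simp_all add: K(2,3) al' z_def)
    also have "\<dots> = (\<Sum>q<s. if w ! q then z q else - z q)"
      using run(2) by (intro sum.mono_neutral_cong_right) auto
    finally have tot: "(\<Sum>q<s. if w ! q then z q else - z q) = 0" .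
    have "p < s \<Longrightarrow> (\<Sum>q<Suc p. if w ! q then z q else - z q) = (if w ! p then \<kappa> p else - \<kappa> p)" for p
    proof (induction p)
      case (Suc p)
      then show ?case using run(3)[of p] by (auto simp: \<kappa>S)
    qed (simp add: \<kappa>0)
    from this[of "s - 1"] tot run(1) show ?thesis by (auto split: if_splits)
  qed
  \<comment> \<open>The relation at \<open>K[p := c]\<close> undoes c at p, which gives z p, or puts
    a second c at a run position of opposite sign. Two copies of c that are not adjacent leave a
    reduced word, where v vanishes; only the neighbours of p in the run survive.\<close>
  define nb where "nb p c q = (if Suc q = p \<or> (q = Suc p \<and> q < s) then v (K[p := c, q := c]) else 0)" for p c q
  have rel: "z p = (\<Sum>q<length w. nb p c q)"
    if p: "p < s" and c: "c \<notin> range al" for p c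
  proof -
    let ?f = "\<lambda>q. if w ! q = w ! p \<and> K[p := c] ! q = c then v (K[p := c, q := al (\<not> w ! p)])
      else if w ! q \<noteq> w ! p \<and> K[p := c] ! q = al (\<not> w ! p) then - v (K[p := c, q := c]) else 0"
    have cn: "c \<noteq> al x" for x using c by auto
    have "(\<Sum>q<length w. ?f q) = 0"
      by (rule root_relation[OF Z(1) v _ _ cn]) (use K(1) van[OF _ redKc[OF c]] in auto)
    moreover have "?f q = (if q = p then z p else 0) - nb p c q"
      if q: "q < length w" for q
    proof (cases "q = p")
      case True
      then show ?thesis using p run(2) K(1) by (simp add: nb_def z_def)
    next
      case False
      then have Kq: "K[p := c] ! q = K ! q" by simp
      have Kc: "K ! q \<noteq> c" using Kal[OF q] c by auto
      show ?thesis
      proof (cases "w ! q \<noteq> w ! p \<and> K ! q = al (\<not> w ! p)")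
        case True
        then have "q < s" using K(3)[of q] q by (auto simp: al' not_less[symmetric])
        then show ?thesis
        proof (cases "Suc q = p \<or> q = Suc p")
          case adjq: True
          then show ?thesis using True False Kc Kq \<open>q < s\<close> by (simp add: nb_def split: if_split)
        next
          case nadj: False
          then have "v (K[p := c, q := c]) = 0"
            by (intro van[OF v redKcc[OF c, of p q]]) auto
          then show ?thesis using True False Kc Kq nadj by (simp add: nb_def split: if_split)
        qed
      next
        case F: False
        have "\<not> (Suc q = p \<or> (q = Suc p \<and> q < s))"
        proof
          assume "Suc q = p \<or> (q = Suc p \<and> q < s)"
          then have "w ! q \<noteq> w ! p" "q < s" using run(3)[of q] run(3)[of p] p by auto
          then show False using F K(2)[of q] by auto
        qed
        moreover have "\<not> (w ! q \<noteq> w ! p \<and> K[p := c] ! q = al (\<not> w ! p))"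
          unfolding Kq by (rule F)
        moreover have "\<not> (w ! q = w ! p \<and> K[p := c] ! q = c)"
          unfolding Kq using Kc by simp
        ultimately show ?thesis by (simp only: nb_def if_not_P[OF False] if_False diff_zero)
      qed
    qed
    moreover have "(\<Sum>q<length w. ?f q) = (\<Sum>q<length w. (if q = p then z p else 0) - nb p c q)"
      by (rule sum.cong[OF refl]) (rule calculation(2), simp)
    ultimately have "0 = (\<Sum>q<length w. (if q = p then z p else 0) - nb p c q)"
      by (simp only:)
    then show ?thesis using p run(2) by (simp add: sum_subtractf)
  qed
  \<comment> \<open>Position 0 has a single neighbour in the run, so z 0 is the coordinate of the
    first pair. Each later relation involves two consecutive pairs, which is the recursion of
    \<kappa>; the value is therefore the same for all third letters.\<close>
  have third: "v (K[p := c, Suc p := c]) = \<kappa> p" if "Suc p < s" "c \<notin> range al" for p c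
    using that
  proof (induction p)
    case 0
    have "(\<Sum>q<length w. nb 0 c q) =
        (\<Sum>q<length w. if q = Suc 0 then v (K[0 := c, Suc 0 := c]) else 0)"
      using 0 by (intro sum.cong) (auto simp: nb_def)
    then show ?case using rel[of 0 c] 0 run(2) by (simp add: \<kappa>0)
  next
    case (Suc p)
    have c: "c \<notin> range al" by fact
    have "(\<Sum>q<length w. nb (Suc p) c q) =
        (\<Sum>q<length w. (if q = p then v (K[p := c, Suc p := c]) else 0) +
           (if q = Suc (Suc p) then v (K[Suc p := c, Suc (Suc p) := c]) else 0))"
      using Suc.prems by (intro sum.cong) (auto simp: nb_def list_update_swap)
    also have "\<dots> = v (K[p := c, Suc p := c]) + v (K[Suc p := c, Suc (Suc p) := c])"
      using Suc.prems run(2) by (simp add: sum.distrib)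
    finally show ?case using rel[of "Suc p" c] Suc by (simp add: \<kappa>S)
  qed
  \<comment> \<open>For c in the range of \<open>al\<close> one of the two positions keeps its
    letter and the other is flipped, which gives z p and z (Suc p). The remaining N - 2 letters
    contribute \<kappa> p each.\<close>
  have con: "z p + z (Suc p) + of_nat (CARD('n) - 2) * \<kappa> p = 0" if p: "Suc p < s" for p
  proof -
    have "0 = (\<Sum>c\<in>UNIV. v (K[p := c, Suc p := c]))"
      using harmonic_contraction[of v w p K] Z(2) v p run(2) run(3)[OF p] K(1) by auto
    also have "\<dots> = v (K[p := al (\<not> w ! p), Suc p := al (\<not> w ! p)]) +
      (v (K[p := al (w ! p), Suc p := al (w ! p)]) +
       (\<Sum>c\<in>UNIV - {al (\<not> w ! p), al (w ! p)}. v (K[p := c, Suc p := c])))"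
      by (rule sum_two_points) (simp add: al')
    also have "(\<Sum>c\<in>UNIV - {al (\<not> w ! p), al (w ! p)}. v (K[p := c, Suc p := c])) =
       (\<Sum>c\<in>UNIV - {al (\<not> w ! p), al (w ! p)}. \<kappa> p)"
    proof (rule sum.cong[OF refl])
      fix c assume "c \<in> UNIV - {al (\<not> w ! p), al (w ! p)}"
      then have "c \<notin> range al" by (cases "w ! p") (auto simp: image_iff, (metis (full_types))+)
      then show "v (K[p := c, Suc p := c]) = \<kappa> p" using third p by blast
    qed
    also have "\<dots> = of_nat (CARD('n) - 2) * \<kappa> p"
      by (simp add: card_Diff_subset al' numeral_2_eq_2)
    also have "K[p := al (\<not> w ! p), Suc p := al (\<not> w ! p)] = K[p := al (\<not> w ! p)]"
    proof -
      have "K ! Suc p = al (\<not> w ! p)" using K(2)[of "Suc p"] p run(3)[OF p] by simp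
      then show ?thesis by (metis list_update_id list_update_swap n_not_Suc_n)
    qed
    also have "K[p := al (w ! p), Suc p := al (w ! p)] = K[Suc p := al (\<not> w ! Suc p)]"
      using K(2)[of p] p run(3)[OF p] list_update_id[of K p] by simp
    finally show ?thesis by (simp add: z_def algebra_simps)
  qed
  \<comment> \<open>With \<open>third\<close> the contractions read
    \<open>\<kappa> (p - 1) + N * \<kappa> p + \<kappa> (p + 1) = 0\<close>, so the moduli cannot decrease; they end at \<open>0\<close>.\<close>
  have mono: "cmod (\<kappa> p) \<le> cmod (\<kappa> (Suc p))" if "Suc p < s" for p
    using that
  proof (induction p)
    case 0
    \<comment> \<open>N is written as 2 + (N - 2) to match the subtraction in \<open>con\<close>. At
      the left end there is no earlier term, so the equation reads N \<kappa> 0 + \<kappa> 1 =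
      0.\<close>
    have "of_nat (2 + (CARD('n) - 2)) * \<kappa> 0 + \<kappa> (Suc 0) = 0"
    proof -
      have "of_nat (2 + (CARD('n) - 2)) * \<kappa> 0 + \<kappa> (Suc 0) =
          z 0 + z (Suc 0) + of_nat (CARD('n) - 2) * \<kappa> 0"
        unfolding of_nat_add \<kappa>S \<kappa>0 by (simp add: algebra_simps)
      then show ?thesis using con[OF 0] by simp
    qed
    then have "\<kappa> (Suc 0) = - (of_nat (CARD('n)) * \<kappa> 0)"
      using N by (simp add: eq_neg_iff_add_eq_0 add.commute)
    then have "cmod (\<kappa> (Suc 0)) = real (CARD('n)) * cmod (\<kappa> 0)"
      by (simp add: norm_mult)
    moreover have "1 * cmod (\<kappa> 0) \<le> real (CARD('n)) * cmod (\<kappa> 0)"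
      using N by (intro mult_right_mono) auto
    ultimately show ?case by simp
  next
    case (Suc p)
    have "of_nat (2 + (CARD('n) - 2)) * \<kappa> (Suc p) = - (\<kappa> (Suc (Suc p)) + \<kappa> p)"
    proof -
      have "of_nat (2 + (CARD('n) - 2)) * \<kappa> (Suc p) + (\<kappa> (Suc (Suc p)) + \<kappa> p) =
          z (Suc p) + z (Suc (Suc p)) + of_nat (CARD('n) - 2) * \<kappa> (Suc p)"
        unfolding of_nat_add \<kappa>S[of "Suc p"] using \<kappa>S[of p] by (simp add: algebra_simps)
      then show ?thesis using con[OF Suc.prems] by (metis eq_neg_iff_add_eq_0)
    qed
    then have "cmod (of_nat (2 + (CARD('n) - 2)) * \<kappa> (Suc p)) = cmod (\<kappa> (Suc (Suc p)) + \<kappa> p)"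
      by (simp only: norm_minus_cancel)
    then have "real (CARD('n)) * cmod (\<kappa> (Suc p)) \<le> cmod (\<kappa> (Suc (Suc p))) + cmod (\<kappa> p)"
      using N norm_triangle_ineq[of "\<kappa> (Suc (Suc p))" "\<kappa> p"] by (simp add: norm_mult)
    moreover have "2 * cmod (\<kappa> (Suc p)) \<le> real (CARD('n)) * cmod (\<kappa> (Suc p))"
      using N by (intro mult_right_mono) auto
    ultimately show ?case using Suc by simp
  qed
  have "p < s \<Longrightarrow> cmod (\<kappa> 0) \<le> cmod (\<kappa> p)" for p
    by (induction p) (use mono in \<open>auto intro: order_trans\<close>)
  from this[of "s - 1"] last0 run(1) have "\<kappa> 0 = 0" by simp
  then show ?thesis by (simp add: \<kappa>0 z_def)
qed

section \<open>Descent to a shorter word by slicing off the first leg\<close>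

text \<open>One tensor of Z is allowed for each first letter, because a unitary matrix acts on the
  first leg too and mixes the slices. The sums form a subspace without taking a span.\<close>

definition first_slices :: "('n::finite list \<Rightarrow> complex) set \<Rightarrow> ('n list \<Rightarrow> complex) set" where
  "first_slices Z = {\<lambda>J. \<Sum>y\<in>UNIV. \<eta> y (y # J) | \<eta>. \<forall>y. \<eta> y \<in> Z}"

lemma weight_Cons: "weight (t # w) (y # J) = cons_reduced (y, t) (weight w J)"
  by (simp add: weight_def)

lemma weight_Cons_eq_iff:
  assumes "h \<in> reduced_words"
  shows "weight (t # w) (y # J) = cons_reduced (y, t) h \<longleftrightarrow> weight w J = h"
  unfolding weight_Cons
  by (metis assms cons_reduced_cancel' weight_reduced)

lemma stable_first_slices:
  assumes Z: "stable (t # w) Z"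
  shows "stable w (first_slices Z)"
  unfolding stable_def
proof (intro conjI ballI allI)
  show "(\<lambda>_. 0) \<in> first_slices Z"
    using Z unfolding first_slices_def stable_def
    by (intro CollectI exI[of _ "\<lambda>_ _. 0"]) auto
next
  fix u v assume "u \<in> first_slices Z" "v \<in> first_slices Z"
  then obtain \<eta> \<theta> where "u = (\<lambda>J. \<Sum>y\<in>UNIV. \<eta> y (y # J))" "v = (\<lambda>J. \<Sum>y\<in>UNIV. \<theta> y (y # J))"
      "\<forall>y. \<eta> y \<in> Z" "\<forall>y. \<theta> y \<in> Z"
    unfolding first_slices_def by blast
  then show "(\<lambda>I. u I + v I) \<in> first_slices Z"
    using Z unfolding first_slices_def stable_def
    by (intro CollectI exI[of _ "\<lambda>y I. \<eta> y I + \<theta> y I"]) (auto simp: sum.distrib)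
next
  fix c v assume "v \<in> first_slices Z"
  then obtain \<eta> where "v = (\<lambda>J. \<Sum>y\<in>UNIV. \<eta> y (y # J))" "\<forall>y. \<eta> y \<in> Z"
    unfolding first_slices_def by blast
  then show "(\<lambda>I. c * v I) \<in> first_slices Z"
    using Z unfolding first_slices_def stable_def
    by (intro CollectI exI[of _ "\<lambda>y I. c * \<eta> y I"]) (auto simp: sum_distrib_left)
next
  fix U :: "complex^'a^'a" and v
  assume U: "U \<in> carrier unitary_group" and "v \<in> first_slices Z"
  then obtain \<eta> where v: "v = (\<lambda>J. \<Sum>y\<in>UNIV. \<eta> y (y # J))" and \<eta>: "\<forall>y. \<eta> y \<in> Z"
    unfolding first_slices_def by blast
  have fin: "(\<lambda>I. \<Sum>x\<in>S. c x * \<eta>' x I) \<in> Z" if "\<forall>y. \<eta>' y \<in> Z" "finite S"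
    for \<eta>' :: "'a \<Rightarrow> _" and S and c :: "'a \<Rightarrow> complex"
    using that(2)
  proof (induction S rule: finite_induct)
    case empty
    then show ?case using Z by (simp add: stable_def)
  next
    case (insert x S)
    have "(\<lambda>I. c x * \<eta>' x I) \<in> Z" using Z that(1) by (simp add: stable_def)
    then show ?case using Z insert by (simp add: stable_def)
  qed
  \<comment> \<open>Acting with U on all legs also turns the leg that is sliced off. The entries of
    opposite sign in front undo this, again by orthogonality of columns.\<close>
  let ?\<theta> = "\<lambda>y I. \<Sum>z\<in>UNIV. signed_entry U (\<not> t) y z * tensor_act U (t # w) (\<eta> z) I"
  have "?\<theta> y \<in> Z" for y
    by (rule fin) (use Z U \<eta> in \<open>auto simp: stable_def\<close>)
  moreover have "tensor_act U w v J = (\<Sum>y\<in>UNIV. ?\<theta> y (y # J))" for J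
  proof -
    let ?T = "\<lambda>z j. tensor_act U w (\<lambda>J. \<eta> z (j # J)) J"
    have "(\<Sum>y\<in>UNIV. ?\<theta> y (y # J)) = (\<Sum>y\<in>UNIV. \<Sum>z\<in>UNIV. \<Sum>j\<in>UNIV.
        signed_entry U (\<not> t) y z * signed_entry U t y j * ?T z j)"
      by (simp add: sum_distrib_left mult.assoc)
    also have "\<dots> = (\<Sum>z\<in>UNIV. \<Sum>j\<in>UNIV. \<Sum>y\<in>UNIV.
        signed_entry U (\<not> t) y z * signed_entry U t y j * ?T z j)"
      by (subst sum.swap, rule sum.cong[OF refl], rule sum.swap)
    also have "\<dots> = (\<Sum>z\<in>UNIV. \<Sum>j\<in>UNIV. (if z = j then 1 else 0) * ?T z j)"
      using signed_entry_cols[OF U, of "\<not> t"] by (simp add: sum_distrib_right[symmetric])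
    also have "\<dots> = (\<Sum>z\<in>UNIV. \<Sum>j\<in>UNIV. if j = z then ?T z j else 0)"
      by (intro sum.cong) auto
    also have "\<dots> = (\<Sum>z\<in>UNIV. ?T z z)"
      by simp
    also have "\<dots> = tensor_act U w v J"
      unfolding v by (simp add: tensor_act_sum)
    finally show ?thesis by simp
  qed
  ultimately show "tensor_act U w v \<in> first_slices Z"
    unfolding first_slices_def by (intro CollectI exI[of _ ?\<theta>]) auto
next
  fix h v assume "v \<in> first_slices Z"
  then obtain \<eta> where v: "v = (\<lambda>J. \<Sum>y\<in>UNIV. \<eta> y (y # J))" and \<eta>: "\<forall>y. \<eta> y \<in> Z"
    unfolding first_slices_def by blast
  show "weight_proj h w v \<in> first_slices Z"
  proof (cases "h \<in> reduced_words")
    case True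
    \<comment> \<open>Slicing off y shifts the weight by the letter (y, t), which is a bijection of
      reduced words. So a different projection is applied to each \<eta> y.\<close>
    have "weight_proj h w v = (\<lambda>J. \<Sum>y\<in>UNIV. weight_proj (cons_reduced (y, t) h) (t # w) (\<eta> y) (y # J))"
      unfolding weight_proj_def weight_Cons_eq_iff[OF True] v by auto
    moreover have "weight_proj (cons_reduced (y, t) h) (t # w) (\<eta> y) \<in> Z" for y
      using Z \<eta> by (simp add: stable_def)
    ultimately show ?thesis
      unfolding first_slices_def
      by (intro CollectI exI[of _ "\<lambda>y. weight_proj (cons_reduced (y, t) h) (t # w) (\<eta> y)"]) auto
  next
    case False
    then have "weight_proj h w v = (\<lambda>_. 0)"
      unfolding weight_proj_def using weight_reduced by (metis (full_types))
    moreover have "(\<lambda>_. 0) \<in> first_slices Z"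
      using Z unfolding first_slices_def stable_def
      by (intro CollectI exI[of _ "\<lambda>_ _. 0"]) auto
    ultimately show ?thesis by simp
  qed
qed

lemma first_slices_harmonic:
  assumes "Z \<subseteq> harmonic (t # w)"
  shows "first_slices Z \<subseteq> harmonic w"
proof
  fix v assume "v \<in> first_slices Z"
  then obtain \<eta> where v: "v = (\<lambda>J. \<Sum>y\<in>UNIV. \<eta> y (y # J))" and "\<forall>y. \<eta> y \<in> Z"
    unfolding first_slices_def by blast
  then have \<eta>: "\<eta> y \<in> harmonic (t # w)" for y using assms by auto
  show "v \<in> harmonic w"
    unfolding harmonic_def
  proof (intro CollectI conjI allI impI)
    fix I :: "'a list" assume "length I \<noteq> length w"
    then show "v I = 0" using \<eta> by (simp add: v harmonic_def)
  next
    fix w1 s w2 and I1 I2 :: "'a list"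
    assume "w = w1 @ s # (\<not> s) # w2" and l: "length I1 = length w1" "length I2 = length w2"
    then have w: "t # w = (t # w1) @ s # (\<not> s) # w2" by simp
    have "(\<Sum>c\<in>UNIV. \<eta> y ((y # I1) @ c # c # I2)) = 0" for y
    proof -
      have "length (y # I1) = length (t # w1)" using l by simp
      then show ?thesis using \<eta>[of y] l(2) w unfolding harmonic_def by blast
    qed
    then show "(\<Sum>c\<in>UNIV. v (I1 @ c # c # I2)) = 0"
      unfolding v by (subst sum.swap) simp
  qed
qed

text \<open>The weight space at K is a line, so a stable subspace of harmonic tensors contains the
  basis tensor at K or vanishes there, and the second alternative leaves only 0. Passing to the
  orthogonal complement turns this into irreducibility. The induction removes the first leg.\<close>

theorem harmonic_irreducible:
  fixes Z :: "('n::finite list \<Rightarrow> complex) set"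
  assumes N: "CARD('n) \<ge> 2"
    and "stable w Z" "Z \<subseteq> harmonic w"
    and "reduced_index w K" "\<And>v. v \<in> Z \<Longrightarrow> v K = 0"
    and "v \<in> Z"
  shows "v = (\<lambda>_. 0)"
  using assms(2-)
proof (induction w arbitrary: Z K v)
  case Nil
  then show ?case
  proof (intro ext)
    fix I
    have "v \<in> harmonic []" "K = []" "v K = 0"
      using Nil by (auto simp: reduced_index_def)
    then show "v I = 0" by (cases "I = []") (auto simp: harmonic_def)
  qed
next
  case (Cons t w)
  let ?w = "t # w"
  note Z = Cons.prems(1,2)
  have van: "u L = 0" if "u \<in> Z" "reduced_index ?w L" for u L
    by (rule stable_reduced_vanish[OF N Z Cons.prems(3) _ that(2,1)]) (rule Cons.prems(4))
  have "?w \<noteq> []" by simp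
  from initial_alternating_run[OF this] obtain s where s: "s \<ge> 1" "s \<le> length ?w"
      "\<And>q. Suc q < s \<Longrightarrow> ?w ! Suc q = (\<not> ?w ! q)"
      "s < length ?w \<Longrightarrow> ?w ! s = ?w ! (s - 1)"
    by blast
  have "\<not> card (UNIV :: 'n set) \<le> Suc 0" using N by simp
  then obtain a b :: 'n where "a \<noteq> b"
    by (metis UNIV_I card_le_Suc0_iff_eq finite_class.finite_UNIV)
  define al where "al x = (if x then a else b)" for x
  have al: "al True \<noteq> al False" using \<open>a \<noteq> b\<close> by (simp add: al_def)
  have al': "al x = al y \<longleftrightarrow> x = y" for x y
    using al by (cases x; cases y) auto
  \<comment> \<open>The letter follows the sign on the initial run and the opposite sign after it,
    which is the shape that \<open>run_flip_vanish\<close> asks for.\<close>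
  define L where "L = map (\<lambda>q. if q < s then al (?w ! q) else al (\<not> ?w ! q)) [0..<length ?w]"
  have L: "length L = length ?w" "\<And>q. q < s \<Longrightarrow> L ! q = al (?w ! q)"
      "\<And>q. s \<le> q \<Longrightarrow> q < length ?w \<Longrightarrow> L ! q = al (\<not> ?w ! q)"
    using s(2) by (auto simp: L_def simp del: upt_Suc)
  have redL: "reduced_index ?w L"
    using s(4) al L by (rule run_word_reduced)
  obtain L' where L': "L = al t # L'" "length L' = length w"
    using L(1) L(2)[of 0] s(1) by (cases L) auto
  have redL': "reduced_index w L'"
    unfolding reduced_index_def
  proof (intro conjI allI impI)
    fix q assume "Suc q < length w" "w ! Suc q \<noteq> w ! q"
    then show "L' ! Suc q \<noteq> L' ! q"
      using redL unfolding reduced_index_def L'(1) by (auto dest!: spec[of _ "Suc q"])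
  qed (rule L'(2))
  \<comment> \<open>Only y = al (\<not> t) can clash with the first letter of \<open>L'\<close>, and
    this word is L with position 0 flipped. Every other y gives a reduced word.\<close>
  have vanL: "u (y # L') = 0" if u: "u \<in> Z" for u y
  proof (cases "y = al (\<not> t)")
    case True
    have "u (L[0 := al (\<not> ?w ! 0)]) = 0"
      by (rule run_flip_vanish[where al = al, OF N Z _ u s al L]) (rule van)
    then show ?thesis
      using True L'(1) by simp
  next
    case False
    have "reduced_index ?w (y # L')"
      unfolding reduced_index_def
    proof (intro conjI allI impI)
      fix q assume q: "Suc q < length ?w" "?w ! Suc q \<noteq> ?w ! q"
      show "(y # L') ! Suc q \<noteq> (y # L') ! q"
      proof (cases q)
        \<comment> \<open>Opposite signs at positions 0 and 1 mean that the run has length at least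
          2, so \<open>L'\<close> starts with al (\<not> t).\<close>
        case 0
        then have "s > 1" using s(1,4) q by (cases "s = 1") auto
        then have "L' ! 0 = al (\<not> t)" using L(2)[of 1] q 0 L'(1) by auto
        then show ?thesis using False 0 by auto
      next
        case (Suc r)
        then show ?thesis using redL' q by (simp add: reduced_index_def)
      qed
    qed (use L'(2) in simp)
    then show ?thesis using van u by blast
  qed
  have zero: "u = (\<lambda>_. 0)" if "u \<in> first_slices Z" for u
  proof (rule Cons.IH[OF stable_first_slices[OF Z(1)] first_slices_harmonic[OF Z(2)] redL' _ that])
    fix u assume "u \<in> first_slices Z"
    then show "u L' = 0" using vanL unfolding first_slices_def by (auto intro!: sum.neutral)
  qed
  show ?case
  proof
    fix I
    show "v I = 0"
    proof (cases I)
      case Nil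
      then show ?thesis using Z(2) Cons.prems(5) by (auto simp: harmonic_def)
    next
      case (Cons y J)
      \<comment> \<open>The slice of v at y, obtained by taking v for the letter y and 0 for all
        others.\<close>
      have "(\<lambda>J. \<Sum>x\<in>UNIV. (if x = y then v else (\<lambda>_. 0)) (x # J)) \<in> first_slices Z"
        unfolding first_slices_def using Cons.prems(5) Z(1)
        by (intro CollectI exI[of _ "\<lambda>x. if x = y then v else (\<lambda>_. 0)"]) (auto simp: stable_def)
      from zero[OF this, THEN fun_cong, of J] have "(\<Sum>x\<in>UNIV. (if x = y then v else (\<lambda>_. 0)) (x # J)) = 0" .
      also have "(\<Sum>x\<in>UNIV. (if x = y then v else (\<lambda>_. 0)) (x # J)) = (\<Sum>x\<in>UNIV. if x = y then v (x # J) else 0)"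
        by (intro sum.cong) auto
      finally show ?thesis using Cons by simp
    qed
  qed
qed

section \<open>Linear functionals on the free *-algebra\<close>

abbreviation "keys \<equiv> Poly_Mapping.keys"
abbreviation "lookup \<equiv> Poly_Mapping.lookup"
abbreviation "single \<equiv> Poly_Mapping.single"
abbreviation scale :: "complex \<Rightarrow> ('m \<Rightarrow>\<^sub>0 complex) \<Rightarrow> 'm \<Rightarrow>\<^sub>0 complex" where
  "scale c \<equiv> Poly_Mapping.map ((*) c)"

section \<open>Linear extension of functions on a basis\<close>

definition pairing :: "('m \<Rightarrow> complex) \<Rightarrow> ('m \<Rightarrow>\<^sub>0 complex) \<Rightarrow> complex" where
  "pairing \<xi> f = (\<Sum>x\<in>keys f. lookup f x * \<xi> x)"

lemma pairing_superset:
  "finite S \<Longrightarrow> keys f \<subseteq> S \<Longrightarrow> pairing \<xi> f = (\<Sum>x\<in>S. lookup f x * \<xi> x)"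
  unfolding pairing_def by (intro sum.mono_neutral_left) (auto simp: in_keys_iff)

lemma pairing_add: "pairing \<xi> (f + g) = pairing \<xi> f + pairing \<xi> g"
proof -
  let ?S = "keys f \<union> keys g"
  have "pairing \<xi> (f + g) = (\<Sum>x\<in>?S. lookup (f + g) x * \<xi> x)"
    using keys_add[of f g] by (intro pairing_superset) auto
  then show ?thesis
    by (simp add: pairing_superset[of ?S f] pairing_superset[of ?S g] lookup_add
        distrib_right sum.distrib)
qed

lemma lookup_scale: "lookup (scale c f) x = c * lookup f x"
  by (simp add: Poly_Mapping.map.rep_eq when_def)

lemma keys_scale: "keys (scale c f) \<subseteq> keys f"
  by (auto simp: in_keys_iff lookup_scale)

lemma pairing_scale: "pairing \<xi> (scale c f) = c * pairing \<xi> f"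
  by (subst pairing_superset[OF _ keys_scale])
     (simp_all add: lookup_scale pairing_def sum_distrib_left mult.assoc)

lemma pairing_zero [simp]: "pairing \<xi> 0 = 0"
  by (simp add: pairing_def)

lemma pairing_single [simp]: "pairing \<xi> (single x c) = c * \<xi> x"
  by (simp add: pairing_def)

lemma pairing_uminus: "pairing \<xi> (- f) = - pairing \<xi> f"
  using pairing_add[of \<xi> f "- f"] by (simp add: add_eq_0_iff)

lemma pairing_diff: "pairing \<xi> (f - g) = pairing \<xi> f - pairing \<xi> g"
  using pairing_add[of \<xi> f "- g"] by (simp add: pairing_uminus)

lemma pairing_sum: "pairing \<xi> (\<Sum>i\<in>S. f i) = (\<Sum>i\<in>S. pairing \<xi> (f i))"
  by (induction S rule: infinite_finite_induct) (auto simp: pairing_add)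

lemma poly_mapping_eq_sum_single:
  "f = (\<Sum>x\<in>keys f. single x (lookup f x))"
  by (rule poly_mapping_eqI)
     (auto simp: lookup_sum lookup_single when_def in_keys_iff)

section \<open>Words as matrix coefficients, and convolution of functionals\<close>

definition letter_word :: "'n list \<Rightarrow> 'n list \<Rightarrow> bool list \<Rightarrow> 'n letter list" where
  "letter_word I J w = zip (zip I J) w"

definition row_word :: "'n letter list \<Rightarrow> 'n list" where "row_word = map (\<lambda>l. fst (fst l))"
definition col_word :: "'n letter list \<Rightarrow> 'n list" where "col_word = map (\<lambda>l. snd (fst l))"
definition sign_word :: "'n letter list \<Rightarrow> bool list" where "sign_word = map snd"

lemma length_letter_parts [simp]:
  "length (row_word x) = length x" "length (col_word x) = length x" "length (sign_word x) = length x"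
  by (auto simp: row_word_def col_word_def sign_word_def)

lemma letter_word_parts [simp]: "letter_word (row_word x) (col_word x) (sign_word x) = x"
  by (induction x) (auto simp: letter_word_def row_word_def col_word_def sign_word_def)

lemma parts_letter_word:
  assumes "length I = length w" "length J = length w"
  shows "row_word (letter_word I J w) = I" "col_word (letter_word I J w) = J" "sign_word (letter_word I J w) = w"
    "length (letter_word I J w) = length w"
proof -
  have "length J = length I" using assms by simp
  from this assms show "row_word (letter_word I J w) = I" "col_word (letter_word I J w) = J"
      "sign_word (letter_word I J w) = w" "length (letter_word I J w) = length w"
    by (induction I w arbitrary: J rule: list_induct2')
       (auto simp: letter_word_def row_word_def col_word_def sign_word_def length_Suc_conv)
qed

definition index_lists :: "nat \<Rightarrow> 'n list set" where "index_lists n = {I. length I = n}"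

lemma finite_index_lists [simp]: "finite (index_lists n :: 'n::finite list set)"
  using finite_lists_length_eq[of "UNIV :: 'n set" n] by (simp add: index_lists_def)

lemma index_lists_iff [simp]: "I \<in> index_lists n \<longleftrightarrow> length I = n"
  by (simp add: index_lists_def)

text \<open>The product dual to the comultiplication of the free *-algebra.\<close>

definition convolution ::
  "('n::finite letter list \<Rightarrow> complex) \<Rightarrow> ('n letter list \<Rightarrow> complex) \<Rightarrow> 'n letter list \<Rightarrow> complex" where
  "convolution \<phi> \<psi> x = (\<Sum>K\<in>index_lists (length x).
     \<phi> (letter_word (row_word x) K (sign_word x)) * \<psi> (letter_word K (col_word x) (sign_word x)))"

definition unitary_coeff :: "complex^'n^'n \<Rightarrow> 'n letter list \<Rightarrow> complex" where
  "unitary_coeff U x = (\<Prod>((i, j), s)\<leftarrow>x. signed_entry U s i j)"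

text \<open>The coefficient of h in the image of the word x under u_ij -> \<delta>_ij g_i.\<close>

definition torus_coeff :: "('n \<times> bool) list \<Rightarrow> 'n letter list \<Rightarrow> complex" where
  "torus_coeff h x = (if row_word x = col_word x \<and> weight (sign_word x) (row_word x) = h then 1 else 0)"

lemma sum_index_lists_Suc:
  "(\<Sum>I\<in>index_lists (Suc n). f I) = (\<Sum>i\<in>(UNIV::'n::finite set). \<Sum>I\<in>index_lists n. f (i # I))"
proof -
  have "(\<Sum>i\<in>(UNIV::'n set). \<Sum>I\<in>index_lists n. f (i # I)) =
      (\<Sum>(i, I)\<in>UNIV \<times> index_lists n. f (i # I))"
    by (simp add: sum.cartesian_product)
  also have "\<dots> = (\<Sum>I\<in>index_lists (Suc n). f I)"
    by (rule sum.reindex_bij_witness[of _ "\<lambda>I. (hd I, tl I)" "\<lambda>(i, I). i # I"])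
       (auto simp: length_Suc_conv)
  finally show ?thesis by simp
qed

lemma index_lists_0 [simp]: "index_lists 0 = {[]}"
  by (auto simp: index_lists_def)

lemma tensor_act_eq_sum:
  "length I = length w \<Longrightarrow>
     tensor_act U w v I = (\<Sum>J\<in>index_lists (length w). unitary_coeff U (letter_word I J w) * v J)"
proof (induction w arbitrary: I v)
  case Nil
  then show ?case by (simp add: unitary_coeff_def letter_word_def)
next
  case (Cons s w)
  then obtain i I' where I: "I = i # I'" "length I' = length w" by (cases I) auto
  show ?case
    unfolding I(1) tensor_act.simps Cons.IH[OF I(2)] length_Cons sum_index_lists_Suc
    by (simp add: letter_word_def unitary_coeff_def sum_distrib_left mult.assoc)
qed

lemma unitary_coeff_transpose:
  "length I = length w \<Longrightarrow> length J = length w \<Longrightarrow>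
    unitary_coeff (transpose U) (letter_word I J w) = unitary_coeff U (letter_word J I w)"
proof (induction w arbitrary: I J)
  case (Cons s w)
  then obtain i I' j J' where "I = i # I'" "J = j # J'" "length I' = length w" "length J' = length w"
    by (metis length_Suc_conv)
  then show ?case using Cons.IH[of I' J']
    by (simp add: unitary_coeff_def letter_word_def signed_entry_def transpose_def)
qed (simp add: letter_word_def unitary_coeff_def)

lemma transpose_unitary:
  assumes "U \<in> carrier unitary_group"
  shows "transpose U \<in> carrier unitary_group"
proof -
  have r: "(\<Sum>k\<in>UNIV. U $ i $ k * cnj (U $ j $ k)) = (if i = j then 1 else 0)"
   and c: "(\<Sum>k\<in>UNIV. cnj (U $ k $ i) * U $ k $ j) = (if i = j then 1 else 0)" for i j
    using assms unfolding unitary_group_iff by blast+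
  show ?thesis
    unfolding unitary_group_iff transpose_def
    using r c by (auto simp: mult.commute)
qed

lemma convolution_letter_word:
  assumes "length I = length w" "length J = length w"
  shows "convolution \<phi> \<psi> (letter_word I J w) =
    (\<Sum>K\<in>index_lists (length w). \<phi> (letter_word I K w) * \<psi> (letter_word K J w))"
  by (simp add: convolution_def parts_letter_word assms)

lemma convolution_torus_left:
  assumes "length I = length w" "length J = length w"
  shows "convolution (torus_coeff h) \<psi> (letter_word I J w) =
    (if weight w I = h then \<psi> (letter_word I J w) else 0)"
proof -
  have "convolution (torus_coeff h) \<psi> (letter_word I J w) =
    (\<Sum>K\<in>index_lists (length w). if K = I then (if weight w I = h then \<psi> (letter_word I J w) else 0) else 0)"
    unfolding convolution_letter_word[OF assms]
    by (rule sum.cong) (auto simp: torus_coeff_def parts_letter_word assms)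
  then show ?thesis using assms by simp
qed

lemma exists_reduced_index:
  assumes "CARD('n::finite) \<ge> 2"
  shows "\<exists>K :: 'n list. reduced_index w K"
proof -
  have "\<not> card (UNIV :: 'n set) \<le> Suc 0" using assms by simp
  then obtain a b :: 'n where "a \<noteq> b"
    by (metis UNIV_I card_le_Suc0_iff_eq finite_class.finite_UNIV)
  then show ?thesis
    by (intro exI[of _ "map (\<lambda>x. if x then a else b) w"]) (auto simp: reduced_index_def)
qed

section \<open>Harmonic tensors are separated by the functionals\<close>

lemma harmonic_zero: "(\<lambda>_. 0) \<in> harmonic w"
  by (simp add: harmonic_def)

lemma harmonic_add: "u \<in> harmonic w \<Longrightarrow> v \<in> harmonic w \<Longrightarrow> (\<lambda>I. u I + v I) \<in> harmonic w"
  by (auto simp: harmonic_def sum.distrib)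

lemma harmonic_scale: "v \<in> harmonic w \<Longrightarrow> (\<lambda>I. c * v I) \<in> harmonic w"
  by (auto simp: harmonic_def sum_distrib_left[symmetric])

lemma harmonic_sum:
  "(\<And>x. x \<in> S \<Longrightarrow> f x \<in> harmonic w) \<Longrightarrow> (\<lambda>I. \<Sum>x\<in>S. c x * f x I) \<in> harmonic w"
  by (induction S rule: infinite_finite_induct)
     (auto simp: harmonic_zero intro!: harmonic_add harmonic_scale)

definition transpose_word :: "'n letter list \<Rightarrow> 'n letter list" where
  "transpose_word = map (\<lambda>((i, j), s). ((j, i), s))"

lemma transpose_word_parts [simp]:
  "length (transpose_word x) = length x" "row_word (transpose_word x) = col_word x"
  "col_word (transpose_word x) = row_word x" "sign_word (transpose_word x) = sign_word x"
  by (auto simp: transpose_word_def row_word_def col_word_def sign_word_def)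

lemma transpose_letter_word:
  assumes "length I = length w" "length J = length w"
  shows "transpose_word (letter_word I J w) = letter_word J I w"
  using letter_word_parts[of "transpose_word (letter_word I J w)"]
  by (simp add: parts_letter_word assms)

text \<open>An abstraction of the annihilator of the kernel of the quotient map. As a parameter it
  can be replaced by its transpose, which turns statements about row indices into statements about
  column indices.\<close>

locale generating_functionals =
  fixes \<Phi> :: "('n::finite letter list \<Rightarrow> complex) set"
  assumes card_ge_2: "CARD('n) \<ge> 2"
    and convolution_closed: "\<phi> \<in> \<Phi> \<Longrightarrow> \<psi> \<in> \<Phi> \<Longrightarrow> convolution \<phi> \<psi> \<in> \<Phi>"
    and unitary_coeff_mem: "U \<in> carrier unitary_group \<Longrightarrow> unitary_coeff U \<in> \<Phi>"
    and torus_coeff_mem: "h \<in> reduced_words \<Longrightarrow> torus_coeff h \<in> \<Phi>"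
begin

text \<open>The tensors annihilated against column K by all of \<Phi> form a stable subspace: an
  operator applied to v can be moved onto \<phi> as a convolution from the left. The torus
  coefficient at \<open>zip K w\<close> reads off the coordinate at K, so irreducibility
  applies.\<close>

lemma harmonic_left_vanish:
  assumes K: "reduced_index w K" and v: "v \<in> harmonic w"
    and zero: "\<And>\<phi>. \<phi> \<in> \<Phi> \<Longrightarrow> (\<Sum>I\<in>index_lists (length w). v I * \<phi> (letter_word I K w)) = 0"
  shows "v = (\<lambda>_. 0)"
proof -
  have lK: "length K = length w" using K by (simp add: reduced_index_def)
  define Z where "Z = {v \<in> harmonic w. \<forall>\<phi>\<in>\<Phi>.
     (\<Sum>I\<in>index_lists (length w). v I * \<phi> (letter_word I K w)) = 0}"
  have "stable w Z"
    unfolding stable_def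
  proof (intro conjI ballI allI)
    show "(\<lambda>_. 0) \<in> Z" by (simp add: Z_def harmonic_zero)
  next
    fix u v assume "u \<in> Z" "v \<in> Z"
    then show "(\<lambda>I. u I + v I) \<in> Z"
      by (simp add: Z_def harmonic_add distrib_right sum.distrib)
  next
    fix c v assume "v \<in> Z"
    then show "(\<lambda>I. c * v I) \<in> Z"
      by (simp add: Z_def harmonic_scale mult.assoc sum_distrib_left[symmetric])
  next
    fix U :: "complex^'n^'n" and v
    assume U: "U \<in> carrier unitary_group" and v: "v \<in> Z"
    have "(\<Sum>I\<in>index_lists (length w). tensor_act U w v I * \<phi> (letter_word I K w)) = 0" if "\<phi> \<in> \<Phi>" for \<phi>
    proof -
      \<comment> \<open>The pairing involves no conjugation, so moving U across it produces the
        transpose.\<close>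
      have "(\<Sum>I\<in>index_lists (length w). tensor_act U w v I * \<phi> (letter_word I K w)) =
        (\<Sum>I\<in>index_lists (length w). \<Sum>J\<in>index_lists (length w).
           v J * (unitary_coeff (transpose U) (letter_word J I w) * \<phi> (letter_word I K w)))"
        by (intro sum.cong refl)
           (simp add: tensor_act_eq_sum unitary_coeff_transpose sum_distrib_left sum_distrib_right mult_ac)
      also have "\<dots> = (\<Sum>J\<in>index_lists (length w).
           v J * convolution (unitary_coeff (transpose U)) \<phi> (letter_word J K w))"
        by (subst sum.swap) (simp add: convolution_letter_word lK sum_distrib_left)
      also have "\<dots> = 0"
        using v convolution_closed[OF unitary_coeff_mem[OF transpose_unitary[OF U]] that]
        by (simp add: Z_def)
      finally show ?thesis .
    qed
    then show "tensor_act U w v \<in> Z"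
      using v U by (simp add: Z_def tensor_act_harmonic)
  next
    fix h v assume v: "v \<in> Z"
    have "(\<Sum>I\<in>index_lists (length w). weight_proj h w v I * \<phi> (letter_word I K w)) = 0" if "\<phi> \<in> \<Phi>" for \<phi>
    proof (cases "h \<in> reduced_words")
      case True
      have "(\<Sum>I\<in>index_lists (length w). weight_proj h w v I * \<phi> (letter_word I K w)) =
        (\<Sum>I\<in>index_lists (length w). v I * convolution (torus_coeff h) \<phi> (letter_word I K w))"
        by (intro sum.cong refl) (simp add: convolution_torus_left lK weight_proj_def)
      then show ?thesis
        using v convolution_closed[OF torus_coeff_mem[OF True] that] by (simp add: Z_def)
    next
      case False
      then have "weight w I \<noteq> h" for I :: "'n list" using weight_reduced by metis
      then show ?thesis by (simp add: weight_proj_def)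
    qed
    then show "weight_proj h w v \<in> Z"
      using v by (simp add: Z_def weight_proj_harmonic)
  qed
  moreover have "Z \<subseteq> harmonic w" by (auto simp: Z_def)
  moreover have "u K = 0" if "u \<in> Z" for u
  proof -
    have "torus_coeff (zip K w) \<in> \<Phi>"
      using K lK by (intro torus_coeff_mem) (simp add: reduced_index_zip)
    then have "0 = (\<Sum>I\<in>index_lists (length w). u I * torus_coeff (zip K w) (letter_word I K w))"
      using that by (simp add: Z_def)
    also have "\<dots> = (\<Sum>I\<in>index_lists (length w). if I = K then u K else 0)"
      by (intro sum.cong) (auto simp: torus_coeff_def parts_letter_word lK weight_reduced_index[OF K])
    finally show ?thesis using lK by simp
  qed
  moreover have "v \<in> Z" using v zero by (simp add: Z_def)
  ultimately show ?thesis
    using harmonic_irreducible[OF card_ge_2 _ _ K] by blast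
qed

text \<open>Exchanging rows and columns reverses convolutions, transposes unitary matrices and fixes
  the diagonal torus coefficients.\<close>

lemma generating_functionals_transpose: "generating_functionals ((\<lambda>\<phi>. \<phi> \<circ> transpose_word) ` \<Phi>)"
proof
  show "CARD('n) \<ge> 2" by (rule card_ge_2)
next
  fix \<phi> \<psi> assume "\<phi> \<in> (\<lambda>\<phi>. \<phi> \<circ> transpose_word) ` \<Phi>" "\<psi> \<in> (\<lambda>\<phi>. \<phi> \<circ> transpose_word) ` \<Phi>"
  then obtain \<phi>' \<psi>' where *: "\<phi> = \<phi>' \<circ> transpose_word" "\<psi> = \<psi>' \<circ> transpose_word" "\<phi>' \<in> \<Phi>" "\<psi>' \<in> \<Phi>"
    by blast
  have "convolution \<phi> \<psi> = convolution \<psi>' \<phi>' \<circ> transpose_word"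
    unfolding *(1,2) convolution_def fun_eq_iff by (simp add: transpose_letter_word mult.commute)
  then show "convolution \<phi> \<psi> \<in> (\<lambda>\<phi>. \<phi> \<circ> transpose_word) ` \<Phi>"
    using convolution_closed[OF *(4,3)] by blast
next
  fix U :: "complex^'n^'n" assume "U \<in> carrier unitary_group"
  then have "unitary_coeff (transpose U) \<in> \<Phi>" by (intro unitary_coeff_mem transpose_unitary)
  moreover have "unitary_coeff U = unitary_coeff (transpose U) \<circ> transpose_word"
  proof
    fix x :: "'n letter list"
    have "transpose_word x = letter_word (col_word x) (row_word x) (sign_word x)"
      using transpose_letter_word[of "row_word x" "sign_word x" "col_word x"] by simp
    then show "unitary_coeff U x = (unitary_coeff (transpose U) \<circ> transpose_word) x"
      using unitary_coeff_transpose[of "col_word x" "sign_word x" "row_word x" U] by simp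
  qed
  ultimately show "unitary_coeff U \<in> (\<lambda>\<phi>. \<phi> \<circ> transpose_word) ` \<Phi>" by blast
next
  fix h :: "('n \<times> bool) list" assume "h \<in> reduced_words"
  then have "torus_coeff h \<in> \<Phi>" by (rule torus_coeff_mem)
  moreover have "torus_coeff h = torus_coeff h \<circ> transpose_word"
    by (auto simp: fun_eq_iff torus_coeff_def)
  ultimately show "torus_coeff h \<in> (\<lambda>\<phi>. \<phi> \<circ> transpose_word) ` \<Phi>" by blast
qed

lemma harmonic_right_vanish:
  assumes K: "reduced_index w K" and v: "v \<in> harmonic w"
    and zero: "\<And>\<phi>. \<phi> \<in> \<Phi> \<Longrightarrow> (\<Sum>J\<in>index_lists (length w). v J * \<phi> (letter_word K J w)) = 0"
  shows "v = (\<lambda>_. 0)"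
proof (rule generating_functionals.harmonic_left_vanish[OF generating_functionals_transpose K v])
  fix \<phi> assume "\<phi> \<in> (\<lambda>\<phi>. \<phi> \<circ> transpose_word) ` \<Phi>"
  then obtain \<phi>' where "\<phi> = \<phi>' \<circ> transpose_word" "\<phi>' \<in> \<Phi>" by blast
  then show "(\<Sum>I\<in>index_lists (length w). v I * \<phi> (letter_word I K w)) = 0"
    using zero[of \<phi>'] K by (simp add: transpose_letter_word reduced_index_def)
qed

text \<open>The weight projection in the middle cuts out the words of signature \<open>w\<close> and of
  maximal length, since shorter words have shorter weights.\<close>

lemma convolution_weight_sandwich:
  fixes K :: "'n list"
  assumes K: "reduced_index w K" and x: "length x \<le> length w"
  shows "convolution \<phi> (convolution (torus_coeff (zip K w)) \<psi>) x =
    (if sign_word x = w then \<phi> (letter_word (row_word x) K w) * \<psi> (letter_word K (col_word x) w) else 0)"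
proof -
  have lK: "length K = length w" using K by (simp add: reduced_index_def)
  let ?t = "\<lambda>L. \<phi> (letter_word (row_word x) L (sign_word x)) * \<psi> (letter_word L (col_word x) (sign_word x))"
  have "convolution \<phi> (convolution (torus_coeff (zip K w)) \<psi>) x =
    (\<Sum>L\<in>index_lists (length x). if weight (sign_word x) L = zip K w then ?t L else 0)"
    unfolding convolution_def[of \<phi>] by (intro sum.cong refl) (simp add: convolution_torus_left)
  also have "\<dots> = (\<Sum>L\<in>index_lists (length x). if L = K then (if sign_word x = w then ?t K else 0) else 0)"
  proof (intro sum.cong refl)
    fix L :: "'n list" assume L: "L \<in> index_lists (length x)"
    show "(if weight (sign_word x) L = zip K w then ?t L else 0) =
      (if L = K then (if sign_word x = w then ?t K else 0) else 0)"
      using weight_eq_long[of "sign_word x" L K w] weight_reduced_index[OF K] L x lK by auto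
  qed
  also have "\<dots> = (if sign_word x = w then \<phi> (letter_word (row_word x) K w) * \<psi> (letter_word K (col_word x) w) else 0)"
    using lK by auto
  finally show ?thesis .
qed
end

section \<open>Reduction to harmonic coefficients\<close>

text \<open>Induction on B: the remainder of v is corrected by its projection to the remainder of
  the new vector. The inner product sees only indices in S, while the decomposition holds at every
  index.\<close>

lemma finite_gram_schmidt:
  fixes B :: "('i \<Rightarrow> complex) set" and v :: "'i \<Rightarrow> complex"
  assumes "finite B" "finite S"
  shows "\<exists>c r. v = (\<lambda>i. (\<Sum>b\<in>B. c b * b i) + r i) \<and> (\<forall>b\<in>B. (\<Sum>i\<in>S. r i * cnj (b i)) = 0)"
  using assms(1)
proof (induction B arbitrary: v rule: finite_induct)
  case empty
  show ?case by (intro exI[of _ "\<lambda>_. 0"] exI[of _ v]) simp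
next
  case (insert b B)
  obtain cb rb where b: "b = (\<lambda>i. (\<Sum>b\<in>B. cb b * b i) + rb i)"
    and rb: "\<forall>b\<in>B. (\<Sum>i\<in>S. rb i * cnj (b i)) = 0" using insert.IH[of b] by blast
  obtain cv rv where v: "v = (\<lambda>i. (\<Sum>b\<in>B. cv b * b i) + rv i)"
    and rv: "\<forall>b\<in>B. (\<Sum>i\<in>S. rv i * cnj (b i)) = 0" using insert.IH[of v] by blast
  \<comment> \<open>If rb vanishes on S, the denominator is 0 and so is every inner product with rb,
    so the default value of the quotient does no harm.\<close>
  define \<alpha> where "\<alpha> = (\<Sum>i\<in>S. rv i * cnj (rb i)) / (\<Sum>i\<in>S. rb i * cnj (rb i))"
  define r where "r i = rv i - \<alpha> * rb i" for i
  have rB: "(\<Sum>i\<in>S. r i * cnj (b' i)) = 0" if "b' \<in> B" for b'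
    using rb rv that by (simp add: r_def left_diff_distrib sum_subtractf mult.assoc sum_distrib_left[symmetric])
  have rrb: "(\<Sum>i\<in>S. r i * cnj (rb i)) = 0"
  proof -
    have "(\<Sum>i\<in>S. r i * cnj (rb i)) =
        (\<Sum>i\<in>S. rv i * cnj (rb i)) - \<alpha> * (\<Sum>i\<in>S. rb i * cnj (rb i))"
      by (simp add: r_def left_diff_distrib sum_subtractf mult.assoc sum_distrib_left)
    also have "\<dots> = 0"
    proof (cases "(\<Sum>i\<in>S. rb i * cnj (rb i)) = 0")
      case True
      then have "complex_of_real (\<Sum>i\<in>S. (cmod (rb i))\<^sup>2) = 0"
        by (simp only: of_real_sum complex_norm_square)
      then have "\<forall>i\<in>S. rb i = 0"
        using assms(2) unfolding of_real_eq_0_iff by (subst (asm) sum_nonneg_eq_0_iff) auto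
      then show ?thesis using True by simp
    next
      case False
      then show ?thesis by (simp add: \<alpha>_def)
    qed
    finally show ?thesis .
  qed
  have "(\<Sum>i\<in>S. r i * cnj (b i)) = 0"
  proof -
    have "(\<Sum>i\<in>S. r i * cnj (b i)) =
        (\<Sum>i\<in>S. \<Sum>b'\<in>B. cnj (cb b') * (r i * cnj (b' i))) + (\<Sum>i\<in>S. r i * cnj (rb i))"
      by (subst b) (simp add: distrib_left sum.distrib sum_distrib_left mult_ac)
    also have "(\<Sum>i\<in>S. \<Sum>b'\<in>B. cnj (cb b') * (r i * cnj (b' i))) = 0"
      by (subst sum.swap) (simp add: sum_distrib_left[symmetric] rB)
    finally show ?thesis using rrb by simp
  qed
  moreover have "v = (\<lambda>i. (\<Sum>b'\<in>insert b B. (if b' = b then \<alpha> else cv b' - \<alpha> * cb b') * b' i) + r i)"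
  proof
    fix i
    have "(\<Sum>b'\<in>B. (if b' = b then \<alpha> else cv b' - \<alpha> * cb b') * b' i) =
        (\<Sum>b'\<in>B. cv b' * b' i) - \<alpha> * (\<Sum>b'\<in>B. cb b' * b' i)"
    proof -
      have "(\<Sum>b'\<in>B. (if b' = b then \<alpha> else cv b' - \<alpha> * cb b') * b' i) =
          (\<Sum>b'\<in>B. cv b' * b' i - \<alpha> * (cb b' * b' i))"
        using insert.hyps(2) by (intro sum.cong) (auto simp: algebra_simps)
      then show ?thesis by (simp add: sum_subtractf sum_distrib_left)
    qed
    moreover have "b i = (\<Sum>b'\<in>B. cb b' * b' i) + rb i" by (subst b) simp
    moreover have "v i = (\<Sum>b'\<in>B. cv b' * b' i) + rv i" by (subst v) simp
    ultimately show "v i = (\<Sum>b'\<in>insert b B. (if b' = b then \<alpha> else cv b' - \<alpha> * cb b') * b' i) + r i"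
      using insert.hyps by (simp add: r_def algebra_simps)
  qed
  ultimately show ?case
    using rB by (intro exI[of _ "\<lambda>b'. if b' = b then \<alpha> else cv b' - \<alpha> * cb b'"] exI[of _ r]) auto
qed

section \<open>Cups and their orthogonal complement\<close>

definition cup :: "'n list \<Rightarrow> 'n list \<Rightarrow> 'n list \<Rightarrow> complex" where
  "cup I1 I2 I = (if \<exists>c. I = I1 @ c # c # I2 then 1 else 0)"

definition cups :: "bool list \<Rightarrow> ('n list \<Rightarrow> complex) set" where
  "cups w = {cup I1 I2 | I1 I2. \<exists>w1 s w2. w = w1 @ s # (\<not> s) # w2 \<and>
     length I1 = length w1 \<and> length I2 = length w2}"

lemma finite_cups: "finite (cups w :: ('n::finite list \<Rightarrow> complex) set)"
proof (rule finite_subset)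
  show "(cups w :: ('n list \<Rightarrow> complex) set) \<subseteq> (\<lambda>(I1, I2). cup I1 I2) `
      ((\<Union>k\<le>length w. index_lists k) \<times> (\<Union>k\<le>length w. index_lists k))"
  proof
    fix b assume "b \<in> (cups w :: ('n list \<Rightarrow> complex) set)"
    then obtain I1 I2 w1 s w2 where "b = cup I1 I2" "w = w1 @ s # (\<not> s) # w2"
      "length I1 = length w1" "length I2 = length w2" unfolding cups_def by blast
    then show "b \<in> (\<lambda>(I1, I2). cup I1 I2) `
      ((\<Union>k\<le>length w. index_lists k) \<times> (\<Union>k\<le>length w. index_lists k))"
      by (intro image_eqI[of _ _ "(I1, I2)"]) auto
  qed
qed auto

lemma sum_cup:
  fixes f :: "'n::finite list \<Rightarrow> 'c::comm_monoid_add"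
  assumes "length I1 + length I2 + 2 = n"
  shows "(\<Sum>I\<in>index_lists n. if \<exists>c. I = I1 @ c # c # I2 then f I else 0) =
    (\<Sum>c\<in>UNIV. f (I1 @ c # c # I2))"
proof -
  have "(\<Sum>I\<in>index_lists n. if \<exists>c. I = I1 @ c # c # I2 then f I else 0) =
      (\<Sum>I\<in>range (\<lambda>c. I1 @ c # c # I2). f I)"
    using assms by (intro sum.mono_neutral_cong_right) auto
  also have "\<dots> = (\<Sum>c\<in>UNIV. f (I1 @ c # c # I2))"
    by (subst sum.reindex) (auto simp: inj_on_def)
  finally show ?thesis .
qed

text \<open>A cup has real entries and pairing with it is a contraction, so the remainder orthogonal
  to all cups is harmonic. At lists of the wrong length the cups and the basis tensor vanish, hence
  the remainder too.\<close>

lemma harmonic_part_exists: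
  fixes I :: "'n::finite list"
  assumes "length I = length w"
  shows "\<exists>r\<in>harmonic w. \<exists>c. (\<lambda>J. if J = I then 1 else 0) = (\<lambda>J. (\<Sum>b\<in>cups w. c b * b J) + r J)"
proof -
  obtain c r where e: "(\<lambda>J. if J = I then 1 else 0) = (\<lambda>J. (\<Sum>b\<in>cups w. c b * b J) + r J)"
    and r: "\<forall>b\<in>cups w. (\<Sum>J\<in>index_lists (length w). r J * cnj (b J)) = 0"
    using finite_gram_schmidt[OF finite_cups[of w] finite_index_lists,
        where v = "\<lambda>J. if J = I then 1 else 0"] by blast
  have "r \<in> harmonic w"
    unfolding harmonic_def
  proof (intro CollectI conjI allI impI)
    fix J :: "'n list" assume J: "length J \<noteq> length w"
    then have "b J = 0" if "b \<in> cups w" for b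
      using that by (auto simp: cups_def cup_def)
    moreover have "(if J = I then 1 else 0) = (\<Sum>b\<in>cups w. c b * b J) + r J"
      using fun_cong[OF e, of J] .
    moreover have "(\<Sum>b\<in>cups w. c b * b J) = 0"
      using calculation(1) by (intro sum.neutral) auto
    moreover have "J \<noteq> I" using J assms by auto
    ultimately show "r J = 0" by simp
  next
    fix w1 s w2 and I1 I2 :: "'n list"
    assume *: "w = w1 @ s # (\<not> s) # w2" "length I1 = length w1" "length I2 = length w2"
    then have "cup I1 I2 \<in> cups w" unfolding cups_def by blast
    then have "0 = (\<Sum>J\<in>index_lists (length w). r J * cnj (cup I1 I2 J))" using r by simp
    also have "\<dots> = (\<Sum>J\<in>index_lists (length w). if \<exists>c. J = I1 @ c # c # I2 then r J else 0)"
      by (intro sum.cong) (auto simp: cup_def)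
    also have "\<dots> = (\<Sum>c\<in>UNIV. r (I1 @ c # c # I2))"
      using * by (intro sum_cup) simp
    finally show "(\<Sum>c\<in>UNIV. r (I1 @ c # c # I2)) = 0" by simp
  qed
  then show ?thesis using e by blast
qed

lemma letter_word_eq_iff:
  assumes "length I = length w" "length J = length w"
  shows "letter_word I J w = x \<longleftrightarrow> I = row_word x \<and> J = col_word x \<and> w = sign_word x"
  using parts_letter_word[OF assms] by auto

section \<open>Lowering the degree modulo the unitarity relations\<close>

definition coefficient_element ::
  "('n::finite list \<Rightarrow> complex) \<Rightarrow> ('n list \<Rightarrow> complex) \<Rightarrow> bool list \<Rightarrow> 'n star_poly" where
  "coefficient_element a b w = (\<Sum>I\<in>index_lists (length w). \<Sum>J\<in>index_lists (length w).
     single (letter_word I J w) (a I * b J))"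

lemma lookup_coefficient_element:
  "lookup (coefficient_element a b w) x =
     (if sign_word x = w then a (row_word x) * b (col_word x) else 0)"
proof -
  have "lookup (coefficient_element a b w) x =
     (\<Sum>I\<in>index_lists (length w). \<Sum>J\<in>index_lists (length w).
        if J = col_word x then (if I = row_word x \<and> sign_word x = w then a I * b (col_word x) else 0) else 0)"
    unfolding coefficient_element_def lookup_sum lookup_single
    by (intro sum.cong refl) (auto simp: when_def letter_word_eq_iff)
  also have "\<dots> = (\<Sum>I\<in>index_lists (length w).
      if I = row_word x then (if sign_word x = w then a (row_word x) * b (col_word x) else 0) else 0)"
    by (intro sum.cong refl) (auto simp flip: length_letter_parts(3))
  also have "\<dots> = (if sign_word x = w then a (row_word x) * b (col_word x) else 0)"
    by (auto simp flip: length_letter_parts(3))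
  finally show ?thesis .
qed

lemma pairing_coefficient_element:
  "pairing \<phi> (coefficient_element a b w) =
    (\<Sum>I\<in>index_lists (length w). \<Sum>J\<in>index_lists (length w). a I * b J * \<phi> (letter_word I J w))"
  by (simp add: coefficient_element_def pairing_sum)

lemma split_two_letters:
  assumes "length L = m + k + 2"
  obtains L1 j1 j2 L2 where "L = L1 @ j1 # j2 # L2" "length L1 = m" "length L2 = k"
proof
  show "L = take m L @ L ! m # L ! Suc m # drop (Suc (Suc m)) L"
    using id_take_nth_drop[of m L] Cons_nth_drop_Suc[of "Suc m" L] assms by simp
qed (use assms in auto)

lemma scale_diff: "scale c (f - g) = scale c f - scale c g"
  by (rule poly_mapping_eqI) (simp add: lookup_scale lookup_minus right_diff_distrib)

text \<open>J stands for the defining ideal. With s ranging over both signs, the row and column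
  relations are the four unitarity conditions, already multiplied by words on both sides.\<close>

locale unitary_relations = generating_functionals \<Phi>
  for \<Phi> :: "('n::finite letter list \<Rightarrow> complex) set" +
  fixes J :: "'n star_poly set"
  assumes J_zero: "0 \<in> J"
    and J_add: "f \<in> J \<Longrightarrow> g \<in> J \<Longrightarrow> f + g \<in> J"
    and J_scale: "f \<in> J \<Longrightarrow> scale c f \<in> J"
    and row_relation: "(\<Sum>c\<in>UNIV. single (x @ ((i, c), s) # ((j, c), \<not> s) # y) 1) -
       (if i = j then single (x @ y) 1 else 0) \<in> J"
    and col_relation: "(\<Sum>c\<in>UNIV. single (x @ ((c, i), s) # ((c, j), \<not> s) # y) 1) -
       (if i = j then single (x @ y) 1 else 0) \<in> J"
    and pairing_J: "\<phi> \<in> \<Phi> \<Longrightarrow> f \<in> J \<Longrightarrow> pairing \<phi> f = 0"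
begin

text \<open>The filtration of the quotient by word length, pulled back to the free algebra.\<close>

definition lower :: "nat \<Rightarrow> 'n star_poly set" where
  "lower n = {g. \<exists>f\<in>J. \<forall>x\<in>keys (g - f). length x < n}"

lemma lower_zero: "0 \<in> lower n"
  unfolding lower_def using J_zero by force

lemma lower_add: "f \<in> lower n \<Longrightarrow> g \<in> lower n \<Longrightarrow> f + g \<in> lower n"
proof -
  assume "f \<in> lower n" "g \<in> lower n"
  then obtain f' g' where *: "f' \<in> J" "g' \<in> J" "\<forall>x\<in>keys (f - f'). length x < n"
    "\<forall>x\<in>keys (g - g'). length x < n" unfolding lower_def by blast
  have "keys (f + g - (f' + g')) \<subseteq> keys (f - f') \<union> keys (g - g')"
    using keys_add[of "f - f'" "g - g'"] by (simp add: algebra_simps)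
  then show "f + g \<in> lower n"
    unfolding lower_def using * J_add by blast
qed

lemma lower_scale: "f \<in> lower n \<Longrightarrow> scale c f \<in> lower n"
proof -
  assume "f \<in> lower n"
  then obtain f' where *: "f' \<in> J" "\<forall>x\<in>keys (f - f'). length x < n"
    unfolding lower_def by blast
  then show ?thesis
    unfolding lower_def using J_scale[of f' c] keys_scale[of c "f - f'"]
    by (auto simp: scale_diff)
qed

lemma lower_sum: "(\<And>i. i \<in> S \<Longrightarrow> f i \<in> lower n) \<Longrightarrow> (\<Sum>i\<in>S. f i) \<in> lower n"
  by (induction S rule: infinite_finite_induct) (auto intro: lower_zero lower_add)

lemma lower_single: "length x < n \<Longrightarrow> single x c \<in> lower n"
  unfolding lower_def using J_zero by (force split: if_splits)

lemma lower_relation: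
  assumes "g - (if P then single x 1 else 0) \<in> J" "length x < n"
  shows "g \<in> lower n"
  unfolding lower_def using assms by (intro CollectI bexI[OF _ assms(1)]) auto

text \<open>Here g is \<open>letter_word\<close> or the same with its index arguments exchanged, so
  one computation serves cups in the rows and cups in the columns.\<close>

lemma cup_sum_lower:
  fixes g :: "'n list \<Rightarrow> 'n list \<Rightarrow> 'n letter list"
  assumes "length I1 + length I2 + 2 = n"
    and low: "\<And>L. length L = n \<Longrightarrow> (\<Sum>c\<in>UNIV. single (g (I1 @ c # c # I2) L) 1) \<in> lower n"
  shows "(\<Sum>L\<in>index_lists n. \<Sum>I\<in>index_lists n. single (g I L) (cup I1 I2 I * b L)) \<in> lower n"
proof (rule lower_sum)
  fix L :: "'n list" assume L: "L \<in> index_lists n"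
  have "(\<Sum>I\<in>index_lists n. single (g I L) (cup I1 I2 I * b L)) =
      (\<Sum>I\<in>index_lists n. if \<exists>c. I = I1 @ c # c # I2 then single (g I L) (b L) else 0)"
    by (intro sum.cong refl) (simp add: cup_def)
  also have "\<dots> = (\<Sum>c\<in>UNIV. single (g (I1 @ c # c # I2) L) (b L))"
    by (rule sum_cup[OF assms(1)])
  also have "\<dots> = scale (b L) (\<Sum>c\<in>UNIV. single (g (I1 @ c # c # I2) L) 1)"
    by (rule poly_mapping_eqI)
       (auto simp: lookup_sum lookup_scale lookup_single when_def sum_distrib_left intro!: sum.cong)
  also have "\<dots> \<in> lower n" using low L by (intro lower_scale) simp
  finally show "(\<Sum>I\<in>index_lists n. single (g I L) (cup I1 I2 I * b L)) \<in> lower n" .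
qed

text \<open>A cup sums two neighbouring letters of opposite sign over a common row or column index.
  Unitarity replaces the pair by a scalar, which costs two letters.\<close>

lemma coefficient_element_cup:
  assumes "a \<in> cups w"
  shows "coefficient_element a b w \<in> lower (length w)" "coefficient_element b a w \<in> lower (length w)"
proof -
  obtain I1 I2 w1 s w2 where a: "a = cup I1 I2" and w: "w = w1 @ s # (\<not> s) # w2"
    and l: "length I1 = length w1" "length I2 = length w2"
    using assms unfolding cups_def by blast
  have n: "length I1 + length I2 + 2 = length w" using w l by simp
  have low: "(\<Sum>c\<in>UNIV. single (letter_word (I1 @ c # c # I2) L w) 1) \<in> lower (length w)"
      "(\<Sum>c\<in>UNIV. single (letter_word L (I1 @ c # c # I2) w) 1) \<in> lower (length w)"
    if "length L = length w" for L
  proof -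
    have "length L = length w1 + length w2 + 2" using that w by simp
    then obtain L1 j1 j2 L2 where L: "L = L1 @ j1 # j2 # L2" "length L1 = length w1" "length L2 = length w2"
      by (rule split_two_letters)
    have "letter_word (I1 @ c # c # I2) L w =
        letter_word I1 L1 w1 @ ((c, j1), s) # ((c, j2), \<not> s) # letter_word I2 L2 w2"
      "letter_word L (I1 @ c # c # I2) w =
        letter_word L1 I1 w1 @ ((j1, c), s) # ((j2, c), \<not> s) # letter_word L2 I2 w2" for c
      using L l w by (simp_all add: letter_word_def zip_append)
    then show "(\<Sum>c\<in>UNIV. single (letter_word (I1 @ c # c # I2) L w) 1) \<in> lower (length w)"
      "(\<Sum>c\<in>UNIV. single (letter_word L (I1 @ c # c # I2) w) 1) \<in> lower (length w)"
      using lower_relation[OF col_relation, of "letter_word I1 L1 w1" "letter_word I2 L2 w2" "length w" j1 s j2]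
        lower_relation[OF row_relation, of "letter_word L1 I1 w1" "letter_word L2 I2 w2" "length w" j1 s j2] w L l
      by (simp_all add: parts_letter_word)
  qed
  show "coefficient_element a b w \<in> lower (length w)"
    unfolding coefficient_element_def a
    by (subst sum.swap, rule cup_sum_lower[OF n]) (rule low)
  show "coefficient_element b a w \<in> lower (length w)"
    unfolding coefficient_element_def a
    by (subst mult.commute, rule cup_sum_lower[OF n]) (rule low)
qed

lemma coefficient_element_sum_left:
  "coefficient_element (\<lambda>I. (\<Sum>e\<in>S. c e * e I) + r I) b w =
    (\<Sum>e\<in>S. scale (c e) (coefficient_element e b w)) + coefficient_element r b w"
  by (rule poly_mapping_eqI)
     (auto simp: lookup_coefficient_element lookup_add lookup_sum lookup_scale
        distrib_right sum_distrib_right mult.assoc)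

lemma coefficient_element_sum_right:
  "coefficient_element a (\<lambda>I. (\<Sum>e\<in>S. c e * e I) + r I) w =
    (\<Sum>e\<in>S. scale (c e) (coefficient_element a e w)) + coefficient_element a r w"
  by (rule poly_mapping_eqI)
     (auto simp: lookup_coefficient_element lookup_add lookup_sum lookup_scale
        distrib_left sum_distrib_left mult_ac)

lemma single_eq_coefficient_element:
  "single x 1 = coefficient_element (\<lambda>I. if I = row_word x then 1 else 0)
      (\<lambda>I. if I = col_word x then 1 else 0) (sign_word x)"
proof (rule poly_mapping_eqI)
  fix y
  have "x = y" if "sign_word y = sign_word x" "row_word y = row_word x" "col_word y = col_word x"
    using that letter_word_parts by metis
  then show "lookup (single x 1) y =
    lookup (coefficient_element (\<lambda>I. if I = row_word x then 1 else 0)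
      (\<lambda>I. if I = col_word x then 1 else 0) (sign_word x)) y"
    by (auto simp: lookup_coefficient_element lookup_single when_def)
qed

text \<open>The row vector is split into cups and a harmonic part first; then the column vector is
  split next to the harmonic row part. Every term with a cup drops in degree.\<close>

lemma single_congruent_harmonic:
  "\<exists>a\<in>harmonic (sign_word x). \<exists>b\<in>harmonic (sign_word x).
     single x 1 - coefficient_element a b (sign_word x) \<in> lower (length x)"
proof -
  let ?w = "sign_word x"
  let ?ea = "\<lambda>I. if I = row_word x then 1 else 0" and ?eb = "\<lambda>I. if I = col_word x then 1 else 0"
  obtain a ca where a: "a \<in> harmonic ?w" and ea: "?ea = (\<lambda>J. (\<Sum>e\<in>cups ?w. ca e * e J) + a J)"
    using harmonic_part_exists[of "row_word x" ?w] by auto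
  obtain b cb where b: "b \<in> harmonic ?w" and eb: "?eb = (\<lambda>J. (\<Sum>e\<in>cups ?w. cb e * e J) + b J)"
    using harmonic_part_exists[of "col_word x" ?w] by auto
  have "single x 1 - coefficient_element a b ?w =
      (\<Sum>e\<in>cups ?w. scale (ca e) (coefficient_element e ?eb ?w)) +
      (\<Sum>e\<in>cups ?w. scale (cb e) (coefficient_element a e ?w))"
    unfolding single_eq_coefficient_element
    by (subst ea, subst coefficient_element_sum_left, subst (2) eb, subst coefficient_element_sum_right) simp
  also have "\<dots> \<in> lower (length ?w)"
    by (intro lower_add; rule lower_sum; rule lower_scale;
        erule coefficient_element_cup)
  finally show ?thesis using a b by auto
qed

theorem annihilated_in_J:
  assumes "\<And>\<phi>. \<phi> \<in> \<Phi> \<Longrightarrow> pairing \<phi> f = 0"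
  shows "f \<in> J"
proof -
  have "(\<forall>x\<in>keys f. length x < n) \<Longrightarrow> (\<And>\<phi>. \<phi> \<in> \<Phi> \<Longrightarrow> pairing \<phi> f = 0) \<Longrightarrow> f \<in> J" for n
  proof (induction n arbitrary: f)
    case 0
    then have "keys f = {}" by auto
    then have "f = 0" by simp
    then show ?case using J_zero by simp
  next
    case (Suc n)
    have "\<exists>a b. a \<in> harmonic (sign_word x) \<and> b \<in> harmonic (sign_word x) \<and>
       single x 1 - coefficient_element a b (sign_word x) \<in> lower (length x)" for x
      using single_congruent_harmonic by blast
    then obtain a b where ha: "\<And>x. a x \<in> harmonic (sign_word x)" and hb: "\<And>x. b x \<in> harmonic (sign_word x)"
      and ab: "\<And>x. single x 1 - coefficient_element (a x) (b x) (sign_word x) \<in> lower (length x)"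
      by metis
    let ?h = "\<lambda>x. coefficient_element (a x) (b x) (sign_word x)"
    let ?T = "{x \<in> keys f. length x = n}"
    define t where "t = (\<Sum>x\<in>?T. scale (lookup f x)
        (?h x))"
    have "f - t \<in> lower n"
    proof -
      have "f = (\<Sum>x\<in>keys f. single x (lookup f x))"
        by (rule poly_mapping_eq_sum_single)
      also have "\<dots> = (\<Sum>x\<in>?T. single x (lookup f x)) +
          (\<Sum>x\<in>keys f - ?T. single x (lookup f x))"
        by (subst add.commute, rule sum.subset_diff) auto
      finally have "f - t = (\<Sum>x\<in>?T. single x (lookup f x) -
          scale (lookup f x) (?h x)) +
          (\<Sum>x\<in>keys f - ?T. single x (lookup f x))"
        unfolding t_def by (simp add: sum_subtractf)
      moreover have "\<dots> \<in> lower n"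
      proof (rule lower_add; rule lower_sum)
        fix x assume x: "x \<in> ?T"
        have "single x (lookup f x) -
          scale (lookup f x) (?h x) =
          scale (lookup f x)
            (single x 1 - ?h x)"
          by (simp add: scale_diff)
        then show "single x (lookup f x) -
          scale (lookup f x) (?h x) \<in> lower n"
          using lower_scale[OF ab[of x]] x by simp
      next
        fix x assume "x \<in> keys f - ?T"
        then have "length x < n" using Suc.prems(1) by (auto simp: less_Suc_eq)
        then show "single x (lookup f x) \<in> lower n"
          by (rule lower_single)
      qed
      ultimately show ?thesis by simp
    qed
    then obtain j where j: "j \<in> J" and short: "\<forall>x\<in>keys (f - t - j). length x < n"
      unfolding lower_def by blast
    \<comment> \<open>The coefficient matrix of t in signature w. Its rows and columns are harmonic
      although F need not have rank one.\<close>
    define F where "F w I L = (\<Sum>x\<in>{x \<in> ?T. sign_word x = w}. lookup f x * a x I * b x L)" for w I L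
    have F_left: "(\<lambda>I. F w I L) \<in> harmonic w" for w L
    proof -
      have "(\<lambda>I. \<Sum>x\<in>{x \<in> ?T. sign_word x = w}. (lookup f x * b x L) * a x I) \<in> harmonic w"
        using ha by (intro harmonic_sum) auto
      then show ?thesis by (simp add: F_def mult_ac)
    qed
    have F_right: "(\<lambda>L. F w I L) \<in> harmonic w" for w I
      unfolding F_def using hb by (intro harmonic_sum) auto
    have t_lookup: "lookup t x = F (sign_word x) (row_word x) (col_word x)" for x
      unfolding t_def F_def lookup_sum lookup_scale lookup_coefficient_element
      by (intro sum.mono_neutral_cong_right) (auto simp: mult.assoc)
    have F_zero: "F w I L = 0" if w: "length w = n" for w I L
    proof -
      obtain K :: "'n list" where K: "reduced_index w K"
        using exists_reduced_index[OF card_ge_2] by blast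
      then have lK: "length K = length w" by (simp add: reduced_index_def)
      \<comment> \<open>The functional \<theta> kills words shorter than w and lies in \<Phi>, so it
        kills f, j and f - t - j. What remains is its value on t, where only the signature w is
        seen.\<close>
      have key: "(\<Sum>I\<in>index_lists (length w). \<Sum>L\<in>index_lists (length w).
           F w I L * (\<phi> (letter_word I K w) * \<psi> (letter_word K L w))) = 0"
        if \<phi>: "\<phi> \<in> \<Phi>" and \<psi>: "\<psi> \<in> \<Phi>" for \<phi> \<psi>
      proof -
        let ?k = "\<lambda>I L. \<phi> (letter_word I K w) * \<psi> (letter_word K L w)"
        let ?\<theta> = "convolution \<phi> (convolution (torus_coeff (zip K w)) \<psi>)"
        have \<theta>: "?\<theta> \<in> \<Phi>"
          using K lK \<phi> \<psi> by (intro convolution_closed torus_coeff_mem) (simp_all add: reduced_index_zip)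
        have "pairing ?\<theta> (f - t - j) = 0"
          unfolding pairing_def
        proof (intro sum.neutral ballI)
          fix x assume "x \<in> keys (f - t - j)"
          then have "length x < length w" using short w by auto
          then show "lookup (f - t - j) x * ?\<theta> x = 0"
            using convolution_weight_sandwich[OF K, of x \<phi> \<psi>] by (auto simp flip: length_letter_parts(3))
        qed
        then have "0 = pairing ?\<theta> t"
          using Suc.prems(2)[OF \<theta>] pairing_J[OF \<theta> j] by (simp add: pairing_diff)
        also have "\<dots> = (\<Sum>x\<in>?T. lookup f x * (\<Sum>I\<in>index_lists n. \<Sum>L\<in>index_lists n.
            a x I * b x L * ?\<theta> (letter_word I L (sign_word x))))"
          unfolding t_def pairing_sum pairing_scale pairing_coefficient_element
          by (intro sum.cong refl) auto
        also have "\<dots> = (\<Sum>x\<in>?T. if sign_word x = w then lookup f x * (\<Sum>I\<in>index_lists n. \<Sum>L\<in>index_lists n.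
            a x I * b x L * ?k I L) else 0)"
        proof (intro sum.cong refl)
          fix x assume x: "x \<in> ?T"
          have "?\<theta> (letter_word I L (sign_word x)) =
            (if sign_word x = w then ?k I L else 0)"
            if "length I = n" "length L = n" for I L
            using convolution_weight_sandwich[OF K, of "letter_word I L (sign_word x)" \<phi> \<psi>] x w that
            by (simp add: parts_letter_word)
          then show "lookup f x * (\<Sum>I\<in>index_lists n. \<Sum>L\<in>index_lists n.
            a x I * b x L * ?\<theta> (letter_word I L (sign_word x))) =
            (if sign_word x = w then lookup f x * (\<Sum>I\<in>index_lists n. \<Sum>L\<in>index_lists n.
            a x I * b x L * ?k I L) else 0)"
            by simp
        qed
        also have "\<dots> = (\<Sum>x\<in>{x \<in> ?T. sign_word x = w}. \<Sum>I\<in>index_lists n. \<Sum>L\<in>index_lists n.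
            lookup f x * a x I * b x L * ?k I L)"
          by (subst sum.inter_filter[symmetric]) (auto simp: sum_distrib_left mult_ac)
        also have "\<dots> = (\<Sum>I\<in>index_lists n. \<Sum>L\<in>index_lists n. \<Sum>x\<in>{x \<in> ?T. sign_word x = w}.
            lookup f x * a x I * b x L * ?k I L)"
          by (subst sum.swap, rule sum.cong[OF refl], rule sum.swap)
        finally show ?thesis
          using w by (simp add: F_def sum_distrib_right)
      qed
      \<comment> \<open>Irreducibility is applied twice: for fixed \<psi> to the row index, using
        all \<phi>, and then for a fixed row to the column index, using all \<psi>.\<close>
      have left: "(\<lambda>I. \<Sum>L\<in>index_lists (length w). \<psi> (letter_word K L w) * F w I L) = (\<lambda>_. 0)"
        if \<psi>: "\<psi> \<in> \<Phi>" for \<psi>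
      proof (rule harmonic_left_vanish[OF K])
        show "(\<lambda>I. \<Sum>L\<in>index_lists (length w). \<psi> (letter_word K L w) * F w I L) \<in> harmonic w"
          by (rule harmonic_sum) (rule F_left)
        show "(\<Sum>I\<in>index_lists (length w). (\<Sum>L\<in>index_lists (length w).
            \<psi> (letter_word K L w) * F w I L) * \<phi> (letter_word I K w)) = 0" if "\<phi> \<in> \<Phi>" for \<phi>
          using key[OF that \<psi>] by (simp add: sum_distrib_right sum_distrib_left mult_ac)
      qed
      have "(\<lambda>L. F w I L) = (\<lambda>_. 0)"
      proof (rule harmonic_right_vanish[OF K F_right])
        fix \<psi> assume "\<psi> \<in> \<Phi>"
        from fun_cong[OF left[OF this], of I]
        show "(\<Sum>L\<in>index_lists (length w). F w I L * \<psi> (letter_word K L w)) = 0"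
          by (simp add: mult.commute)
      qed
      then show ?thesis by (rule fun_cong)
    qed
    have "t = 0"
    proof (rule poly_mapping_eqI)
      fix x
      show "lookup t x = lookup 0 x"
      proof (cases "length x = n")
        case True
        then show ?thesis by (simp add: t_lookup F_zero)
      next
        case False
        then have "{y \<in> ?T. sign_word y = sign_word x} = {}"
          by (auto simp flip: length_letter_parts(3))
        then show ?thesis unfolding t_lookup F_def by (simp only: sum.empty lookup_zero)
      qed
    qed
    then have "f - j \<in> J"
      using Suc.IH[of "f - j"] short Suc.prems(2) pairing_J j by (simp add: pairing_diff)
    then show ?case using J_add[OF _ j] by fastforce
  qed
  moreover have "\<forall>x\<in>keys f. length x < Suc (Max (length ` keys f))"
    by (auto simp: less_Suc_eq_le)
  ultimately show ?thesis using assms by blast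
qed
end

section \<open>Monoid *-algebras, quotients and tensor products\<close>

lemma scale_single: "scale c (single a d) = single a (c * d)"
  by (rule poly_mapping_eqI) (simp add: lookup_scale lookup_single when_def)

lemma scale_sum: "scale c (\<Sum>i\<in>S. f i) = (\<Sum>i\<in>S. scale c (f i))"
  by (rule poly_mapping_eqI) (simp add: lookup_scale lookup_sum sum_distrib_left)

lemma scale_add: "scale c (f + g) = scale c f + scale c g"
  by (rule poly_mapping_eqI) (simp add: lookup_scale lookup_add distrib_left)

section \<open>Product and involution on finitely supported functions\<close>

text \<open>Detached from the carrier of a monoid, the product and the involution satisfy their
  summation laws for all finitely supported functions.\<close>

definition conv_prod ::
  "('m \<Rightarrow> 'm \<Rightarrow> 'm) \<Rightarrow> ('m \<Rightarrow>\<^sub>0 complex) \<Rightarrow> ('m \<Rightarrow>\<^sub>0 complex) \<Rightarrow> ('m \<Rightarrow>\<^sub>0 complex)" where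
  "conv_prod m f g = (\<Sum>a\<in>keys f. \<Sum>b\<in>keys g.
     single (m a b) (lookup f a * lookup g b))"

definition conj_ext :: "('m \<Rightarrow> 'm) \<Rightarrow> ('m \<Rightarrow>\<^sub>0 complex) \<Rightarrow> ('m \<Rightarrow>\<^sub>0 complex)" where
  "conj_ext \<iota> f = (\<Sum>a\<in>keys f. single (\<iota> a) (cnj (lookup f a)))"

lemma star_monoid_alg_simps [simp]:
  "carrier (star_monoid_alg M \<iota>) = {f. keys f \<subseteq> carrier M}"
  "mult (star_monoid_alg M \<iota>) = conv_prod (mult M)"
  "one (star_monoid_alg M \<iota>) = single \<one>\<^bsub>M\<^esub> 1"
  "zero (star_monoid_alg M \<iota>) = 0"
  "add (star_monoid_alg M \<iota>) = (+)"
  "smult (star_monoid_alg M \<iota>) c = scale c"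
  "star (star_monoid_alg M \<iota>) = conj_ext \<iota>"
  by (simp_all add: star_monoid_alg_def conv_prod_def[abs_def] conj_ext_def[abs_def])

lemma conv_prod_add_left: "conv_prod m (f + g) h = conv_prod m f h + conv_prod m g h"
  unfolding conv_prod_def
  by (rule setsum_keys_plus_distrib) (simp_all add: distrib_right single_add sum.distrib)

lemma conv_prod_add_right: "conv_prod m h (f + g) = conv_prod m h f + conv_prod m h g"
  unfolding conv_prod_def sum.distrib[symmetric]
  by (rule sum.cong[OF refl], rule setsum_keys_plus_distrib) (simp_all add: distrib_left single_add)

lemma conv_prod_zero [simp]: "conv_prod m 0 h = 0" "conv_prod m h 0 = 0"
  by (simp_all add: conv_prod_def)

lemma conv_prod_sum_left: "conv_prod m (\<Sum>i\<in>S. f i) h = (\<Sum>i\<in>S. conv_prod m (f i) h)"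
  by (induction S rule: infinite_finite_induct) (simp_all add: conv_prod_add_left)

lemma conv_prod_sum_right: "conv_prod m h (\<Sum>i\<in>S. f i) = (\<Sum>i\<in>S. conv_prod m h (f i))"
  by (induction S rule: infinite_finite_induct) (simp_all add: conv_prod_add_right)

lemma conv_prod_single_left:
  "conv_prod m (single x c) h =
    (\<Sum>b\<in>keys h. single (m x b) (c * lookup h b))"
  by (cases "c = 0") (simp_all add: conv_prod_def)

lemma conv_prod_single_right:
  "conv_prod m h (single x c) =
    (\<Sum>b\<in>keys h. single (m b x) (lookup h b * c))"
  by (cases "c = 0") (simp_all add: conv_prod_def)

lemma conv_prod_single_single [simp]:
  "conv_prod m (single x c) (single y d) = single (m x y) (c * d)"
  by (cases "d = 0") (simp_all add: conv_prod_single_left)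

lemma conv_prod_scale:
  "conv_prod m (scale c f) g = scale c (conv_prod m f g)"
  "conv_prod m f (scale c g) = scale c (conv_prod m f g)"
proof -
  \<comment> \<open>The sum runs over the support of f even when c = 0, where
    \<open>scale c f\<close> has a smaller one.\<close>
  have f: "scale c f = (\<Sum>a\<in>keys f. single a (c * lookup f a))" for f :: "'b \<Rightarrow>\<^sub>0 complex"
    by (subst (1) poly_mapping_eq_sum_single[of f]) (simp add: scale_sum scale_single)
  show "conv_prod m (scale c f) g = scale c (conv_prod m f g)"
    unfolding f[of f] conv_prod_sum_left conv_prod_single_left
    by (simp add: conv_prod_def scale_sum scale_single mult.assoc)
  show "conv_prod m f (scale c g) = scale c (conv_prod m f g)"
    unfolding f[of g] conv_prod_sum_right conv_prod_single_right
    by (subst sum.swap) (simp add: conv_prod_def scale_sum scale_single mult_ac)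
qed

lemma conv_prod_keys:
  assumes "keys f \<subseteq> A" "keys g \<subseteq> A" "\<And>a b. a \<in> A \<Longrightarrow> b \<in> A \<Longrightarrow> m a b \<in> A"
  shows "keys (conv_prod m f g) \<subseteq> A"
  unfolding conv_prod_def using assms
  by (intro subset_trans[OF keys_sum] UN_least) auto

lemma conv_prod_assoc:
  assumes "keys f \<subseteq> A" "keys g \<subseteq> A" "keys h \<subseteq> A"
    and "\<And>a b c. a \<in> A \<Longrightarrow> b \<in> A \<Longrightarrow> c \<in> A \<Longrightarrow> m (m a b) c = m a (m b c)"
  shows "conv_prod m (conv_prod m f g) h = conv_prod m f (conv_prod m g h)"
proof -
  have "conv_prod m (conv_prod m f g) h =
    (\<Sum>a\<in>keys f. \<Sum>b\<in>keys g. \<Sum>c\<in>keys h.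
      single (m (m a b) c) (lookup f a * lookup g b * lookup h c))"
    by (simp add: conv_prod_def[of m f g] conv_prod_sum_left conv_prod_single_left)
  also have "\<dots> =
    (\<Sum>a\<in>keys f. \<Sum>b\<in>keys g. \<Sum>c\<in>keys h.
      single (m a (m b c)) (lookup f a * (lookup g b * lookup h c)))"
    using assms by (intro sum.cong refl) (auto simp: subset_iff mult.assoc)
  also have "\<dots> = (\<Sum>b\<in>keys g. \<Sum>c\<in>keys h. \<Sum>a\<in>keys f.
      single (m a (m b c)) (lookup f a * (lookup g b * lookup h c)))"
    by (subst sum.swap, rule sum.cong[OF refl], rule sum.swap)
  also have "\<dots> = conv_prod m f (conv_prod m g h)"
    by (simp add: conv_prod_def[of m g h] conv_prod_sum_right conv_prod_single_right)
  finally show ?thesis .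
qed

lemma conj_ext_add: "conj_ext \<iota> (f + g) = conj_ext \<iota> f + conj_ext \<iota> g"
  unfolding conj_ext_def by (rule setsum_keys_plus_distrib) (simp_all add: single_add)

lemma conj_ext_zero [simp]: "conj_ext \<iota> 0 = 0"
  by (simp add: conj_ext_def)

lemma conj_ext_single [simp]: "conj_ext \<iota> (single a c) = single (\<iota> a) (cnj c)"
  by (cases "c = 0") (simp_all add: conj_ext_def)

lemma conj_ext_sum: "conj_ext \<iota> (\<Sum>i\<in>S. f i) = (\<Sum>i\<in>S. conj_ext \<iota> (f i))"
  by (induction S rule: infinite_finite_induct) (simp_all add: conj_ext_add)

lemma conj_ext_uminus: "conj_ext \<iota> (- f) = - conj_ext \<iota> f"
  using conj_ext_add[of \<iota> f "- f"] by (simp add: add_eq_0_iff)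

lemma conj_ext_diff: "conj_ext \<iota> (f - g) = conj_ext \<iota> f - conj_ext \<iota> g"
  using conj_ext_add[of \<iota> f "- g"] by (simp add: conj_ext_uminus)

lemma conj_ext_scale: "conj_ext \<iota> (scale c f) = scale (cnj c) (conj_ext \<iota> f)"
proof -
  have "scale c f = (\<Sum>a\<in>keys f. single a (c * lookup f a))"
    by (subst (1) poly_mapping_eq_sum_single[of f]) (simp add: scale_sum scale_single)
  then show ?thesis
    by (simp add: conj_ext_sum conj_ext_def[of \<iota> f] scale_sum scale_single)
qed

lemma conj_ext_involutive:
  assumes "\<And>a. a \<in> keys f \<Longrightarrow> \<iota> (\<iota> a) = a"
  shows "conj_ext \<iota> (conj_ext \<iota> f) = f"
proof -
  have "conj_ext \<iota> (conj_ext \<iota> f) = (\<Sum>a\<in>keys f. single a (lookup f a))"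
    unfolding conj_ext_def[of \<iota> f] conj_ext_sum using assms by (intro sum.cong) auto
  then show ?thesis using poly_mapping_eq_sum_single[of f] by simp
qed

lemma conj_ext_conv_prod:
  assumes "\<And>a b. a \<in> keys f \<Longrightarrow> b \<in> keys g \<Longrightarrow> \<iota> (m a b) = m (\<iota> b) (\<iota> a)"
  shows "conj_ext \<iota> (conv_prod m f g) = conv_prod m (conj_ext \<iota> g) (conj_ext \<iota> f)"
proof -
  have "conj_ext \<iota> (conv_prod m f g) = (\<Sum>a\<in>keys f. \<Sum>b\<in>keys g.
      single (m (\<iota> b) (\<iota> a)) (cnj (lookup g b) * cnj (lookup f a)))"
    unfolding conv_prod_def conj_ext_sum using assms by (intro sum.cong refl) (simp add: mult.commute)
  also have "\<dots> = conv_prod m (conj_ext \<iota> g) (conj_ext \<iota> f)"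
    unfolding conj_ext_def[of \<iota> g] conj_ext_def[of \<iota> f] conv_prod_sum_left conv_prod_sum_right
    by simp
  finally show ?thesis .
qed

section \<open>The axioms of complex star-algebras\<close>

lemma complex_alg_simps [simp]:
  "carrier complex_alg = UNIV" "mult complex_alg = (*)" "one complex_alg = 1" "zero complex_alg = 0"
  "add complex_alg = (+)" "smult complex_alg = (*)" "star complex_alg = cnj"
  by (simp_all add: complex_alg_def)

lemma cring_complex_alg: "cring complex_alg"
proof (rule cringI)
  show "abelian_group complex_alg"
    by (rule abelian_groupI) (auto simp: algebra_simps intro: exI[of _ "- _"] add.left_inverse)
  show "comm_monoid complex_alg"
    by (rule comm_monoidI) (auto simp: algebra_simps)
qed (auto simp: algebra_simps)

lemma star_algebraI:
  fixes A :: "('a, 'm) star_alg_scheme" (structure)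
  assumes "ring A"
    and "\<And>c x. x \<in> carrier A \<Longrightarrow> c \<odot> x \<in> carrier A"
    and "\<And>c d x. x \<in> carrier A \<Longrightarrow> (c + d) \<odot> x = c \<odot> x \<oplus> d \<odot> x"
    and "\<And>c x y. x \<in> carrier A \<Longrightarrow> y \<in> carrier A \<Longrightarrow> c \<odot> (x \<oplus> y) = c \<odot> x \<oplus> c \<odot> y"
    and "\<And>c d x. x \<in> carrier A \<Longrightarrow> (c * d) \<odot> x = c \<odot> (d \<odot> x)"
    and "\<And>x. x \<in> carrier A \<Longrightarrow> 1 \<odot> x = x"
    and "\<And>c x y. x \<in> carrier A \<Longrightarrow> y \<in> carrier A \<Longrightarrow> (c \<odot> x) \<otimes> y = c \<odot> (x \<otimes> y)"
    and "\<And>c x y. x \<in> carrier A \<Longrightarrow> y \<in> carrier A \<Longrightarrow> x \<otimes> (c \<odot> y) = c \<odot> (x \<otimes> y)"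
    and "\<And>x. x \<in> carrier A \<Longrightarrow> star A x \<in> carrier A"
    and "\<And>x. x \<in> carrier A \<Longrightarrow> star A (star A x) = x"
    and "\<And>c x. x \<in> carrier A \<Longrightarrow> star A (c \<odot> x) = cnj c \<odot> star A x"
    and "\<And>x y. x \<in> carrier A \<Longrightarrow> y \<in> carrier A \<Longrightarrow> star A (x \<oplus> y) = star A x \<oplus> star A y"
    and "\<And>x y. x \<in> carrier A \<Longrightarrow> y \<in> carrier A \<Longrightarrow> star A (x \<otimes> y) = star A y \<otimes> star A x"
  shows "star_algebra A"
  unfolding star_algebra_def
  using assms
  by (intro conjI moduleI cring_complex_alg ring.is_abelian_group allI ballI) auto

lemma star_algebraD:
  fixes A :: "('a, 'm) star_alg_scheme" (structure)
  assumes "star_algebra A"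
  shows "ring A" "Module.module complex_alg A"
    and "x \<in> carrier A \<Longrightarrow> c \<odot> x \<in> carrier A"
    and "x \<in> carrier A \<Longrightarrow> (c + d) \<odot> x = c \<odot> x \<oplus> d \<odot> x"
    and "x \<in> carrier A \<Longrightarrow> y \<in> carrier A \<Longrightarrow> c \<odot> (x \<oplus> y) = c \<odot> x \<oplus> c \<odot> y"
    and "x \<in> carrier A \<Longrightarrow> (c * d) \<odot> x = c \<odot> (d \<odot> x)"
    and "x \<in> carrier A \<Longrightarrow> 1 \<odot> x = x"
    and "x \<in> carrier A \<Longrightarrow> 0 \<odot> x = \<zero>"
    and "x \<in> carrier A \<Longrightarrow> y \<in> carrier A \<Longrightarrow> (c \<odot> x) \<otimes> y = c \<odot> (x \<otimes> y)"
    and "x \<in> carrier A \<Longrightarrow> y \<in> carrier A \<Longrightarrow> x \<otimes> (c \<odot> y) = c \<odot> (x \<otimes> y)"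
    and "x \<in> carrier A \<Longrightarrow> star A x \<in> carrier A"
    and "x \<in> carrier A \<Longrightarrow> star A (star A x) = x"
    and "x \<in> carrier A \<Longrightarrow> star A (c \<odot> x) = cnj c \<odot> star A x"
    and "x \<in> carrier A \<Longrightarrow> y \<in> carrier A \<Longrightarrow> star A (x \<oplus> y) = star A x \<oplus> star A y"
    and "x \<in> carrier A \<Longrightarrow> y \<in> carrier A \<Longrightarrow> star A (x \<otimes> y) = star A y \<otimes> star A x"
proof -
  show m: "Module.module complex_alg A" and "ring A" using assms by (auto simp: star_algebra_def)
  interpret Module.module complex_alg A by (rule m)
  note mod = smult_closed[of c x] smult_l_distr[of c d x] smult_r_distr[of c x y]
    smult_assoc1[of c d x] smult_one[of x] smult_l_null[of x]
  show "c \<odot> x \<in> carrier A" "(c + d) \<odot> x = c \<odot> x \<oplus> d \<odot> x"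
    "(c * d) \<odot> x = c \<odot> (d \<odot> x)" "1 \<odot> x = x" "0 \<odot> x = \<zero>"
    if "x \<in> carrier A" using mod that by auto
  show "c \<odot> (x \<oplus> y) = c \<odot> x \<oplus> c \<odot> y"
    if "x \<in> carrier A" "y \<in> carrier A" using mod that by auto
qed (use assms in \<open>auto simp: star_algebra_def\<close>)

lemma abelian_group_star_monoid_alg: "abelian_group (star_monoid_alg M \<iota>)"
proof (rule abelian_groupI)
  fix x assume "x \<in> carrier (star_monoid_alg M \<iota>)"
  then show "\<exists>y\<in>carrier (star_monoid_alg M \<iota>). y \<oplus>\<^bsub>star_monoid_alg M \<iota>\<^esub> x = \<zero>\<^bsub>star_monoid_alg M \<iota>\<^esub>"
    by (intro bexI[of _ "- x"]) auto
next
  fix x y assume "x \<in> carrier (star_monoid_alg M \<iota>)" "y \<in> carrier (star_monoid_alg M \<iota>)"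
  then show "x \<oplus>\<^bsub>star_monoid_alg M \<iota>\<^esub> y \<in> carrier (star_monoid_alg M \<iota>)"
    using keys_add[of x y] by auto
qed (auto simp: algebra_simps)

lemma star_monoid_algebra:
  assumes "monoid M"
    and \<iota>: "\<And>a. a \<in> carrier M \<Longrightarrow> \<iota> a \<in> carrier M" "\<And>a. a \<in> carrier M \<Longrightarrow> \<iota> (\<iota> a) = a"
      "\<And>a b. a \<in> carrier M \<Longrightarrow> b \<in> carrier M \<Longrightarrow> \<iota> (a \<otimes>\<^bsub>M\<^esub> b) = \<iota> b \<otimes>\<^bsub>M\<^esub> \<iota> a"
  shows "star_algebra (star_monoid_alg M \<iota>)"
proof -
  let ?A = "star_monoid_alg M \<iota>"
  interpret monoid M by fact
  show ?thesis
  proof (rule star_algebraI)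
    show "ring ?A"
    proof (rule ringI)
      show "abelian_group ?A" by (rule abelian_group_star_monoid_alg)
      show "monoid ?A"
      proof (rule monoidI)
        fix x assume x: "x \<in> carrier ?A"
        have "(\<Sum>b\<in>keys x. single (\<one>\<^bsub>M\<^esub> \<otimes>\<^bsub>M\<^esub> b) (lookup x b)) = x"
          using x poly_mapping_eq_sum_single[of x] by (auto simp: subset_iff cong: sum.cong)
        then show "\<one>\<^bsub>?A\<^esub> \<otimes>\<^bsub>?A\<^esub> x = x"
          by (simp add: conv_prod_single_left)
        have "(\<Sum>b\<in>keys x. single (b \<otimes>\<^bsub>M\<^esub> \<one>\<^bsub>M\<^esub>) (lookup x b)) = x"
          using x poly_mapping_eq_sum_single[of x] by (auto simp: subset_iff cong: sum.cong)
        then show "x \<otimes>\<^bsub>?A\<^esub> \<one>\<^bsub>?A\<^esub> = x"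
          by (simp add: conv_prod_single_right)
      next
        fix x y z
        assume "x \<in> carrier ?A" "y \<in> carrier ?A"
          "z \<in> carrier ?A"
        then show "x \<otimes>\<^bsub>?A\<^esub> y \<otimes>\<^bsub>?A\<^esub> z =
            x \<otimes>\<^bsub>?A\<^esub> (y \<otimes>\<^bsub>?A\<^esub> z)"
          by (simp add: conv_prod_assoc[of _ "carrier M"] m_assoc)
      qed (use conv_prod_keys[of _ "carrier M" _ "mult M"] in auto)
    qed (simp_all add: conv_prod_add_left conv_prod_add_right)
  next
    fix x assume x: "x \<in> carrier ?A"
    then show "star ?A x \<in> carrier ?A"
      using \<iota>(1) by (auto simp: conj_ext_def dest!: keys_sum[THEN subsetD] split: if_splits)
    show "star ?A (star ?A x) = x"
      using x \<iota>(2) by (auto intro!: conj_ext_involutive)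
  next
    fix c and x assume "x \<in> carrier ?A"
    then show "c \<odot>\<^bsub>?A\<^esub> x \<in> carrier ?A"
      using keys_scale[of c x] by auto
  next
    fix x y assume "x \<in> carrier ?A" "y \<in> carrier ?A"
    then show "star ?A (x \<otimes>\<^bsub>?A\<^esub> y) =
        star ?A y \<otimes>\<^bsub>?A\<^esub> star ?A x"
      using \<iota>(3) by (auto intro!: conj_ext_conv_prod)
  qed (auto simp: conv_prod_scale conj_ext_scale conj_ext_add scale_add lookup_scale lookup_add
        distrib_right mult.assoc intro!: poly_mapping_eqI)
qed

section \<open>Quotients by star-ideals\<close>

lemma quot_star_alg_simps [simp]:
  "carrier (quot_star_alg F I) = carrier (F Quot I)"
  "mult (quot_star_alg F I) = mult (F Quot I)"
  "one (quot_star_alg F I) = one (F Quot I)"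
  "zero (quot_star_alg F I) = zero (F Quot I)"
  "add (quot_star_alg F I) = add (F Quot I)"
  by (simp_all add: quot_star_alg_def)

locale star_ideal = ideal I F for I and F :: "('a, 'm) star_alg_scheme" (structure) +
  assumes star_algebra: "star_algebra F"
    and star_closed: "x \<in> I \<Longrightarrow> star F x \<in> I"
begin

lemmas alg = star_algebraD[OF star_algebra]

abbreviation coset :: "'a \<Rightarrow> 'a set" where "coset x \<equiv> I +> x"

text \<open>A ring ideal is closed under scalars because c x is the product of c 1 and x.\<close>

lemma smult_in_ideal: "x \<in> I \<Longrightarrow> c \<odot> x \<in> I"
proof -
  assume x: "x \<in> I"
  then have "c \<odot> x = (c \<odot> \<one>) \<otimes> x" using a_Hcarr[OF x] by (simp add: alg)
  then show ?thesis using I_l_closed[OF x, of "c \<odot> \<one>"] by (simp add: alg)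
qed

lemma coset_eqI:
  assumes "i \<in> I" "x \<in> carrier F"
  shows "coset (i \<oplus> x) = coset x"
proof -
  have "coset (i \<oplus> x) = coset i <+> coset x"
    using assms a_Hcarr by (simp add: a_rcos_sum)
  also have "\<dots> = coset \<zero> <+> coset x"
    using assms(1) a_rcos_const a_rcos_zero by (simp add: a_rcos_const)
  also have "\<dots> = coset (\<zero> \<oplus> x)" using assms(2) by (simp only: a_rcos_sum zero_closed)
  finally show ?thesis using assms(2) by simp
qed

lemma coset_carrier: "x \<in> carrier F \<Longrightarrow> coset x \<in> carrier (quot_star_alg F I)"
  by (simp add: FactRing_def a_rcosetsI[OF a_subset])

lemma coset_cases:
  assumes "X \<in> carrier (quot_star_alg F I)"
  obtains x where "x \<in> carrier F" "X = coset x"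
  using assms by (auto simp: FactRing_simps)

lemma mem_cosetE:
  assumes "y \<in> coset x"
  obtains i where "i \<in> I" "y = i \<oplus> x"
  using assms by (auto simp: a_r_coset_def')

lemma coset_mult: "x \<in> carrier F \<Longrightarrow> y \<in> carrier F \<Longrightarrow>
    coset x \<otimes>\<^bsub>quot_star_alg F I\<^esub> coset y = coset (x \<otimes> y)"
  by (simp add: FactRing_def rcoset_mult_add)

lemma coset_add: "x \<in> carrier F \<Longrightarrow> y \<in> carrier F \<Longrightarrow>
    coset x \<oplus>\<^bsub>quot_star_alg F I\<^esub> coset y = coset (x \<oplus> y)"
  by (simp add: FactRing_def a_rcos_sum)

lemma coset_one: "\<one>\<^bsub>quot_star_alg F I\<^esub> = coset \<one>"
  by (simp add: FactRing_def)

text \<open>The operation is defined as a union over all representatives. Their cosets coincide and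
  there is at least one of them, so the union is that single coset.\<close>

lemma coset_smult:
  assumes "x \<in> carrier F"
  shows "c \<odot>\<^bsub>quot_star_alg F I\<^esub> coset x = coset (c \<odot> x)"
proof -
  have "coset (c \<odot> y) = coset (c \<odot> x)" if y: "y \<in> coset x" for y
  proof -
    obtain i where i: "i \<in> I" "y = i \<oplus> x" using y by (rule mem_cosetE)
    show ?thesis
      unfolding i(2) alg(5)[OF a_Hcarr[OF i(1)] assms]
      by (rule coset_eqI[OF smult_in_ideal[OF i(1)] alg(3)[OF assms]])
  qed
  then have "(\<Union>y\<in>coset x. coset (c \<odot> y)) = (\<Union>y\<in>coset x. coset (c \<odot> x))"
    by (rule SUP_cong[OF refl])
  also have "\<dots> = coset (c \<odot> x)" using a_rcos_self[OF assms] by (simp only: UN_constant) auto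
  finally have "(\<Union>y\<in>coset x. coset (c \<odot> y)) = coset (c \<odot> x)" .
  then show ?thesis by (simp add: quot_star_alg_def)
qed

lemma coset_star:
  assumes "x \<in> carrier F"
  shows "star (quot_star_alg F I) (coset x) = coset (star F x)"
proof -
  have "coset (star F y) = coset (star F x)" if y: "y \<in> coset x" for y
  proof -
    obtain i where i: "i \<in> I" "y = i \<oplus> x" using y by (rule mem_cosetE)
    show ?thesis
      unfolding i(2) alg(14)[OF a_Hcarr[OF i(1)] assms]
      by (rule coset_eqI[OF star_closed[OF i(1)] alg(11)[OF assms]])
  qed
  then have "(\<Union>y\<in>coset x. coset (star F y)) = (\<Union>y\<in>coset x. coset (star F x))"
    by (rule SUP_cong[OF refl])
  also have "\<dots> = coset (star F x)" using a_rcos_self[OF assms] by (simp only: UN_constant) auto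
  finally have "(\<Union>y\<in>coset x. coset (star F y)) = coset (star F x)" .
  then show ?thesis by (simp add: quot_star_alg_def)
qed

lemma ring_quot: "ring (quot_star_alg F I)"
proof -
  interpret R: ring "F Quot I" by (rule quotient_is_ring)
  show ?thesis
  proof (intro ringI abelian_groupI monoidI)
    fix x assume "x \<in> carrier (quot_star_alg F I)"
    then show "\<exists>y\<in>carrier (quot_star_alg F I). y \<oplus>\<^bsub>quot_star_alg F I\<^esub> x = \<zero>\<^bsub>quot_star_alg F I\<^esub>"
      using R.l_neg by auto
  qed (simp_all add: R.m_assoc R.add.m_ac R.l_distr R.r_distr)
qed

lemma star_algebra_quot: "star_algebra (quot_star_alg F I)"
  by (rule star_algebraI[OF ring_quot]; (elim coset_cases)?; (elim coset_cases)?;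
      hypsubst?; simp add: coset_carrier coset_smult coset_star coset_mult coset_add alg
        del: quot_star_alg_simps)

end

lemma a_minus_star_monoid_alg:
  assumes "x \<in> carrier (star_monoid_alg M \<iota>)" "y \<in> carrier (star_monoid_alg M \<iota>)"
  shows "x \<ominus>\<^bsub>star_monoid_alg M \<iota>\<^esub> y = x - y"
proof -
  interpret abelian_group "star_monoid_alg M \<iota>" by (rule abelian_group_star_monoid_alg)
  have "\<ominus>\<^bsub>star_monoid_alg M \<iota>\<^esub> y = - y"
    using assms(2) by (intro minus_equality) auto
  then show ?thesis by (simp add: a_minus_def)
qed

lemma finsum_star_monoid_alg:
  assumes "finite S" "\<And>i. i \<in> S \<Longrightarrow> f i \<in> carrier (star_monoid_alg M \<iota>)"
  shows "finsum (star_monoid_alg M \<iota>) f S = (\<Sum>i\<in>S. f i)"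
  using assms
proof (induction S rule: finite_induct)
  interpret abelian_group "star_monoid_alg M \<iota>" by (rule abelian_group_star_monoid_alg)
  {
    case empty
    then show ?case by simp
  next
    case (insert x S)
    then show ?case by (subst finsum_insert) (auto simp del: star_monoid_alg_simps(1))
  }
qed

lemma (in star_ideal) coset_eq_ideal_iff:
  assumes "x \<in> carrier F"
  shows "coset x = I \<longleftrightarrow> x \<in> I"
  using assms a_rcos_const a_rcos_self by metis

lemma (in star_ideal) finsum_coset:
  assumes "finite S" "\<And>i. i \<in> S \<Longrightarrow> f i \<in> carrier F"
  shows "finsum (quot_star_alg F I) (\<lambda>i. coset (f i)) S = coset (finsum F f S)"
  using assms
proof (induction S rule: finite_induct)
  interpret Q: ring "quot_star_alg F I" by (rule ring_quot)
  {
    case empty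
    show ?case by (simp add: FactRing_def a_coset_add_zero[OF a_subset])
  next
    case (insert x S)
    then have "finsum (quot_star_alg F I) (\<lambda>i. coset (f i)) (insert x S) =
        coset (f x) \<oplus>\<^bsub>quot_star_alg F I\<^esub> finsum (quot_star_alg F I) (\<lambda>i. coset (f i)) S"
      by (intro Q.finsum_insert) (auto simp del: quot_star_alg_simps intro!: coset_carrier)
    also have "\<dots> = coset (f x) \<oplus>\<^bsub>quot_star_alg F I\<^esub> coset (finsum F f S)"
      using insert by simp
    also have "\<dots> = coset (f x \<oplus> finsum F f S)"
      using insert by (intro coset_add finsum_closed) auto
    also have "\<dots> = coset (finsum F f (insert x S))"
      using insert by (subst finsum_insert) auto
    finally show ?case .
  }
qed

lemma conv_prod_diff:
  "conv_prod m f (g - h) = conv_prod m f g - conv_prod m f h"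
  "conv_prod m (g - h) f = conv_prod m g f - conv_prod m h f"
  using conv_prod_add_right[of m f "g - h" h] conv_prod_add_left[of m "g - h" h f]
  by (simp_all add: algebra_simps)

section \<open>Tensor products as quotients of formal sums\<close>

lemma formal_sums_carrier: "carrier (formal_sums A B) = {f. keys f \<subseteq> carrier A \<times> carrier B}"
  by (simp add: formal_sums_def)

lemma star_algebra_formal_sums:
  fixes A :: "('a, 'm) star_alg_scheme" and B :: "('b, 'k) star_alg_scheme"
  assumes "star_algebra A" "star_algebra B"
  shows "star_algebra (formal_sums A B)"
  unfolding formal_sums_def
proof (rule star_monoid_algebra)
  interpret A: ring A by (rule star_algebraD(1)[OF assms(1)])
  interpret B: ring B by (rule star_algebraD(1)[OF assms(2)])
  show "monoid (A \<times>\<times> B)" by (rule DirProd_monoid) unfold_locales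
qed (use star_algebraD[OF assms(1)] star_algebraD[OF assms(2)] in auto)

lemma tensor_null_carrier:
  fixes A :: "('a, 'm) star_alg_scheme" and B :: "('b, 'k) star_alg_scheme"
  assumes "star_algebra A" "star_algebra B" "x \<in> tensor_null A B"
  shows "keys x \<subseteq> carrier A \<times> carrier B"
proof -
  interpret A: ring A by (rule star_algebraD(1)[OF assms(1)])
  interpret B: ring B by (rule star_algebraD(1)[OF assms(2)])
  have d: "keys (f - g) \<subseteq> S" if "keys f \<subseteq> S" "keys g \<subseteq> S"
    for f g :: "'a \<times> 'b \<Rightarrow>\<^sub>0 complex" and S
  proof
    fix z assume "z \<in> keys (f - g)"
    then have "z \<in> keys f \<or> z \<in> keys g"
      by (auto simp: in_keys_iff lookup_minus)
    then show "z \<in> S" using that by blast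
  qed
  show ?thesis
    using assms(3)
  proof induction
    case (add x y)
    then show ?case using keys_add[of x y] by auto
  next
    case (smult x c)
    then show ?case using keys_scale[of c x] by auto
  qed (simp, (intro d; simp add: star_algebraD(3)[OF assms(1)] star_algebraD(3)[OF assms(2)])+)
qed

lemma tensor_null_sum: "(\<And>i. i \<in> S \<Longrightarrow> f i \<in> tensor_null A B) \<Longrightarrow> (\<Sum>i\<in>S. f i) \<in> tensor_null A B"
  by (induction S rule: infinite_finite_induct) (auto intro: tensor_null.zero tensor_null.add)

text \<open>Multiplication by a single pair sends each bilinearity relation to a multiple of a
  relation of the same kind; sums of pairs follow by linearity.\<close>

lemma tensor_null_left:
  fixes A :: "('a, 'm) star_alg_scheme" and B :: "('b, 'k) star_alg_scheme"
  assumes A: "star_algebra A" and B: "star_algebra B" and x: "x \<in> tensor_null A B"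
    and f: "keys f \<subseteq> carrier A \<times> carrier B"
  shows "conv_prod (mult (A \<times>\<times> B)) f x \<in> tensor_null A B"
proof -
  interpret A: ring A by (rule star_algebraD(1)[OF A])
  interpret B: ring B by (rule star_algebraD(1)[OF B])
  note alg = star_algebraD[OF A] star_algebraD[OF B]
  have 1: "conv_prod (mult (A \<times>\<times> B)) (single (a, b) d) x \<in> tensor_null A B"
    if ab: "a \<in> carrier A" "b \<in> carrier B" for a b d
    using x
  proof induction
    case zero
    show ?case by (simp add: tensor_null.zero)
  next
    case (add x y)
    then show ?case by (simp add: conv_prod_add_right tensor_null.add)
  next
    case (smult x c)
    then show ?case by (simp add: conv_prod_scale tensor_null.smult)
  next
    case (add_left a1 a2 b1)
    have "scale d (single ((a \<otimes>\<^bsub>A\<^esub> a1) \<oplus>\<^bsub>A\<^esub> (a \<otimes>\<^bsub>A\<^esub> a2), b \<otimes>\<^bsub>B\<^esub> b1) 1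
       - single (a \<otimes>\<^bsub>A\<^esub> a1, b \<otimes>\<^bsub>B\<^esub> b1) 1
       - single (a \<otimes>\<^bsub>A\<^esub> a2, b \<otimes>\<^bsub>B\<^esub> b1) 1) \<in> tensor_null A B"
      using add_left ab by (intro tensor_null.smult tensor_null.add_left) auto
    then show ?case using add_left ab
      by (simp add: conv_prod_diff A.r_distr scale_diff scale_single)
  next
    case (add_right a1 b1 b2)
    have "scale d (single (a \<otimes>\<^bsub>A\<^esub> a1, (b \<otimes>\<^bsub>B\<^esub> b1) \<oplus>\<^bsub>B\<^esub> (b \<otimes>\<^bsub>B\<^esub> b2)) 1
       - single (a \<otimes>\<^bsub>A\<^esub> a1, b \<otimes>\<^bsub>B\<^esub> b1) 1
       - single (a \<otimes>\<^bsub>A\<^esub> a1, b \<otimes>\<^bsub>B\<^esub> b2) 1) \<in> tensor_null A B"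
      using add_right ab by (intro tensor_null.smult tensor_null.add_right) auto
    then show ?case using add_right ab
      by (simp add: conv_prod_diff B.r_distr scale_diff scale_single)
  next
    case (smult_left a1 b1 c)
    have "scale d (single (c \<odot>\<^bsub>A\<^esub> (a \<otimes>\<^bsub>A\<^esub> a1), b \<otimes>\<^bsub>B\<^esub> b1) 1
       - single (a \<otimes>\<^bsub>A\<^esub> a1, b \<otimes>\<^bsub>B\<^esub> b1) c) \<in> tensor_null A B"
      using smult_left ab by (intro tensor_null.smult tensor_null.smult_left) auto
    then show ?case using smult_left ab
      by (simp add: conv_prod_diff alg scale_diff scale_single)
  next
    case (smult_right a1 b1 c)
    have "scale d (single (a \<otimes>\<^bsub>A\<^esub> a1, c \<odot>\<^bsub>B\<^esub> (b \<otimes>\<^bsub>B\<^esub> b1)) 1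
       - single (a \<otimes>\<^bsub>A\<^esub> a1, b \<otimes>\<^bsub>B\<^esub> b1) c) \<in> tensor_null A B"
      using smult_right ab by (intro tensor_null.smult tensor_null.smult_right) auto
    then show ?case using smult_right ab
      by (simp add: conv_prod_diff alg scale_diff scale_single)
  qed
  have "conv_prod (mult (A \<times>\<times> B)) f x = (\<Sum>z\<in>keys f.
      conv_prod (mult (A \<times>\<times> B)) (single z (lookup f z)) x)"
    by (subst poly_mapping_eq_sum_single[of f]) (rule conv_prod_sum_left)
  also have "\<dots> \<in> tensor_null A B"
    using f 1 by (intro tensor_null_sum) auto
  finally show ?thesis .
qed

lemma tensor_null_star:
  fixes A :: "('a, 'm) star_alg_scheme" and B :: "('b, 'k) star_alg_scheme"
  assumes A: "star_algebra A" and B: "star_algebra B" and x: "x \<in> tensor_null A B"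
  shows "conj_ext (map_prod (star A) (star B)) x \<in> tensor_null A B"
  using x
proof induction
  case zero
  show ?case by (simp add: tensor_null.zero)
next
  case (add x y)
  then show ?case by (simp add: conj_ext_add tensor_null.add)
next
  case (smult x c)
  then show ?case by (simp add: conj_ext_scale tensor_null.smult)
next
  case (add_left a a' b)
  then show ?case
    using tensor_null.add_left[of "star A a" A "star A a'" "star B b" B]
    by (simp add: conj_ext_diff star_algebraD[OF A] star_algebraD[OF B])
next
  case (add_right a b b')
  then show ?case
    using tensor_null.add_right[of "star A a" A "star B b" B "star B b'"]
    by (simp add: conj_ext_diff star_algebraD[OF A] star_algebraD[OF B])
next
  case (smult_left a b c)
  then show ?case
    using tensor_null.smult_left[of "star A a" A "star B b" B "cnj c"]
    by (simp add: conj_ext_diff star_algebraD[OF A] star_algebraD[OF B])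
next
  case (smult_right a b c)
  then show ?case
    using tensor_null.smult_right[of "star A a" A "star B b" B "cnj c"]
    by (simp add: conj_ext_diff star_algebraD[OF A] star_algebraD[OF B])
qed

text \<open>The product of x and f is the adjoint of the product of the adjoints in reverse order,
  so closure under the involution reduces this to multiplication from the left.\<close>

lemma tensor_null_right:
  fixes A :: "('a, 'm) star_alg_scheme" and B :: "('b, 'k) star_alg_scheme"
  assumes A: "star_algebra A" and B: "star_algebra B" and x: "x \<in> tensor_null A B"
    and f: "keys f \<subseteq> carrier A \<times> carrier B"
  shows "conv_prod (mult (A \<times>\<times> B)) x f \<in> tensor_null A B"
proof -
  let ?F = "formal_sums A B"
  note alg = star_algebraD[OF star_algebra_formal_sums[OF A B]]
  have c: "x \<in> carrier ?F" "f \<in> carrier ?F"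
    using f tensor_null_carrier[OF A B x] by (auto simp: formal_sums_carrier)
  have star: "star ?F z \<in> tensor_null A B" if "z \<in> tensor_null A B" for z
    using tensor_null_star[OF A B that] by (simp add: formal_sums_def)
  have "star ?F (star ?F f \<otimes>\<^bsub>?F\<^esub> star ?F x) \<in> tensor_null A B"
    using tensor_null_left[OF A B star[OF x], of "star ?F f"] alg(11)[OF c(2)]
    by (intro star) (simp add: formal_sums_def)
  then have "x \<otimes>\<^bsub>?F\<^esub> f \<in> tensor_null A B"
    unfolding alg(15)[OF alg(11)[OF c(2)] alg(11)[OF c(1)]] alg(12)[OF c(1)] alg(12)[OF c(2)] .
  then show ?thesis by (simp add: formal_sums_def)
qed

lemma star_ideal_tensor_null:
  fixes A :: "('a, 'm) star_alg_scheme" and B :: "('b, 'k) star_alg_scheme"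
  assumes A: "star_algebra A" and B: "star_algebra B"
  shows "star_ideal (tensor_null A B) (formal_sums A B)"
proof -
  note alg = star_algebra_formal_sums[OF A B]
  interpret F: ring "formal_sums A B" by (rule star_algebraD(1)[OF alg])
  have sub: "tensor_null A B \<subseteq> carrier (formal_sums A B)"
    using tensor_null_carrier[OF A B] by (auto simp: formal_sums_carrier)
  have neg: "\<ominus>\<^bsub>formal_sums A B\<^esub> x = - x" if "x \<in> carrier (formal_sums A B)" for x
    using that by (intro F.minus_equality) (auto simp: formal_sums_def)
  have uminus: "- x \<in> tensor_null A B" if "x \<in> tensor_null A B" for x
  proof -
    have "scale (- 1) x = - x"
      by (rule poly_mapping_eqI) (simp add: lookup_scale)
    then show ?thesis using tensor_null.smult[OF that, of "- 1"] by simp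
  qed
  have "ideal (tensor_null A B) (formal_sums A B)"
  proof (rule idealI[OF F.ring_axioms])
    show "subgroup (tensor_null A B) (add_monoid (formal_sums A B))"
    proof
      fix x assume x: "x \<in> tensor_null A B"
      then show "inv\<^bsub>add_monoid (formal_sums A B)\<^esub> x \<in> tensor_null A B"
        using neg[of x] uminus[OF x] sub by (auto simp: a_inv_def)
    qed (use sub in \<open>auto simp: formal_sums_def intro: tensor_null.intros\<close>)
  next
    fix a x assume "a \<in> tensor_null A B" "x \<in> carrier (formal_sums A B)"
    then show "x \<otimes>\<^bsub>formal_sums A B\<^esub> a \<in> tensor_null A B" "a \<otimes>\<^bsub>formal_sums A B\<^esub> x \<in> tensor_null A B"
      using tensor_null_left[OF A B] tensor_null_right[OF A B] by (simp_all add: formal_sums_def)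
  qed
  then show ?thesis
    using alg tensor_null_star[OF A B]
    by (simp add: star_ideal_def star_ideal_axioms_def formal_sums_def)
qed

section \<open>Product functionals on tensor products\<close>

definition tensor_pairing :: "('a \<Rightarrow> complex) \<Rightarrow> ('b \<Rightarrow> complex) \<Rightarrow> ('a \<times> 'b \<Rightarrow>\<^sub>0 complex) \<Rightarrow> complex" where
  "tensor_pairing \<alpha> \<beta> = pairing (\<lambda>(a, b). \<alpha> a * \<beta> b)"

lemma tensor_pairing_null:
  assumes \<alpha>: "linear_map A complex_alg \<alpha>" and \<beta>: "linear_map B complex_alg \<beta>"
    and x: "x \<in> tensor_null A B"
  shows "tensor_pairing \<alpha> \<beta> x = 0"
  using x
  by induction
     (use \<alpha> \<beta> in \<open>auto simp: tensor_pairing_def pairing_add pairing_scale pairing_diff linear_map_def algebra_simps\<close>)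

text \<open>This turns an equation in the tensor product into scalar equations, which gives closure
  under convolution later. Product functionals kill the null relations, so the representative chosen
  by \<open>tensor_lift\<close> may be exchanged for r.\<close>

lemma tensor_map_zero:
  fixes A :: "('a, 'm) star_alg_scheme" and Q :: "('q, 'k) star_alg_scheme"
  assumes A: "star_algebra A" and Q: "star_algebra Q" and p: "linear_map A Q p"
    and \<alpha>: "linear_map Q complex_alg \<alpha>" and \<beta>: "linear_map Q complex_alg \<beta>"
    and r: "r \<in> carrier (formal_sums A A)"
    and zero: "tensor_map Q Q p p (tensor_class A A r) = \<zero>\<^bsub>tensor_alg Q Q\<^esub>"
  shows "tensor_pairing (\<alpha> \<circ> p) (\<beta> \<circ> p) r = 0"
proof -
  interpret A: star_ideal "tensor_null A A" "formal_sums A A" by (rule star_ideal_tensor_null[OF A A])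
  interpret Q: star_ideal "tensor_null Q Q" "formal_sums Q Q" by (rule star_ideal_tensor_null[OF Q Q])
  have lin: "linear_map A complex_alg (\<gamma> \<circ> p)" if "linear_map Q complex_alg \<gamma>" for \<gamma>
    using p that by (fastforce simp: linear_map_def Pi_iff)
  define s where "s = (SOME s. s \<in> tensor_class A A r)"
  have "s \<in> tensor_class A A r"
    unfolding s_def tensor_class_def using A.a_rcos_self[OF r] by (rule someI)
  then obtain n where n: "n \<in> tensor_null A A" "s = n + r"
    unfolding tensor_class_def by (elim A.mem_cosetE) (simp add: formal_sums_def)
  have ks: "keys s \<subseteq> carrier A \<times> carrier A"
    using n r tensor_null_carrier[OF A A n(1)] keys_add[of n r] by (auto simp: formal_sums_carrier)
  let ?e = "\<lambda>x. single (p (fst x), p (snd x)) (lookup s x)"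
  have pc: "p a \<in> carrier Q" if "a \<in> carrier A" for a
    using p that by (auto simp: linear_map_def)
  have ec: "?e x \<in> carrier (formal_sums Q Q)" if "x \<in> keys s" for x
    using that ks pc by (auto simp: formal_sums_carrier)
  have "tensor_map Q Q p p (tensor_class A A r) =
     finsum (tensor_alg Q Q) (\<lambda>(a, b). lookup s (a, b) \<odot>\<^bsub>tensor_alg Q Q\<^esub>
        simple_tensor Q Q (p a) (p b)) (keys s)"
    by (simp add: tensor_map_def tensor_lift_def s_def Let_def)
  also have "\<dots> = finsum (tensor_alg Q Q) (\<lambda>x. Q.coset (?e x)) (keys s)"
  proof (rule abelian_monoid.finsum_cong')
    show "abelian_monoid (tensor_alg Q Q)"
      using Q.ring_quot by (simp add: tensor_alg_def ring_def abelian_group_def)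
    show "(\<lambda>x. Q.coset (?e x)) \<in> keys s \<rightarrow> carrier (tensor_alg Q Q)"
      using ec Q.coset_carrier by (auto simp: tensor_alg_def simp del: quot_star_alg_simps)
    fix x assume x: "x \<in> keys s"
    then have "single (p (fst x), p (snd x)) 1 \<in> carrier (formal_sums Q Q)"
      using ks pc by (auto simp: formal_sums_carrier)
    from Q.coset_smult[OF this, of "lookup s x"]
    show "(case x of (a, b) \<Rightarrow> lookup s (a, b) \<odot>\<^bsub>tensor_alg Q Q\<^esub>
        simple_tensor Q Q (p a) (p b)) = Q.coset (?e x)"
      by (simp add: split_beta tensor_alg_def simple_tensor_def tensor_class_def formal_sums_def scale_single)
  qed simp
  also have "\<dots> = Q.coset (finsum (formal_sums Q Q) ?e (keys s))"
    unfolding tensor_alg_def using ec by (intro Q.finsum_coset) auto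
  also have "finsum (formal_sums Q Q) ?e (keys s) = (\<Sum>x\<in>keys s. ?e x)"
    unfolding formal_sums_def using ec by (intro finsum_star_monoid_alg) (auto simp: formal_sums_def)
  finally have "Q.coset (\<Sum>x\<in>keys s. ?e x) = tensor_null Q Q"
    using zero by (simp add: tensor_alg_def FactRing_def)
  moreover have "(\<Sum>x\<in>keys s. ?e x) \<in> carrier (formal_sums Q Q)"
    using ec keys_sum[of ?e "keys s"] by (fastforce simp: formal_sums_carrier)
  ultimately have "(\<Sum>x\<in>keys s. ?e x) \<in> tensor_null Q Q"
    by (simp add: Q.coset_eq_ideal_iff)
  then have "tensor_pairing \<alpha> \<beta> (\<Sum>x\<in>keys s. ?e x) = 0"
    by (rule tensor_pairing_null[OF \<alpha> \<beta>])
  then have "tensor_pairing (\<alpha> \<circ> p) (\<beta> \<circ> p) s = 0"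
    by (simp add: tensor_pairing_def pairing_sum pairing_def[of _ s] split_beta)
  then show ?thesis
    using tensor_pairing_null[OF lin[OF \<alpha>] lin[OF \<beta>] n(1)]
    by (simp add: n(2) tensor_pairing_def pairing_add)
qed

section \<open>The algebra of the free unitary group\<close>

definition adjoint_word :: "'n letter list \<Rightarrow> 'n letter list" where
  "adjoint_word w = rev (map (\<lambda>(ij, s). (ij, \<not> s)) w)"

lemma adjoint_word_simps [simp]:
  "adjoint_word [] = []" "adjoint_word [((i, j), s)] = [((i, j), \<not> s)]"
  "adjoint_word [((i, j), s), ((k, l), t)] = [((k, l), \<not> t), ((i, j), \<not> s)]"
  "adjoint_word (x @ y) = adjoint_word y @ adjoint_word x"
  "adjoint_word (adjoint_word w) = w"
  by (auto simp: adjoint_word_def rev_map o_def split_beta)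

lemma free_star_alg_eq:
  "free_star_alg = star_monoid_alg \<lparr>carrier = UNIV, mult = (@), one = []\<rparr> adjoint_word"
  by (simp add: free_star_alg_def adjoint_word_def[abs_def])

lemma free_star_alg_simps [simp]:
  "carrier free_star_alg = UNIV" "mult free_star_alg = conv_prod (@)"
  "one free_star_alg = single [] 1" "zero free_star_alg = 0" "add free_star_alg = (+)"
  "smult free_star_alg c = scale c" "star free_star_alg = conj_ext adjoint_word"
  by (simp_all add: free_star_alg_eq)

lemma star_algebra_free: "star_algebra free_star_alg"
  unfolding free_star_alg_eq by (rule star_monoid_algebra) (auto intro: monoidI)

lemma a_minus_free: "x \<ominus>\<^bsub>free_star_alg\<^esub> y = x - y"
  unfolding free_star_alg_eq by (rule a_minus_star_monoid_alg) auto

lemma a_inv_free: "\<ominus>\<^bsub>free_star_alg\<^esub> y = - y"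
  using a_minus_free[of 0 y] by (simp add: a_minus_def)

lemma finsum_free: "finite S \<Longrightarrow> finsum free_star_alg f S = sum f S"
  unfolding free_star_alg_eq by (rule finsum_star_monoid_alg) auto

lemma star_ideal_generated_ideal:
  assumes F: "star_algebra F" and S: "S \<subseteq> carrier F"
  shows "star_ideal (star_ideal_generated F S) F"
proof -
  interpret ring F by (rule star_algebraD(1)[OF F])
  let ?C = "{I. ideal I F \<and> (\<forall>x\<in>I. star F x \<in> I) \<and> S \<subseteq> I}"
  have "carrier F \<in> ?C" using oneideal S star_algebraD(11)[OF F] by auto
  then have "ideal (\<Inter>?C) F" by (intro i_Intersect) auto
  then show ?thesis
    using F by (auto simp: star_ideal_def star_ideal_axioms_def star_ideal_generated_def)
qed

section \<open>The defining relations of the free unitary group\<close>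

text \<open>The sign merges the relations for u and for its conjugate: \<open>row_rel\<close> with s
  False and \<open>col_rel\<close> with s True express unitarity of u, the other two cases that of
  the conjugate matrix.\<close>

definition row_rel :: "'n::finite \<Rightarrow> 'n \<Rightarrow> bool \<Rightarrow> 'n star_poly" where
  "row_rel i j s = (\<Sum>c\<in>UNIV. single [((i, c), s), ((j, c), \<not> s)] 1) -
     (if i = j then single [] 1 else 0)"

definition col_rel :: "'n::finite \<Rightarrow> 'n \<Rightarrow> bool \<Rightarrow> 'n star_poly" where
  "col_rel i j s = (\<Sum>c\<in>UNIV. single [((c, i), s), ((c, j), \<not> s)] 1) -
     (if i = j then single [] 1 else 0)"

lemma free_unitary_relations:
  "unitarity_relations free_star_alg free_gen \<union>
   unitarity_relations free_star_alg (\<lambda>i j. star free_star_alg (free_gen i j)) =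
   {row_rel i j s | i j s. True} \<union> {col_rel i j s | i j s. True}"
proof -
  have u: "unitarity_relations free_star_alg free_gen = {row_rel i j False | i j. True} \<union> {col_rel i j True | i j. True}"
    unfolding unitarity_relations_def by (simp add: finsum_free a_minus_free free_gen_def row_rel_def col_rel_def)
  have v: "unitarity_relations free_star_alg (\<lambda>i j. star free_star_alg (free_gen i j)) =
      {row_rel i j True | i j. True} \<union> {col_rel i j False | i j. True}"
    unfolding unitarity_relations_def by (simp add: finsum_free a_minus_free free_gen_def row_rel_def col_rel_def)
  have ex: "(\<exists>s. P s) \<longleftrightarrow> P True \<or> P False" for P by (metis (full_types))
  show ?thesis
    unfolding u v by (auto simp: ex)
qed

lemma star_ideal_free_unitary: "star_ideal free_unitary_ideal free_star_alg"
  unfolding free_unitary_ideal_def by (rule star_ideal_generated_ideal[OF star_algebra_free]) simp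

lemma rel_in_free_unitary_ideal: "row_rel i j s \<in> free_unitary_ideal" "col_rel i j s \<in> free_unitary_ideal"
  unfolding free_unitary_ideal_def star_ideal_generated_def free_unitary_relations by blast+

lemma sandwich_rel:
  "conv_prod (@) (single x 1) (conv_prod (@) (row_rel i j s) (single y 1)) =
    (\<Sum>c\<in>UNIV. single (x @ ((i, c), s) # ((j, c), \<not> s) # y) 1) -
       (if i = j then single (x @ y) 1 else 0)"
  "conv_prod (@) (single x 1) (conv_prod (@) (col_rel i j s) (single y 1)) =
    (\<Sum>c\<in>UNIV. single (x @ ((c, i), s) # ((c, j), \<not> s) # y) 1) -
       (if i = j then single (x @ y) 1 else 0)"
  by (simp_all add: row_rel_def col_rel_def conv_prod_diff conv_prod_sum_left conv_prod_sum_right)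

lemma sandwich_rel_in_ideal:
  "(\<Sum>c\<in>UNIV. single (x @ ((i, c), s) # ((j, c), \<not> s) # y) 1) -
       (if i = j then single (x @ y) 1 else 0) \<in> free_unitary_ideal"
  "(\<Sum>c\<in>UNIV. single (x @ ((c, i), s) # ((c, j), \<not> s) # y) 1) -
       (if i = j then single (x @ y) 1 else 0) \<in> free_unitary_ideal"
proof -
  interpret star_ideal "free_unitary_ideal :: 'a star_poly set" free_star_alg
    by (rule star_ideal_free_unitary)
  have "conv_prod (@) (single x 1) (conv_prod (@) r (single y 1)) \<in> free_unitary_ideal"
    if "r \<in> free_unitary_ideal" for r :: "'a star_poly"
    using I_l_closed[OF I_r_closed[OF that]] by simp
  from this[OF rel_in_free_unitary_ideal(1)] this[OF rel_in_free_unitary_ideal(2)]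
  show "(\<Sum>c\<in>UNIV. single (x @ ((i, c), s) # ((j, c), \<not> s) # y) 1) -
       (if i = j then single (x @ y) 1 else 0) \<in> free_unitary_ideal"
    and "(\<Sum>c\<in>UNIV. single (x @ ((c, i), s) # ((c, j), \<not> s) # y) 1) -
       (if i = j then single (x @ y) 1 else 0) \<in> free_unitary_ideal"
    by (simp_all only: sandwich_rel)
qed

section \<open>Functionals compatible with the relations\<close>

definition unitary_functional :: "('n::finite letter list \<Rightarrow> complex) \<Rightarrow> bool" where
  "unitary_functional \<xi> \<longleftrightarrow> (\<forall>x y i j s.
     (\<Sum>c\<in>UNIV. \<xi> (x @ ((i, c), s) # ((j, c), \<not> s) # y)) = (if i = j then \<xi> (x @ y) else 0) \<and>
     (\<Sum>c\<in>UNIV. \<xi> (x @ ((c, i), s) # ((c, j), \<not> s) # y)) = (if i = j then \<xi> (x @ y) else 0))"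

lemma unitary_functionalD:
  assumes "unitary_functional \<xi>"
  shows "(\<Sum>c\<in>UNIV. \<xi> (x @ ((i, c), s) # ((j, c), \<not> s) # y)) = (if i = j then \<xi> (x @ y) else 0)"
    "(\<Sum>c\<in>UNIV. \<xi> (x @ ((c, i), s) # ((c, j), \<not> s) # y)) = (if i = j then \<xi> (x @ y) else 0)"
  using assms unfolding unitary_functional_def by blast+

text \<open>The ideal is an intersection, so it is enough to find one star-ideal that contains the
  relations and is killed by \<xi>.\<close>

lemma unitary_functional_kills_ideal:
  assumes \<xi>: "unitary_functional \<xi>" and f: "f \<in> free_unitary_ideal"
  shows "pairing \<xi> f = 0"
proof -
  interpret F: ring free_star_alg by (rule star_algebraD(1)[OF star_algebra_free])
  define sw where "sw x f y = conv_prod (@) (single x 1) (conv_prod (@) f (single y 1))" for x y :: "'a letter list" and f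
  define P where "P f \<longleftrightarrow> (\<forall>x y. pairing \<xi> (sw x f y) = 0)" for f
  \<comment> \<open>P makes I stable under multiplication by words on both sides; asking the same of
    the adjoint makes it closed under the involution. The relations belong to I because their
    adjoints are again relations.\<close>
  define I where "I = {f. P f \<and> P (conj_ext adjoint_word f)}"
  have P_left: "P (conv_prod (@) g f)" if "P f" for f g
  proof -
    have "sw x (conv_prod (@) g f) y = (\<Sum>b\<in>keys g. scale (lookup g b) (sw (x @ b) f y))" for x y
    proof -
      have "sw x (conv_prod (@) g f) y =
          conv_prod (@) (conv_prod (@) (single x 1) g) (conv_prod (@) f (single y 1))"
        by (simp add: sw_def conv_prod_assoc[of _ UNIV])
      then show ?thesis
        unfolding sw_def conv_prod_single_left[of _ x] conv_prod_sum_left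
          conv_prod_scale(1)[symmetric] scale_single by simp
    qed
    then show ?thesis using that by (simp add: P_def pairing_sum pairing_scale)
  qed
  have P_right: "P (conv_prod (@) f g)" if "P f" for f g
  proof -
    have "sw x (conv_prod (@) f g) y = (\<Sum>b\<in>keys g. scale (lookup g b) (sw x f (b @ y)))" for x y
    proof -
      have "sw x (conv_prod (@) f g) y =
          conv_prod (@) (single x 1) (conv_prod (@) f (conv_prod (@) g (single y 1)))"
        by (simp add: sw_def conv_prod_assoc[of _ UNIV])
      then show ?thesis
        unfolding sw_def conv_prod_single_right[of _ g y] conv_prod_sum_right
          conv_prod_scale(2)[symmetric] scale_single by simp
    qed
    then show ?thesis using that by (simp add: P_def pairing_sum pairing_scale)
  qed
  have adj: "conj_ext adjoint_word (conv_prod (@) f g) =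
      conv_prod (@) (conj_ext adjoint_word g) (conj_ext adjoint_word f)" for f g :: "'a star_poly"
    by (rule conj_ext_conv_prod) simp
  have P_add: "P (f + g)" if "P f" "P g" for f g
    using that by (simp add: P_def sw_def conv_prod_add_left conv_prod_add_right pairing_add)
  have P_zero: "P 0" by (simp add: P_def sw_def)
  have P_uminus: "P (- f)" if "P f" for f
  proof -
    have "P (0 - f)" using that unfolding P_def sw_def conv_prod_diff pairing_diff by simp
    then show ?thesis by simp
  qed
  have P_rel: "P (row_rel i j s)" "P (col_rel i j s)" for i j s
    unfolding P_def sw_def sandwich_rel
    using unitary_functionalD[OF \<xi>] by (simp_all add: pairing_diff pairing_sum)
  have star_rel: "conj_ext adjoint_word (row_rel i j s) = row_rel j i s"
    "conj_ext adjoint_word (col_rel i j s) = col_rel j i s" for i j :: 'a and s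
    by (simp_all add: row_rel_def col_rel_def conj_ext_diff conj_ext_sum)
  have "ideal I free_star_alg"
  proof (rule idealI[OF F.ring_axioms])
    show "subgroup I (add_monoid free_star_alg)"
    proof
      fix x assume "x \<in> I"
      then show "inv\<^bsub>add_monoid free_star_alg\<^esub> x \<in> I"
        using a_inv_free[of x] by (simp add: a_inv_def I_def P_uminus conj_ext_uminus)
    qed (auto simp: I_def conj_ext_add P_add P_zero)
  next
    fix a x assume "a \<in> I"
    then show "x \<otimes>\<^bsub>free_star_alg\<^esub> a \<in> I" "a \<otimes>\<^bsub>free_star_alg\<^esub> x \<in> I"
      by (auto simp: I_def adj P_left P_right)
  qed
  moreover have "\<forall>x\<in>I. star free_star_alg x \<in> I"
    by (auto simp: I_def conj_ext_involutive)
  moreover have "{row_rel i j s | i j s. True} \<union> {col_rel i j s | i j s. True} \<subseteq> I"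
    by (auto simp: I_def P_rel star_rel)
  ultimately have "free_unitary_ideal \<subseteq> I"
    unfolding free_unitary_ideal_def star_ideal_generated_def free_unitary_relations by blast
  then have "P f" using f by (auto simp: I_def)
  then have "pairing \<xi> (sw [] f []) = 0" by (simp add: P_def)
  then show ?thesis using F.l_one[of f] F.r_one[of f] by (simp add: sw_def)
qed

lemma sum_index_lists_add:
  "(\<Sum>K\<in>index_lists (m + n). f K) =
    (\<Sum>K1\<in>index_lists m. \<Sum>K2\<in>(index_lists n :: 'n::finite list set). f (K1 @ K2))"
proof -
  have "(\<Sum>K1\<in>index_lists m. \<Sum>K2\<in>(index_lists n :: 'n list set). f (K1 @ K2)) =
      (\<Sum>(K1, K2)\<in>index_lists m \<times> index_lists n. f (K1 @ K2))"
    by (simp add: sum.cartesian_product)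
  also have "\<dots> = (\<Sum>K\<in>index_lists (m + n). f K)"
    by (rule sum.reindex_bij_witness[of _ "\<lambda>K. (take m K, drop m K)" "\<lambda>(K1, K2). K1 @ K2"]) auto
  finally show ?thesis by simp
qed

lemma word_parts_append [simp]:
  "row_word (x @ y) = row_word x @ row_word y" "col_word (x @ y) = col_word x @ col_word y"
  "sign_word (x @ y) = sign_word x @ sign_word y"
  "row_word (((i, j), s) # x) = i # row_word x" "col_word (((i, j), s) # x) = j # col_word x"
  "sign_word (((i, j), s) # x) = s # sign_word x"
  "row_word [] = []" "col_word [] = []" "sign_word [] = []"
  by (simp_all add: row_word_def col_word_def sign_word_def)

lemma letter_word_append [simp]:
  "length I = length w \<Longrightarrow> length J = length w \<Longrightarrow>
     letter_word (I @ I') (J @ J') (w @ w') = letter_word I J w @ letter_word I' J' w'"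
  "letter_word (i # I) (j # J) (s # w) = ((i, j), s) # letter_word I J w"
  by (simp_all add: letter_word_def zip_append)

text \<open>The two summation indices under the middle letters are moved inside, where the relations
  act.\<close>

lemma convolution_split:
  "convolution \<phi> \<psi> (x @ ((i, j), s) # ((k, l), t) # y) =
    (\<Sum>K1\<in>index_lists (length x). \<Sum>K2\<in>index_lists (length y). \<Sum>a\<in>UNIV. \<Sum>b\<in>UNIV.
      \<phi> (letter_word (row_word x) K1 (sign_word x) @ ((i, a), s) # ((k, b), t) # letter_word (row_word y) K2 (sign_word y)) *
      \<psi> (letter_word K1 (col_word x) (sign_word x) @ ((a, j), s) # ((b, l), t) # letter_word K2 (col_word y) (sign_word y)))"
proof -
  let ?f = "\<lambda>K. \<phi> (letter_word (row_word x @ i # k # row_word y) K (sign_word x @ s # t # sign_word y)) *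
      \<psi> (letter_word K (col_word x @ j # l # col_word y) (sign_word x @ s # t # sign_word y))"
  have "convolution \<phi> \<psi> (x @ ((i, j), s) # ((k, l), t) # y) =
      (\<Sum>K\<in>index_lists (length x + Suc (Suc (length y))). ?f K)"
    by (simp add: convolution_def)
  also have "\<dots> = (\<Sum>K1\<in>index_lists (length x). \<Sum>a\<in>UNIV. \<Sum>b\<in>UNIV. \<Sum>K2\<in>index_lists (length y). ?f (K1 @ a # b # K2))"
    unfolding sum_index_lists_add sum_index_lists_Suc ..
  also have "\<dots> = (\<Sum>K1\<in>index_lists (length x). \<Sum>K2\<in>index_lists (length y). \<Sum>a\<in>UNIV. \<Sum>b\<in>UNIV. ?f (K1 @ a # b # K2))"
  proof (rule sum.cong[OF refl])
    fix K1
    have "(\<Sum>a\<in>UNIV. \<Sum>b\<in>UNIV. \<Sum>K2\<in>index_lists (length y). ?f (K1 @ a # b # K2)) =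
      (\<Sum>a\<in>UNIV. \<Sum>K2\<in>index_lists (length y). \<Sum>b\<in>UNIV. ?f (K1 @ a # b # K2))"
      by (rule sum.cong[OF refl], rule sum.swap)
    also have "\<dots> = (\<Sum>K2\<in>index_lists (length y). \<Sum>a\<in>UNIV. \<Sum>b\<in>UNIV. ?f (K1 @ a # b # K2))"
      by (rule sum.swap)
    finally show "(\<Sum>a\<in>UNIV. \<Sum>b\<in>UNIV. \<Sum>K2\<in>index_lists (length y). ?f (K1 @ a # b # K2)) =
      (\<Sum>K2\<in>index_lists (length y). \<Sum>a\<in>UNIV. \<Sum>b\<in>UNIV. ?f (K1 @ a # b # K2))" .
  qed
  also have "\<dots> = (\<Sum>K1\<in>index_lists (length x). \<Sum>K2\<in>index_lists (length y). \<Sum>a\<in>UNIV. \<Sum>b\<in>UNIV.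
      \<phi> (letter_word (row_word x) K1 (sign_word x) @ ((i, a), s) # ((k, b), t) # letter_word (row_word y) K2 (sign_word y)) *
      \<psi> (letter_word K1 (col_word x) (sign_word x) @ ((a, j), s) # ((b, l), t) # letter_word K2 (col_word y) (sign_word y)))"
    by (intro sum.cong refl) simp
  finally show ?thesis .
qed

lemma convolution_append:
  "convolution \<phi> \<psi> (x @ y) =
    (\<Sum>K1\<in>index_lists (length x). \<Sum>K2\<in>index_lists (length y).
      \<phi> (letter_word (row_word x) K1 (sign_word x) @ letter_word (row_word y) K2 (sign_word y)) *
      \<psi> (letter_word K1 (col_word x) (sign_word x) @ letter_word K2 (col_word y) (sign_word y)))"
  by (simp add: convolution_def sum_index_lists_add)

lemma sum_move_inner:
  "(\<Sum>c\<in>C. \<Sum>x\<in>X. \<Sum>y\<in>Y. \<Sum>a\<in>A. \<Sum>b\<in>B. f c x y a b) =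
    (\<Sum>x\<in>X. \<Sum>y\<in>Y. \<Sum>a\<in>A. \<Sum>b\<in>B. \<Sum>c\<in>C. f c x y a b)"
  by (subst sum.swap, intro sum.cong refl, subst sum.swap, intro sum.cong refl,
      subst sum.swap, intro sum.cong refl, rule sum.swap)

lemma sum_diagonal:
  fixes g :: "'n::finite \<Rightarrow> 'n \<Rightarrow> complex"
  shows "(\<Sum>a\<in>UNIV. \<Sum>b\<in>UNIV. if a = b then g a b else 0) = (\<Sum>a\<in>UNIV. g a a)"
  by simp

text \<open>For a row relation the sum over c falls on \<psi> and forces the two inner indices to
  agree, which leaves a row relation for \<phi>. For a column relation the roles are
  exchanged.\<close>

lemma unitary_functional_convolution:
  assumes \<phi>: "unitary_functional \<phi>" and \<psi>: "unitary_functional \<psi>"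
  shows "unitary_functional (convolution \<phi> \<psi>)"
  unfolding unitary_functional_def
proof (intro allI conjI)
  fix x y :: "'a letter list" and i j s
  let ?X = "index_lists (length x) :: 'a list set" and ?Y = "index_lists (length y) :: 'a list set"
  let ?rx = "\<lambda>K. letter_word (row_word x) K (sign_word x)" and ?ry = "\<lambda>L. letter_word (row_word y) L (sign_word y)"
  let ?cx = "\<lambda>K. letter_word K (col_word x) (sign_word x)" and ?cy = "\<lambda>L. letter_word L (col_word y) (sign_word y)"
  have "(\<Sum>c\<in>UNIV. convolution \<phi> \<psi> (x @ ((i, c), s) # ((j, c), \<not> s) # y)) =
    (\<Sum>K\<in>?X. \<Sum>L\<in>?Y. \<Sum>a\<in>UNIV. \<Sum>b\<in>UNIV.
      \<phi> (?rx K @ ((i, a), s) # ((j, b), \<not> s) # ?ry L) *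
      (\<Sum>c\<in>UNIV. \<psi> (?cx K @ ((a, c), s) # ((b, c), \<not> s) # ?cy L)))"
    unfolding convolution_split by (subst sum_move_inner) (simp only: sum_distrib_left)
  also have "\<dots> = (\<Sum>K\<in>?X. \<Sum>L\<in>?Y. \<Sum>a\<in>UNIV. \<Sum>b\<in>UNIV.
      if a = b then \<phi> (?rx K @ ((i, a), s) # ((j, b), \<not> s) # ?ry L) * \<psi> (?cx K @ ?cy L) else 0)"
    by (intro sum.cong refl) (simp add: unitary_functionalD[OF \<psi>])
  also have "\<dots> = (\<Sum>K\<in>?X. \<Sum>L\<in>?Y.
      (\<Sum>a\<in>UNIV. \<phi> (?rx K @ ((i, a), s) # ((j, a), \<not> s) # ?ry L)) * \<psi> (?cx K @ ?cy L))"
    unfolding sum_diagonal sum_distrib_right ..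
  also have "\<dots> = (if i = j then convolution \<phi> \<psi> (x @ y) else 0)"
    by (simp add: unitary_functionalD[OF \<phi>] convolution_append)
  finally show "(\<Sum>c\<in>UNIV. convolution \<phi> \<psi> (x @ ((i, c), s) # ((j, c), \<not> s) # y)) =
      (if i = j then convolution \<phi> \<psi> (x @ y) else 0)" .
  have "(\<Sum>c\<in>UNIV. convolution \<phi> \<psi> (x @ ((c, i), s) # ((c, j), \<not> s) # y)) =
    (\<Sum>K\<in>?X. \<Sum>L\<in>?Y. \<Sum>a\<in>UNIV. \<Sum>b\<in>UNIV.
      (\<Sum>c\<in>UNIV. \<phi> (?rx K @ ((c, a), s) # ((c, b), \<not> s) # ?ry L)) *
      \<psi> (?cx K @ ((a, i), s) # ((b, j), \<not> s) # ?cy L))"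
    unfolding convolution_split by (subst sum_move_inner) (simp only: sum_distrib_right)
  also have "\<dots> = (\<Sum>K\<in>?X. \<Sum>L\<in>?Y. \<Sum>a\<in>UNIV. \<Sum>b\<in>UNIV.
      if a = b then \<phi> (?rx K @ ?ry L) * \<psi> (?cx K @ ((a, i), s) # ((b, j), \<not> s) # ?cy L) else 0)"
    by (intro sum.cong refl) (simp add: unitary_functionalD[OF \<phi>])
  also have "\<dots> = (\<Sum>K\<in>?X. \<Sum>L\<in>?Y.
      \<phi> (?rx K @ ?ry L) * (\<Sum>a\<in>UNIV. \<psi> (?cx K @ ((a, i), s) # ((a, j), \<not> s) # ?cy L)))"
    unfolding sum_diagonal sum_distrib_left ..
  also have "\<dots> = (if i = j then convolution \<phi> \<psi> (x @ y) else 0)"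
    by (simp add: unitary_functionalD[OF \<psi>] convolution_append)
  finally show "(\<Sum>c\<in>UNIV. convolution \<phi> \<psi> (x @ ((c, i), s) # ((c, j), \<not> s) # y)) =
      (if i = j then convolution \<phi> \<psi> (x @ y) else 0)" .
qed

lemma unitary_functional_unitary_coeff:
  assumes "U \<in> carrier unitary_group"
  shows "unitary_functional (unitary_coeff U)"
  unfolding unitary_functional_def
proof (intro allI conjI)
  fix x y :: "'a letter list" and i j s
  have app: "unitary_coeff U (x @ ((a, b), s) # ((c, d), \<not> s) # y) =
      unitary_coeff U x * unitary_coeff U y * (signed_entry U s a b * signed_entry U (\<not> s) c d)" for a b c d
    by (simp add: unitary_coeff_def)
  show "(\<Sum>c\<in>UNIV. unitary_coeff U (x @ ((i, c), s) # ((j, c), \<not> s) # y)) =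
      (if i = j then unitary_coeff U (x @ y) else 0)"
    unfolding app sum_distrib_left[symmetric] signed_entry_rows[OF assms]
    by (simp add: unitary_coeff_def)
  show "(\<Sum>c\<in>UNIV. unitary_coeff U (x @ ((c, i), s) # ((c, j), \<not> s) # y)) =
      (if i = j then unitary_coeff U (x @ y) else 0)"
    unfolding app sum_distrib_left[symmetric] signed_entry_cols[OF assms]
    by (simp add: unitary_coeff_def)
qed

text \<open>Off-diagonal letters are killed, so at most one c survives; its two letters are inverse
  to each other and do not affect the weight.\<close>

lemma unitary_functional_torus_coeff: "unitary_functional (torus_coeff h)"
  unfolding unitary_functional_def
proof (intro allI conjI)
  fix x y :: "'a letter list" and i j s
  have "torus_coeff h (x @ ((i, c), s) # ((j, c), \<not> s) # y) =
      (if c = i then (if i = j then torus_coeff h (x @ y) else 0) else 0)" for c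
    by (auto simp: torus_coeff_def weight_cancel append_eq_append_conv)
  then show "(\<Sum>c\<in>UNIV. torus_coeff h (x @ ((i, c), s) # ((j, c), \<not> s) # y)) =
      (if i = j then torus_coeff h (x @ y) else 0)" by simp
  have "torus_coeff h (x @ ((c, i), s) # ((c, j), \<not> s) # y) =
      (if c = i then (if i = j then torus_coeff h (x @ y) else 0) else 0)" for c
    by (auto simp: torus_coeff_def weight_cancel append_eq_append_conv)
  then show "(\<Sum>c\<in>UNIV. torus_coeff h (x @ ((c, i), s) # ((c, j), \<not> s) # y)) =
      (if i = j then torus_coeff h (x @ y) else 0)" by simp
qed

section \<open>Evaluation of the structure maps\<close>

lemma with_coalgebra_simps [simp]:
  "carrier (with_coalgebra A D e) = carrier A" "mult (with_coalgebra A D e) = mult A"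
  "one (with_coalgebra A D e) = one A" "zero (with_coalgebra A D e) = zero A"
  "add (with_coalgebra A D e) = add A" "smult (with_coalgebra A D e) = smult A"
  "star (with_coalgebra A D e) = star A" "comult (with_coalgebra A D e) = D"
  "counit (with_coalgebra A D e) = e"
  by (simp_all add: with_coalgebra_def star_alg.defs hopf_star_alg.defs)

abbreviation free_class :: "'n::finite star_poly \<Rightarrow> 'n star_poly set" where
  "free_class f \<equiv> free_unitary_ideal +>\<^bsub>free_star_alg\<^esub> f"

abbreviation word_class :: "'n::finite letter list \<Rightarrow> 'n star_poly set" where
  "word_class w \<equiv> free_class (single w 1)"

lemma star_algebra_free_unitary_alg: "star_algebra free_unitary_alg"
proof -
  interpret star_ideal "free_unitary_ideal :: 'a star_poly set" free_star_alg
    by (rule star_ideal_free_unitary)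
  show "star_algebra (free_unitary_alg :: 'a star_poly set star_alg)"
    unfolding free_unitary_alg_def by (rule star_algebra_quot)
qed

lemma free_class_carrier: "free_class f \<in> carrier free_unitary_alg"
proof -
  interpret star_ideal "free_unitary_ideal :: 'a star_poly set" free_star_alg
    by (rule star_ideal_free_unitary)
  show ?thesis unfolding free_unitary_alg_def by (rule coset_carrier) simp
qed

lemma word_class_mult: "word_class x \<otimes>\<^bsub>free_unitary_alg\<^esub> word_class y = word_class (x @ y)"
proof -
  interpret star_ideal "free_unitary_ideal :: 'a star_poly set" free_star_alg
    by (rule star_ideal_free_unitary)
  show ?thesis unfolding free_unitary_alg_def by (subst coset_mult) auto
qed

lemma word_class_one: "\<one>\<^bsub>free_unitary_alg\<^esub> = word_class []"
proof -
  interpret star_ideal "free_unitary_ideal :: 'a star_poly set" free_star_alg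
    by (rule star_ideal_free_unitary)
  show "\<one>\<^bsub>free_unitary_alg\<^esub> = (word_class [] :: 'a star_poly set)"
    unfolding free_unitary_alg_def coset_one by simp
qed

lemma word_class_star: "star free_unitary_alg (word_class x) = word_class (adjoint_word x)"
proof -
  interpret star_ideal "free_unitary_ideal :: 'a star_poly set" free_star_alg
    by (rule star_ideal_free_unitary)
  show ?thesis unfolding free_unitary_alg_def by (subst coset_star) auto
qed

section \<open>The comultiplication on words\<close>

text \<open>A preferred representative of the coproduct of a word, taken before bilinearity is
  imposed, on which product functionals can be evaluated term by term.\<close>

definition word_comult ::
  "'n::finite letter list \<Rightarrow> ('n star_poly set \<times> 'n star_poly set \<Rightarrow>\<^sub>0 complex)" where
  "word_comult w = (\<Sum>K\<in>index_lists (length w).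
     single (word_class (letter_word (row_word w) K (sign_word w)),
       word_class (letter_word K (col_word w) (sign_word w))) 1)"

lemma word_comult_letter:
  "word_comult [((i, j), s)] =
    (\<Sum>k\<in>UNIV. single (word_class [((i, k), s)], word_class [((k, j), s)]) 1)"
  by (simp add: word_comult_def sum_index_lists_Suc letter_word_def)

lemma word_comult_Cons:
  "conv_prod (mult (free_unitary_alg \<times>\<times> free_unitary_alg)) (word_comult [((i, j), s)]) (word_comult w) =
    word_comult (((i, j), s) # w)"
proof -
  have "conv_prod (mult (free_unitary_alg \<times>\<times> free_unitary_alg)) (word_comult [((i, j), s)]) (word_comult w) =
    (\<Sum>k\<in>UNIV. \<Sum>K\<in>index_lists (length w).
      single (word_class (((i, k), s) # letter_word (row_word w) K (sign_word w)),
        word_class (((k, j), s) # letter_word K (col_word w) (sign_word w))) 1)"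
    unfolding word_comult_letter word_comult_def[of w] conv_prod_sum_left conv_prod_sum_right
    by (subst sum.swap) (simp add: word_class_mult)
  then show ?thesis
    by (simp add: word_comult_def[of "_ # _"] sum_index_lists_Suc)
qed

lemma word_comult_carrier: "word_comult w \<in> carrier (formal_sums free_unitary_alg free_unitary_alg)"
proof -
  have "keys (word_comult w) \<subseteq> (\<Union>K\<in>index_lists (length w).
     keys (single (word_class (letter_word (row_word w) K (sign_word w)),
       word_class (letter_word K (col_word w) (sign_word w))) (1::complex)))"
    unfolding word_comult_def by (rule keys_sum)
  then show ?thesis
    by (auto simp: formal_sums_carrier free_class_carrier dest!: subsetD)
qed

lemma star_word_comult:
  "conj_ext (map_prod (star free_unitary_alg) (star free_unitary_alg)) (word_comult [((i, j), s)]) =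
    word_comult [((i, j), \<not> s)]"
  by (simp add: word_comult_letter conj_ext_sum word_class_star)

text \<open>The entries of the comultiplied matrix, their adjoints and products are all computed on
  representatives; the null ideal is a star-ideal, so the results collect into one class.\<close>

lemma comult_eval:
  fixes f :: "'n::finite star_poly"
  defines "A \<equiv> free_unitary_alg :: 'n star_poly set star_alg"
  defines "T \<equiv> tensor_alg A A"
  shows "star_poly_eval T (\<lambda>i j. \<Oplus>\<^bsub>T\<^esub>k\<in>UNIV. simple_tensor A A (free_unitary_gen i k) (free_unitary_gen k j)) f =
    tensor_class A A (\<Sum>w\<in>keys f. scale (lookup f w) (word_comult w))"
proof -
  have A: "star_algebra A" unfolding A_def by (rule star_algebra_free_unitary_alg)
  interpret N: star_ideal "tensor_null A A" "formal_sums A A" by (rule star_ideal_tensor_null[OF A A])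
  have T: "T = quot_star_alg (formal_sums A A) (tensor_null A A)"
    by (simp add: T_def tensor_alg_def)
  have car: "word_comult w \<in> carrier (formal_sums A A)" for w
    unfolding A_def by (rule word_comult_carrier)
  have fin: "finsum T (\<lambda>i. N.coset (g i)) S = N.coset (\<Sum>i\<in>S. g i)"
    if "finite S" "\<And>i. i \<in> S \<Longrightarrow> g i \<in> carrier (formal_sums A A)" for g :: "'i \<Rightarrow> _" and S
  proof -
    have "finsum T (\<lambda>i. N.coset (g i)) S = N.coset (finsum (formal_sums A A) g S)"
      unfolding T by (rule N.finsum_coset) (use that in auto)
    also have "finsum (formal_sums A A) g S = (\<Sum>i\<in>S. g i)"
      unfolding formal_sums_def
      by (rule finsum_star_monoid_alg) (use that in \<open>auto simp: formal_sums_def\<close>)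
    finally show ?thesis .
  qed
  define v where "v i j = (\<Oplus>\<^bsub>T\<^esub>k\<in>UNIV. simple_tensor A A (free_unitary_gen i k) (free_unitary_gen k j))" for i j
  have v: "v i j = N.coset (word_comult [((i, j), False)])" for i j
  proof -
    have "v i j = finsum T (\<lambda>k. N.coset (single (word_class [((i, k), False)], word_class [((k, j), False)]) 1)) UNIV"
      by (simp add: v_def simple_tensor_def tensor_class_def free_unitary_gen_def free_gen_def)
    also have "\<dots> = N.coset (\<Sum>k\<in>UNIV. single (word_class [((i, k), False)], word_class [((k, j), False)]) 1)"
      by (rule fin) (auto simp: formal_sums_carrier A_def free_class_carrier)
    finally show ?thesis by (simp add: word_comult_letter)
  qed
  have letter: "(if s then star T (v i j) else v i j) = N.coset (word_comult [((i, j), s)])" for i j s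
    using N.coset_star[OF car[of "[((i, j), False)]"]] star_word_comult[of i j False]
    by (simp add: v T formal_sums_def A_def)
  have word: "foldr (\<lambda>((i, j), s) y. (if s then star T (v i j) else v i j) \<otimes>\<^bsub>T\<^esub> y) w \<one>\<^bsub>T\<^esub> = N.coset (word_comult w)" for w
  proof (induction w)
    case Nil
    show ?case
      unfolding T N.coset_one
      by (simp add: formal_sums_def word_comult_def A_def word_class_one letter_word_def del: quot_star_alg_simps)
  next
    case (Cons l w)
    obtain i j s where l: "l = ((i, j), s)" by (metis surj_pair)
    have "foldr (\<lambda>((i, j), s) y. (if s then star T (v i j) else v i j) \<otimes>\<^bsub>T\<^esub> y) (l # w) \<one>\<^bsub>T\<^esub> =
      N.coset (word_comult [((i, j), s)]) \<otimes>\<^bsub>T\<^esub> N.coset (word_comult w)"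
      by (simp only: foldr.simps o_apply Cons.IH l prod.case) (simp only: letter)
    also have "\<dots> = N.coset (conv_prod (mult (A \<times>\<times> A)) (word_comult [((i, j), s)]) (word_comult w))"
      unfolding T N.coset_mult[OF car car] by (simp add: formal_sums_def)
    finally show ?case by (simp add: l word_comult_Cons A_def)
  qed
  have "star_poly_eval T v f = finsum T (\<lambda>w. N.coset (scale (lookup f w) (word_comult w)))
      (keys f)"
    unfolding star_poly_eval_def word unfolding T N.coset_smult[OF car]
    by (simp add: formal_sums_def)
  also have "\<dots> = N.coset (\<Sum>w\<in>keys f. scale (lookup f w) (word_comult w))"
    by (rule fin) (use car N.alg(3) in \<open>auto simp: formal_sums_def\<close>)
  finally show ?thesis by (simp add: v_def[abs_def] tensor_class_def)
qed

lemma tensor_pairing_comult: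
  "tensor_pairing \<alpha> \<beta> (\<Sum>w\<in>keys f. scale (lookup f w) (word_comult w)) =
    pairing (convolution (\<lambda>w. \<alpha> (word_class w)) (\<lambda>w. \<beta> (word_class w))) f"
  by (simp add: tensor_pairing_def pairing_sum pairing_scale word_comult_def pairing_def[of _ f] convolution_def)

section \<open>Evaluation at unitary matrices\<close>

lemma signed_entry_mult:
  "signed_entry (U ** V) s i j = (\<Sum>k\<in>UNIV. signed_entry U s i k * signed_entry V s k j)"
  by (simp add: signed_entry_def matrix_matrix_mult_def)

lemma unitary_coeff_Cons:
  "unitary_coeff U (((i, j), s) # w) = signed_entry U s i j * unitary_coeff U w"
  by (simp add: unitary_coeff_def)

lemma unitary_coeff_mult:
  "unitary_coeff (U ** V) w = convolution (unitary_coeff U) (unitary_coeff V) w"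
proof (induction w)
  case Nil
  show ?case by (simp add: unitary_coeff_def convolution_def letter_word_def)
next
  case (Cons l w)
  obtain i j s where l: "l = ((i, j), s)" by (metis surj_pair)
  have "unitary_coeff (U ** V) (l # w) =
      (\<Sum>k\<in>UNIV. signed_entry U s i k * signed_entry V s k j) * convolution (unitary_coeff U) (unitary_coeff V) w"
    by (simp add: l unitary_coeff_Cons signed_entry_mult Cons.IH)
  also have "\<dots> = convolution (unitary_coeff U) (unitary_coeff V) (l # w)"
    by (simp add: l convolution_def sum_index_lists_Suc sum_product unitary_coeff_Cons mult_ac)
  finally show ?case .
qed

lemma unitary_group_mult:
  assumes "U \<in> carrier unitary_group" "V \<in> carrier unitary_group"
  shows "U ** V \<in> carrier unitary_group"
proof -
  define adj where "adj W = (\<chi> i j. cnj (W $ j $ i))" for W :: "complex^'a^'a"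
  have a: "adj (U ** V) = adj V ** adj U"
    by (simp add: adj_def matrix_matrix_mult_def vec_eq_iff mult.commute)
  have UV: "U ** adj U = mat 1" "adj U ** U = mat 1" "V ** adj V = mat 1" "adj V ** V = mat 1"
    using assms by (auto simp: unitary_group_def Let_def adj_def)
  have "(U ** V) ** adj (U ** V) = U ** (V ** adj V) ** adj U"
    "adj (U ** V) ** (U ** V) = adj V ** (adj U ** U) ** V"
    unfolding a by (simp_all only: matrix_mul_assoc)
  then have "(U ** V) ** adj (U ** V) = mat 1" "adj (U ** V) ** (U ** V) = mat 1"
    using UV by simp_all
  then show ?thesis by (simp add: unitary_group_def Let_def adj_def)
qed

text \<open>The definition asks for a finite set of functions, while the data at hand are families
  with possible repetitions. Coefficients of equal functions are added up.\<close>

lemma representativeI: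
  assumes "f \<in> extensional (carrier G)" "continuous_on (carrier G) f" "finite S"
    and f: "\<And>x y. x \<in> carrier G \<Longrightarrow> y \<in> carrier G \<Longrightarrow> f (x \<otimes>\<^bsub>G\<^esub> y) = (\<Sum>i\<in>S. c y i * e i x)"
  shows "f \<in> representative_functions G"
  unfolding representative_functions_def
proof (intro CollectI conjI exI[of _ "e ` S"] ballI assms(1,2))
  fix y assume y: "y \<in> carrier G"
  show "\<exists>d. \<forall>x\<in>carrier G. f (x \<otimes>\<^bsub>G\<^esub> y) = (\<Sum>h\<in>e ` S. d h * h x)"
  proof (intro exI[of _ "\<lambda>h. \<Sum>i\<in>{i \<in> S. e i = h}. c y i"] ballI)
    fix x assume x: "x \<in> carrier G"
    have "(\<Sum>i\<in>S. c y i * e i x) = (\<Sum>h\<in>e ` S. \<Sum>i\<in>{i \<in> S. e i = h}. c y i * e i x)"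
      by (rule sum.image_gen[OF assms(3)])
    also have "\<dots> = (\<Sum>h\<in>e ` S. (\<Sum>i\<in>{i \<in> S. e i = h}. c y i) * h x)"
      by (intro sum.cong refl) (simp add: sum_distrib_right)
    finally show "f (x \<otimes>\<^bsub>G\<^esub> y) = (\<Sum>h\<in>e ` S. (\<Sum>i\<in>{i \<in> S. e i = h}. c y i) * h x)"
      using f[OF x y] by simp
  qed
qed (use assms(3) in simp)

lemma representative_add:
  assumes G: "\<And>x y. x \<in> carrier G \<Longrightarrow> y \<in> carrier G \<Longrightarrow> x \<otimes>\<^bsub>G\<^esub> y \<in> carrier G"
    and fg: "f \<in> representative_functions G" "g \<in> representative_functions G"
  shows "(\<lambda>x\<in>carrier G. f x + g x) \<in> representative_functions G"
proof -
  obtain F c where F: "finite F" "\<And>x y. x \<in> carrier G \<Longrightarrow> y \<in> carrier G \<Longrightarrow> f (x \<otimes>\<^bsub>G\<^esub> y) = (\<Sum>h\<in>F. c y h * h x)"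
    using fg(1) unfolding representative_functions_def by simp metis
  obtain H d where H: "finite H" "\<And>x y. x \<in> carrier G \<Longrightarrow> y \<in> carrier G \<Longrightarrow> g (x \<otimes>\<^bsub>G\<^esub> y) = (\<Sum>h\<in>H. d y h * h x)"
    using fg(2) unfolding representative_functions_def by simp metis
  have cont: "continuous_on (carrier G) f" "continuous_on (carrier G) g"
    using fg by (auto simp: representative_functions_def)
  show ?thesis
  \<comment> \<open>The disjoint union keeps the two coefficient families apart even if F and H
    overlap.\<close>
  proof (rule representativeI[where S = "F <+> H" and c = "\<lambda>y. case_sum (c y) (d y)" and e = "case_sum id id"])
    show "continuous_on (carrier G) (\<lambda>x\<in>carrier G. f x + g x)"
      using continuous_on_add[OF cont] by (rule continuous_on_eq) simp
    show "finite (F <+> H)" using F H by simp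
    show "(\<lambda>x\<in>carrier G. f x + g x) (x \<otimes>\<^bsub>G\<^esub> y) =
        (\<Sum>i\<in>F <+> H. case_sum (c y) (d y) i * case_sum id id i x)"
      if "x \<in> carrier G" "y \<in> carrier G" for x y
      using F H G that by (simp add: sum.Plus)
  qed simp
qed

lemma representative_scale:
  assumes G: "\<And>x y. x \<in> carrier G \<Longrightarrow> y \<in> carrier G \<Longrightarrow> x \<otimes>\<^bsub>G\<^esub> y \<in> carrier G"
    and f: "f \<in> representative_functions G"
  shows "(\<lambda>x\<in>carrier G. a * f x) \<in> representative_functions G"
proof -
  obtain F c where F: "finite F" "\<And>x y. x \<in> carrier G \<Longrightarrow> y \<in> carrier G \<Longrightarrow> f (x \<otimes>\<^bsub>G\<^esub> y) = (\<Sum>h\<in>F. c y h * h x)"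
    using f unfolding representative_functions_def by simp metis
  have cont: "continuous_on (carrier G) f"
    using f by (auto simp: representative_functions_def)
  show ?thesis
  proof (rule representativeI[where S = F and c = "\<lambda>y h. a * c y h" and e = id])
    show "continuous_on (carrier G) (\<lambda>x\<in>carrier G. a * f x)"
      using continuous_on_mult_left[OF cont, of a] by (rule continuous_on_eq) simp
  qed (use F G in \<open>simp_all add: sum_distrib_left mult.assoc\<close>)
qed

lemma unitary_coeff_continuous: "continuous_on S (\<lambda>U. unitary_coeff U w)"
proof (induction w)
  case (Cons l w)
  obtain i j s where l: "l = ((i, j), s)" by (metis surj_pair)
  have "continuous_on S (\<lambda>U. signed_entry U s i j)"
    unfolding signed_entry_def by (cases s) (auto intro!: continuous_intros)
  from continuous_on_mult[OF this Cons.IH] show ?case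
    by (simp add: l unitary_coeff_def)
qed (simp add: unitary_coeff_def)

text \<open>Multiplicativity expresses all right translates through the finitely many coefficients
  with the same rows and signs.\<close>

lemma unitary_coeff_representative:
  "(\<lambda>U\<in>carrier unitary_group. unitary_coeff U w) \<in> representative_functions (unitary_group :: (complex^'n::finite^'n) monoid)"
proof (rule representativeI[where S = "index_lists (length w)"
    and e = "\<lambda>K U. unitary_coeff U (letter_word (row_word w) K (sign_word w))"
    and c = "\<lambda>V K. unitary_coeff V (letter_word K (col_word w) (sign_word w))"])
  show "continuous_on (carrier unitary_group) (\<lambda>U\<in>carrier (unitary_group :: (complex^'n^'n) monoid). unitary_coeff U w)"
    using unitary_coeff_continuous by (rule continuous_on_eq) simp
  fix U V :: "complex^'n^'n" assume UV: "U \<in> carrier unitary_group" "V \<in> carrier unitary_group"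
  then have "U \<otimes>\<^bsub>unitary_group\<^esub> V \<in> carrier unitary_group" "U \<otimes>\<^bsub>unitary_group\<^esub> V = U ** V"
    using unitary_group_mult by (auto simp: unitary_group_def)
  then show "(\<lambda>U\<in>carrier unitary_group. unitary_coeff U w) (U \<otimes>\<^bsub>unitary_group\<^esub> V) =
    (\<Sum>K\<in>index_lists (length w). unitary_coeff V (letter_word K (col_word w) (sign_word w)) *
       unitary_coeff U (letter_word (row_word w) K (sign_word w)))"
    by (simp add: unitary_coeff_mult convolution_def mult.commute)
qed auto

lemma O_compact_group_simps [simp]:
  "carrier (O_compact_group G) = representative_functions G"
  "mult (O_compact_group G) = (\<lambda>f g. \<lambda>x\<in>carrier G. f x * g x)"
  "one (O_compact_group G) = (\<lambda>x\<in>carrier G. 1)" "zero (O_compact_group G) = (\<lambda>x\<in>carrier G. 0)"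
  "add (O_compact_group G) = (\<lambda>f g. \<lambda>x\<in>carrier G. f x + g x)"
  "smult (O_compact_group G) = (\<lambda>c f. \<lambda>x\<in>carrier G. c * f x)"
  "star (O_compact_group G) = (\<lambda>f. \<lambda>x\<in>carrier G. cnj (f x))"
  by (simp_all add: O_compact_group_def representative_alg_def Let_def)

text \<open>This allows \<open>finsum\<close> over representative functions to be unfolded and
  evaluated pointwise in \<open>unitary_eval\<close>.\<close>

lemma abelian_monoid_O_compact_group:
  assumes G: "\<And>x y. x \<in> carrier G \<Longrightarrow> y \<in> carrier G \<Longrightarrow> x \<otimes>\<^bsub>G\<^esub> y \<in> carrier G"
  shows "abelian_monoid (O_compact_group G)"
proof (rule abelian_monoidI)
  show "\<zero>\<^bsub>O_compact_group G\<^esub> \<in> carrier (O_compact_group G)"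
    unfolding O_compact_group_simps
  proof (rule representativeI[where S = "{}"])
    show "continuous_on (carrier G) (\<lambda>x\<in>carrier G. 0 :: complex)"
      using continuous_on_const[of "carrier G" 0] by (rule continuous_on_eq) simp
  qed (use G in auto)
next
  fix f assume f: "f \<in> carrier (O_compact_group G)"
  then have "f x = undefined" if "x \<notin> carrier G" for x
    using that by (auto simp: representative_functions_def extensional_def)
  then show "\<zero>\<^bsub>O_compact_group G\<^esub> \<oplus>\<^bsub>O_compact_group G\<^esub> f = f" by auto
qed (auto simp: representative_add[OF G] add_ac)

lemma unitary_eval:
  fixes U :: "complex^'n::finite^'n"
  assumes U: "U \<in> carrier unitary_group"
  shows "star_poly_eval (O_compact_group unitary_group) (\<lambda>i j. \<lambda>U\<in>carrier unitary_group. U $ i $ j) f U =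
    pairing (unitary_coeff U) f"
proof -
  let ?K = "O_compact_group (unitary_group :: (complex^'n^'n) monoid)"
  let ?v = "\<lambda>i j. \<lambda>U\<in>carrier (unitary_group :: (complex^'n^'n) monoid). U $ i $ j"
  let ?c = "\<lambda>w. \<lambda>U\<in>carrier (unitary_group :: (complex^'n^'n) monoid). unitary_coeff U w"
  have G: "x \<otimes>\<^bsub>unitary_group\<^esub> y \<in> carrier unitary_group"
    if "x \<in> carrier unitary_group" "y \<in> carrier unitary_group" for x y :: "complex^'n^'n"
    using unitary_group_mult[OF that] by (simp add: unitary_group_def)
  interpret abelian_monoid ?K by (rule abelian_monoid_O_compact_group[OF G])
  have word: "foldr (\<lambda>((i, j), s) y. (if s then star ?K (?v i j) else ?v i j) \<otimes>\<^bsub>?K\<^esub> y) w \<one>\<^bsub>?K\<^esub> = ?c w" for w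
  proof (induction w)
    case (Cons l w)
    obtain i j s where l: "l = ((i, j), s)" by (metis surj_pair)
    show ?case
      using Cons.IH by (auto simp: l unitary_coeff_def signed_entry_def fun_eq_iff)
  qed (simp add: unitary_coeff_def)
  have closed: "x \<odot>\<^bsub>?K\<^esub> ?c w \<in> carrier ?K" for x w
    using representative_scale[OF G unitary_coeff_representative] by simp
  have "finite S \<Longrightarrow> finsum ?K (\<lambda>w. g w \<odot>\<^bsub>?K\<^esub> ?c w) S U = (\<Sum>w\<in>S. g w * unitary_coeff U w)" for g S
  proof (induction S rule: finite_induct)
    case empty
    show ?case using U by simp
  next
    case (insert x S)
    have "finsum ?K (\<lambda>w. g w \<odot>\<^bsub>?K\<^esub> ?c w) (insert x S) =
        (g x \<odot>\<^bsub>?K\<^esub> ?c x) \<oplus>\<^bsub>?K\<^esub> finsum ?K (\<lambda>w. g w \<odot>\<^bsub>?K\<^esub> ?c w) S"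
      using insert.hyps closed by (intro finsum_insert) (auto simp del: O_compact_group_simps)
    then have "finsum ?K (\<lambda>w. g w \<odot>\<^bsub>?K\<^esub> ?c w) (insert x S) U =
        (g x \<odot>\<^bsub>?K\<^esub> ?c x) U + finsum ?K (\<lambda>w. g w \<odot>\<^bsub>?K\<^esub> ?c w) S U"
      using U by (simp only: O_compact_group_simps restrict_apply')
    moreover have "(g x \<odot>\<^bsub>?K\<^esub> ?c x) U = g x * unitary_coeff U x"
      using U by simp
    ultimately show ?case unfolding sum.insert[OF insert.hyps] insert.IH by (simp only:)
  qed
  then show ?thesis
    unfolding star_poly_eval_def word by (simp add: pairing_def)
qed

section \<open>Coefficients in the dual of the free group\<close>

lemma free_group_inv: "m_inv free_group [(i, s)] = [(i, \<not> s)]"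
proof -
  have red: "[a] \<in> reduced_words" for a :: "'a \<times> bool"
    by (simp add: reduced_words_def)
  \<comment> \<open>\<open>m_inv\<close> is a definite description; the first of its two equations
    already determines y.\<close>
  have "(THE y. y \<in> reduced_words \<and> foldr cons_reduced [(i, s)] y = [] \<and> foldr cons_reduced y [(i, s)] = []) = [(i, \<not> s)]"
  proof (rule the_equality)
    show "[(i, \<not> s)] \<in> reduced_words \<and> foldr cons_reduced [(i, s)] [(i, \<not> s)] = [] \<and>
        foldr cons_reduced [(i, \<not> s)] [(i, s)] = []"
      using red by (simp add: cons_reduced_def)
  next
    fix y assume "y \<in> reduced_words \<and> foldr cons_reduced [(i, s)] y = [] \<and> foldr cons_reduced y [(i, s)] = []"
    then have "cons_reduced (i, s) y = []" by simp
    then show "y = [(i, \<not> s)]"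
      by (cases y) (auto simp: cons_reduced_def split: if_splits)
  qed
  then show ?thesis by (simp add: m_inv_def free_group_def)
qed

lemma free_group_simps [simp]:
  "carrier free_group = reduced_words" "mult free_group = foldr cons_reduced" "one free_group = []"
  by (simp_all add: free_group_def)

text \<open>Evaluation reads only the fields of the star-algebra, so the added coalgebra structure
  is invisible to it.\<close>

lemma star_poly_eval_with_coalgebra: "star_poly_eval (with_coalgebra A D e) v f = star_poly_eval A v f"
  unfolding star_poly_eval_def finsum_def finprod_def by (simp cong: if_cong)

lemma torus_eval:
  fixes f :: "'n::finite star_poly"
  shows "lookup (star_poly_eval (O_dual free_group)
      (\<lambda>i j. if i = j then single [(i, False)] 1 else 0) f) h = pairing (torus_coeff h) f"
proof -
  let ?M = "star_monoid_alg (free_group :: ('n \<times> bool) list monoid) (m_inv free_group)"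
  let ?v = "\<lambda>i j :: 'n. if i = j then single [(i, False)] (1::complex) else 0"
  let ?e = "\<lambda>w. if row_word w = col_word w then single (weight (sign_word w) (row_word w)) (1::complex) else 0"
  have fields: "star_poly_eval (O_dual free_group) ?v f = star_poly_eval ?M ?v f"
    unfolding O_dual_def Let_def star_poly_eval_with_coalgebra ..
  have word: "foldr (\<lambda>((i, j), s) y. (if s then star ?M (?v i j) else ?v i j) \<otimes>\<^bsub>?M\<^esub> y) w \<one>\<^bsub>?M\<^esub> = ?e w" for w
  proof (induction w)
    case Nil
    show ?case by (simp add: weight_def)
  next
    case (Cons l w)
    obtain i j s where l: "l = ((i, j), s)" by (metis surj_pair)
    have "(if s then star ?M (?v i j) else ?v i j) = (if i = j then single [(i, s)] 1 else 0)"
      by (simp add: free_group_inv)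
    then show ?case
      using Cons.IH by (auto simp: l weight_Cons)
  qed
  have "star_poly_eval ?M ?v f = (\<Sum>w\<in>keys f. scale (lookup f w) (?e w))"
    unfolding star_poly_eval_def word star_monoid_alg_simps(6)
    by (rule finsum_star_monoid_alg)
       (auto simp: scale_single weight_reduced lookup_scale in_keys_iff lookup_single when_def split: if_splits)
  also have "lookup \<dots> h = pairing (torus_coeff h) f"
    unfolding lookup_sum lookup_scale pairing_def
    by (intro sum.cong refl) (auto simp: torus_coeff_def lookup_single when_def)
  finally show ?thesis unfolding fields .
qed

section \<open>Topological generation\<close>

lemma O_free_unitary_simps [simp]:
  "carrier O_free_unitary = carrier free_unitary_alg" "add O_free_unitary = add free_unitary_alg"
  "smult O_free_unitary = smult free_unitary_alg"
  by (simp_all add: O_free_unitary_def Let_def)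

section \<open>Classes of polynomials and their representatives\<close>

lemma free_class_add: "free_class f \<oplus>\<^bsub>free_unitary_alg\<^esub> free_class g = free_class (f + g)"
proof -
  interpret star_ideal "free_unitary_ideal :: 'a star_poly set" free_star_alg
    by (rule star_ideal_free_unitary)
  show ?thesis unfolding free_unitary_alg_def by (subst coset_add) auto
qed

lemma free_class_smult:
  "c \<odot>\<^bsub>free_unitary_alg\<^esub> free_class f = free_class (scale c f)"
proof -
  interpret star_ideal "free_unitary_ideal :: 'a star_poly set" free_star_alg
    by (rule star_ideal_free_unitary)
  show ?thesis unfolding free_unitary_alg_def by (subst coset_smult) auto
qed

lemma free_class_cases:
  assumes "X \<in> carrier free_unitary_alg"
  obtains f where "X = free_class f"
proof -
  interpret star_ideal "free_unitary_ideal :: 'a star_poly set" free_star_alg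
    by (rule star_ideal_free_unitary)
  show ?thesis using assms that unfolding free_unitary_alg_def by (rule coset_cases)
qed

lemma free_class_eq_iff: "free_class f = free_class g \<longleftrightarrow> f - g \<in> free_unitary_ideal"
proof -
  interpret star_ideal "free_unitary_ideal :: 'a star_poly set" free_star_alg
    by (rule star_ideal_free_unitary)
  have "f \<ominus>\<^bsub>free_star_alg\<^esub> g \<in> free_unitary_ideal \<longleftrightarrow> free_class f = free_class g"
    by (rule quotient_eq_iff_same_a_r_cos) (auto intro: ideal_axioms)
  then show ?thesis by (simp add: a_minus_free)
qed

text \<open>The maps out of the free unitary algebra in the definitions are evaluated at a chosen
  representative; it differs from any other one by an element of the defining ideal.\<close>

lemma pairing_some_representative:
  assumes "unitary_functional \<xi>"
  shows "pairing \<xi> (SOME g. g \<in> free_class f) = pairing \<xi> f"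
proof -
  interpret star_ideal "free_unitary_ideal :: 'a star_poly set" free_star_alg
    by (rule star_ideal_free_unitary)
  have "f \<in> free_class f" by (rule a_rcos_self) simp
  then have "(SOME g. g \<in> free_class f) \<in> free_class f" by (rule someI)
  then obtain h where "h \<in> free_unitary_ideal" "(SOME g. g \<in> free_class f) = h + f"
    by (elim mem_cosetE) simp
  then show ?thesis
    using unitary_functional_kills_ideal[OF assms] by (simp add: pairing_add)
qed

text \<open>In the concrete targets below a scalar multiple by 0 is visibly zero, so this form
  yields the value at 0 from linearity alone.\<close>

lemma linear_map_zero_smult:
  assumes "linear_map A B f" "star_algebra A"
  shows "f \<zero>\<^bsub>A\<^esub> = 0 \<odot>\<^bsub>B\<^esub> f \<zero>\<^bsub>A\<^esub>"
proof -
  interpret ring A by (rule star_algebraD(1)[OF assms(2)])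
  have "f (0 \<odot>\<^bsub>A\<^esub> \<zero>\<^bsub>A\<^esub>) = 0 \<odot>\<^bsub>B\<^esub> f \<zero>\<^bsub>A\<^esub>"
    using assms(1) by (simp add: linear_map_def)
  then show ?thesis using star_algebraD(8)[OF assms(2), of "\<zero>\<^bsub>A\<^esub>"] by simp
qed

section \<open>The annihilator of the kernel of a common quotient\<close>

locale common_quotient =
  fixes Q :: "'q hopf_star_alg" and p :: "'n::finite star_poly set \<Rightarrow> 'q"
  assumes card_ge_2: "CARD('n) \<ge> 2"
    and quotient: "hopf_star_quotient O_free_unitary Q p"
    and through_unitary: "factors_through O_free_unitary Q p (O_compact_group unitary_group) to_unitary_group"
    and through_torus: "factors_through O_free_unitary Q p (O_dual free_group) to_free_torus"
begin

lemma star_algebra_Q: "star_algebra Q"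
  using quotient by (simp add: hopf_star_quotient_def hopf_star_algebra_def)

lemma linear_p: "linear_map free_unitary_alg Q p"
  using quotient by (simp add: hopf_star_quotient_def hopf_star_hom_def star_alg_hom_def linear_map_def)

lemma linear_comult: "linear_map Q (tensor_alg Q Q) (comult Q)"
  using quotient by (simp add: hopf_star_quotient_def hopf_star_algebra_def star_alg_hom_def)

definition P :: "'n star_poly \<Rightarrow> 'q" where "P f = p (free_class f)"

lemma P_carrier: "P f \<in> carrier Q"
  using linear_p free_class_carrier by (auto simp: linear_map_def P_def)

lemma P_add: "P (f + g) = P f \<oplus>\<^bsub>Q\<^esub> P g"
  using linear_p free_class_carrier[of f] free_class_carrier[of g]
  by (simp add: linear_map_def P_def free_class_add[symmetric])

lemma P_smult: "P (scale c f) = c \<odot>\<^bsub>Q\<^esub> P f"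
  using linear_p free_class_carrier[of f] by (simp add: linear_map_def P_def free_class_smult[symmetric])

lemma P_surj: "q \<in> carrier Q \<Longrightarrow> \<exists>f. P f = q"
proof -
  assume "q \<in> carrier Q"
  then have "q \<in> p ` carrier free_unitary_alg"
    using quotient by (simp add: hopf_star_quotient_def)
  then show ?thesis by (auto simp: P_def elim!: free_class_cases)
qed

lemma P_diff_zero:
  assumes "P f = P g"
  shows "P (f - g) = \<zero>\<^bsub>Q\<^esub>"
proof -
  have "f - g = f + scale (- 1) g"
    by (rule poly_mapping_eqI) (simp add: lookup_add lookup_minus lookup_scale)
  then have "P (f - g) = P g \<oplus>\<^bsub>Q\<^esub> (- 1) \<odot>\<^bsub>Q\<^esub> P g"
    by (simp only: P_add P_smult assms)
  also have "\<dots> = 1 \<odot>\<^bsub>Q\<^esub> P g \<oplus>\<^bsub>Q\<^esub> (- 1) \<odot>\<^bsub>Q\<^esub> P g"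
    by (simp only: star_algebraD(7)[OF star_algebra_Q P_carrier])
  also have "\<dots> = (1 + - 1) \<odot>\<^bsub>Q\<^esub> P g"
    by (rule star_algebraD(4)[OF star_algebra_Q P_carrier, symmetric])
  also have "\<dots> = \<zero>\<^bsub>Q\<^esub>"
    using star_algebraD(8)[OF star_algebra_Q P_carrier] by simp
  finally show ?thesis .
qed

lemma P_ideal: "f \<in> free_unitary_ideal \<Longrightarrow> P f = \<zero>\<^bsub>Q\<^esub>"
proof -
  assume "f \<in> free_unitary_ideal"
  then have "free_class f = free_class 0" by (simp add: free_class_eq_iff)
  then have "P f = P 0" by (simp only: P_def)
  then show ?thesis using P_diff_zero[of f 0] by simp
qed

definition \<Phi> :: "('n letter list \<Rightarrow> complex) set" where
  "\<Phi> = {\<xi>. \<forall>f. P f = \<zero>\<^bsub>Q\<^esub> \<longrightarrow> pairing \<xi> f = 0}"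

lemma \<Phi>_unitary_functional:
  assumes "\<xi> \<in> \<Phi>"
  shows "unitary_functional \<xi>"
proof -
  have "pairing \<xi> f = 0" if "f \<in> free_unitary_ideal" for f
    using assms P_ideal[OF that] by (simp add: \<Phi>_def)
  from this[OF sandwich_rel_in_ideal(1)] this[OF sandwich_rel_in_ideal(2)] show ?thesis
    unfolding unitary_functional_def by (auto simp: pairing_diff pairing_sum split: if_splits)
qed

lemma \<Phi>_descends:
  assumes "\<xi> \<in> \<Phi>"
  shows "\<exists>\<alpha>. linear_map Q complex_alg \<alpha> \<and> (\<forall>f. \<alpha> (P f) = pairing \<xi> f)"
proof -
  \<comment> \<open>Any preimage under P serves, since two of them differ by an element of the
    kernel, on which \<xi> vanishes.\<close>
  define \<alpha> where "\<alpha> q = pairing \<xi> (SOME f. P f = q)" for q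
  have \<alpha>: "\<alpha> (P f) = pairing \<xi> f" for f
  proof -
    have "P (SOME g. P g = P f) = P f" by (rule someI) (rule refl)
    then have "P ((SOME g. P g = P f) - f) = \<zero>\<^bsub>Q\<^esub>" by (rule P_diff_zero)
    then have "pairing \<xi> ((SOME g. P g = P f) - f) = 0" using assms unfolding \<Phi>_def by blast
    then show ?thesis by (simp add: \<alpha>_def pairing_diff)
  qed
  have "linear_map Q complex_alg \<alpha>"
    unfolding linear_map_def
  proof (intro conjI ballI allI)
    fix x y assume "x \<in> carrier Q" "y \<in> carrier Q"
    then obtain f g where "x = P f" "y = P g" using P_surj by metis
    then show "\<alpha> (x \<oplus>\<^bsub>Q\<^esub> y) = \<alpha> x \<oplus>\<^bsub>complex_alg\<^esub> \<alpha> y"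
      using \<alpha>[of "f + g"] by (simp add: P_add \<alpha> pairing_add)
  next
    fix c x assume "x \<in> carrier Q"
    then obtain f where "x = P f" using P_surj by metis
    then show "\<alpha> (c \<odot>\<^bsub>Q\<^esub> x) = c \<odot>\<^bsub>complex_alg\<^esub> \<alpha> x"
      using \<alpha>[of "scale c f"] by (simp add: P_smult \<alpha> pairing_scale)
  qed simp
  then show ?thesis using \<alpha> by blast
qed

text \<open>If P f = 0, compatibility of p with the comultiplications makes the image of the
  coproduct of f under p \<otimes> p zero. Applying the functionals induced by \<phi> and \<psi> to
  its two legs gives the pairing with the convolution.\<close>

lemma \<Phi>_convolution:
  assumes \<phi>: "\<phi> \<in> \<Phi>" and \<psi>: "\<psi> \<in> \<Phi>"
  shows "convolution \<phi> \<psi> \<in> \<Phi>"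
  unfolding \<Phi>_def
proof (intro CollectI allI impI)
  fix f assume f: "P f = \<zero>\<^bsub>Q\<^esub>"
  let ?A = "free_unitary_alg :: 'n star_poly set star_alg"
  obtain \<alpha> where \<alpha>: "linear_map Q complex_alg \<alpha>" "\<And>f. \<alpha> (P f) = pairing \<phi> f"
    using \<Phi>_descends[OF \<phi>] by blast
  obtain \<beta> where \<beta>: "linear_map Q complex_alg \<beta>" "\<And>f. \<beta> (P f) = pairing \<psi> f"
    using \<Phi>_descends[OF \<psi>] by blast
  \<comment> \<open>The comultiplication is defined through this representative, so the pairing is
    computed at g and carried over to f at the end.\<close>
  define g where "g = (SOME g. g \<in> free_class f)"
  define r where "r = (\<Sum>w\<in>keys g. scale (lookup g w) (word_comult w))"
  have r: "r \<in> carrier (formal_sums ?A ?A)"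
  proof -
    have "keys (scale c (word_comult w)) \<subseteq> carrier ?A \<times> carrier ?A" for c and w :: "'n letter list"
      using keys_scale[of c "word_comult w"] word_comult_carrier[of w] by (auto simp: formal_sums_carrier)
    then show ?thesis
      unfolding r_def formal_sums_carrier mem_Collect_eq
      by (intro subset_trans[OF keys_sum] UN_least)
  qed
  have "comult O_free_unitary (free_class f) = tensor_class ?A ?A r"
    using comult_eval[of g] by (simp add: O_free_unitary_def Let_def induced_hom_def g_def r_def)
  moreover have "comult Q (p (free_class f)) = tensor_map Q Q p p (comult O_free_unitary (free_class f))"
    using quotient free_class_carrier[of f] by (simp add: hopf_star_quotient_def hopf_star_hom_def)
  moreover have "comult Q \<zero>\<^bsub>Q\<^esub> = \<zero>\<^bsub>tensor_alg Q Q\<^esub>"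
  proof -
    interpret Q: ring Q by (rule star_algebraD(1)[OF star_algebra_Q])
    interpret N: star_ideal "tensor_null Q Q" "formal_sums Q Q"
      by (rule star_ideal_tensor_null[OF star_algebra_Q star_algebra_Q])
    have "comult Q \<zero>\<^bsub>Q\<^esub> \<in> carrier (tensor_alg Q Q)"
      using linear_comult by (auto simp: linear_map_def)
    then show ?thesis
      using linear_map_zero_smult[OF linear_comult star_algebra_Q] star_algebraD(8)[OF N.star_algebra_quot]
      by (simp only: tensor_alg_def)
  qed
  ultimately have "tensor_map Q Q p p (tensor_class ?A ?A r) = \<zero>\<^bsub>tensor_alg Q Q\<^esub>"
    using f by (simp add: P_def)
  then have "tensor_pairing (\<alpha> \<circ> p) (\<beta> \<circ> p) r = 0"
    by (rule tensor_map_zero[OF star_algebra_free_unitary_alg star_algebra_Q linear_p \<alpha>(1) \<beta>(1) r])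
  moreover have "(\<lambda>w. (\<alpha> \<circ> p) (word_class w)) = \<phi>" "(\<lambda>w. (\<beta> \<circ> p) (word_class w)) = \<psi>"
    using \<alpha>(2)[of "single _ 1"] \<beta>(2)[of "single _ 1"] by (auto simp: P_def)
  ultimately have "pairing (convolution \<phi> \<psi>) g = 0"
    by (simp only: r_def tensor_pairing_comult)
  then show "pairing (convolution \<phi> \<psi>) f = 0"
    using pairing_some_representative[OF unitary_functional_convolution[OF
        \<Phi>_unitary_functional[OF \<phi>] \<Phi>_unitary_functional[OF \<psi>]]] by (simp add: g_def)
qed

lemma \<Phi>_unitary_coeff:
  assumes U: "U \<in> carrier unitary_group"
  shows "unitary_coeff U \<in> \<Phi>"
  unfolding \<Phi>_def
proof (intro CollectI allI impI)
  fix f assume f: "P f = \<zero>\<^bsub>Q\<^esub>"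
  obtain \<rho> where \<rho>: "hopf_star_hom Q (O_compact_group unitary_group) \<rho>"
    "\<And>x. x \<in> carrier free_unitary_alg \<Longrightarrow> to_unitary_group x = \<rho> (p x)"
    using through_unitary by (auto simp: factors_through_def)
  have "pairing (unitary_coeff U) f = pairing (unitary_coeff U) (SOME g. g \<in> free_class f)"
    by (rule pairing_some_representative[OF unitary_functional_unitary_coeff[OF U], symmetric])
  also have "\<dots> = to_unitary_group (free_class f) U"
    by (simp only: to_unitary_group_def induced_hom_def unitary_eval[OF U])
  also have "\<dots> = \<rho> \<zero>\<^bsub>Q\<^esub> U"
    using \<rho>(2)[OF free_class_carrier] f by (simp add: P_def)
  also have "\<rho> \<zero>\<^bsub>Q\<^esub> = 0 \<odot>\<^bsub>O_compact_group unitary_group\<^esub> \<rho> \<zero>\<^bsub>Q\<^esub>"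
    using \<rho>(1) by (intro linear_map_zero_smult star_algebra_Q) (simp add: hopf_star_hom_def star_alg_hom_def)
  also have "(0 \<odot>\<^bsub>O_compact_group unitary_group\<^esub> \<rho> \<zero>\<^bsub>Q\<^esub>) U = 0"
    using U by simp
  finally show "pairing (unitary_coeff U) f = 0" .
qed

lemma \<Phi>_torus_coeff: "torus_coeff h \<in> \<Phi>"
  unfolding \<Phi>_def
proof (intro CollectI allI impI)
  fix f assume f: "P f = \<zero>\<^bsub>Q\<^esub>"
  obtain \<rho> where \<rho>: "hopf_star_hom Q (O_dual free_group) \<rho>"
    "\<And>x. x \<in> carrier free_unitary_alg \<Longrightarrow> to_free_torus x = \<rho> (p x)"
    using through_torus by (auto simp: factors_through_def)
  have "pairing (torus_coeff h) f = pairing (torus_coeff h) (SOME g. g \<in> free_class f)"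
    by (rule pairing_some_representative[OF unitary_functional_torus_coeff, symmetric])
  also have "\<dots> = lookup (to_free_torus (free_class f)) h"
    by (simp only: to_free_torus_def induced_hom_def torus_eval)
  also have "\<dots> = lookup (\<rho> \<zero>\<^bsub>Q\<^esub>) h"
    using \<rho>(2)[OF free_class_carrier] f by (simp add: P_def)
  also have "\<rho> \<zero>\<^bsub>Q\<^esub> = 0 \<odot>\<^bsub>O_dual free_group\<^esub> \<rho> \<zero>\<^bsub>Q\<^esub>"
    using \<rho>(1) by (intro linear_map_zero_smult star_algebra_Q) (simp add: hopf_star_hom_def star_alg_hom_def)
  also have "lookup \<dots> h = 0"
    by (simp add: O_dual_def Let_def lookup_scale)
  finally show "pairing (torus_coeff h) f = 0" .
qed

text \<open>By definition \<Phi> annihilates the kernel of P, so \<open>annihilated_in_J\<close>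
  with J the defining ideal applies.\<close>

lemma P_kernel:
  assumes "P f = \<zero>\<^bsub>Q\<^esub>"
  shows "f \<in> free_unitary_ideal"
proof -
  interpret J: star_ideal "free_unitary_ideal :: 'n star_poly set" free_star_alg
    by (rule star_ideal_free_unitary)
  interpret unitary_relations \<Phi> free_unitary_ideal
  proof
    show "0 \<in> (free_unitary_ideal :: 'n star_poly set)"
      using additive_subgroup.zero_closed[OF J.is_additive_subgroup] by simp
    show "f + g \<in> free_unitary_ideal" if "f \<in> free_unitary_ideal" "g \<in> free_unitary_ideal" for f g :: "'n star_poly"
      using additive_subgroup.a_closed[OF J.is_additive_subgroup that] by simp
    show "scale c f \<in> free_unitary_ideal" if "f \<in> free_unitary_ideal" for c and f :: "'n star_poly"
      using J.smult_in_ideal[OF that] by simp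
    show "pairing \<phi> f = 0" if "\<phi> \<in> \<Phi>" "f \<in> free_unitary_ideal" for \<phi> f
      using unitary_functional_kills_ideal[OF \<Phi>_unitary_functional] that by blast
  qed (fact card_ge_2 | erule (1) \<Phi>_convolution | erule \<Phi>_unitary_coeff
      | rule \<Phi>_torus_coeff sandwich_rel_in_ideal)+
  show ?thesis
    using assms by (intro annihilated_in_J) (simp add: \<Phi>_def)
qed

lemma p_injective: "inj_on p (carrier O_free_unitary)"
proof (rule inj_onI)
  fix X Y :: "'n star_poly set"
  assume "X \<in> carrier O_free_unitary" "Y \<in> carrier O_free_unitary" and eq: "p X = p Y"
  then obtain f g where X: "X = free_class f" and Y: "Y = free_class g"
    by (auto elim!: free_class_cases)
  have "P (f - g) = \<zero>\<^bsub>Q\<^esub>" using eq by (intro P_diff_zero) (simp add: P_def X Y)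
  then show "X = Y" unfolding X Y free_class_eq_iff by (rule P_kernel)
qed

end

theorem theorem3p1:
  assumes "CARD('n::finite) \<ge> 2"
  shows "topologically_generated_by TYPE('q) (O_free_unitary :: 'n star_poly set hopf_star_alg)
           (O_compact_group unitary_group) to_unitary_group
           (O_dual free_group) to_free_torus"
  unfolding topologically_generated_by_def
  using common_quotient.p_injective[OF common_quotient.intro[OF assms]] by blast

end
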